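(* Let $K(x,y)=\sum_{n=0}^M\sum_{j=0}^nk_{nj}x^{n-j}y^j\in L^2(T^2)$ be a polynomial kernel, and consider a well-posed Volterra integral equation of the first kind with limits of integration $0$ to $1-x$, $\int_0^{1-x}K(x,y)u(y)\,dy=g(x)$, written in coefficient space of $\tilde{\mathbf P}^{(1,0)}(x)$ as $\mathrm{V}_K\mathbf u=\mathbf g$ and rewritten as $$\tilde{\mathrm V}_K\mathbf u=\mathbf q,\qquad q(x)=\frac{g(x)}{1-x},$$ with $\mathbf q\in\ell^2_1$. Then the sparse spectral method, which approximates $\mathbf u$ by the solution $\mathbf u_n$ of the truncated system $\mathcal P_n\tilde{\mathrm V}_K\mathcal P_n^{\mathsf T}\mathbf u_n=\mathcal P_n\mathbf q$, converges (i.e. $\mathbf u_n\to\mathbf u$ in $\ell^2$ as $n\to\infty$), subject to the symbol of the Toeplitz part of $\tilde{\mathrm V}_K$ not vanishing on the complex unit circle. This condition on the symbol is fulfilled if and only if $K(x,x)\ne0$ for all $x\in[0,1]$.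
   Context: $T^2=\{(x,y):0\le x,\ 0\le y\le 1-x\}$. $\ell^2_\lambda$, $\lambda\ge0$, is the Banach space of sequences with norm $\|\mathbf u\|_{\ell^2_\lambda}=\sqrt{\sum_{n=0}^\infty\left((1+n)^\lambda|u_n|\right)^2}<\infty$. $\tilde P_n^{(\alpha,\beta)}(x)=P_n^{(\alpha,\beta)}(2x-1)$, $n\ge0$, are the Jacobi polynomials (standard normalization) shifted to $[0,1]$, orthogonal with weight $(1-x)^\alpha x^\beta$. Functions on $[0,1]$ are expanded as $f(x)=\sum_nf_n\tilde P_n^{(1,0)}(x)$ with coefficient vector $\mathbf f=(f_0,f_1,\dots)^{\mathsf T}$; $\mathbf u,\mathbf g,\mathbf q$ are the coefficient vectors of $u,g,q$. $\mathrm{J}$ maps the coefficients of $f(x)$ to those of $xf(x)$; $\mathbb 1$ is the identity. $\mathrm{D}:\ell^2\to\ell^2_1$, with inverse $\mathrm{D}^{-1}:\ell^2_1\to\ell^2$, is the diagonal operator with $n$-th diagonal entry $\frac{(-1)^{n+1}}{n}$, $n=1,2,\dots$; it maps the coefficients of $u$ to those of $\frac{1}{1-x}\int_0^{1-x}u(y)\,dy$. $\mathrm{V}_K$ maps the coefficients of $u$ to those of $\int_0^{1-x}K(x,y)u(y)\,dy$, and the unweighted operator $\tilde{\mathrm V}_K:\ell^2\to\ell^2_1$ is defined by $(\mathbb 1-\mathrm{J})\tilde{\mathrm V}_K=\mathrm{V}_K$, i.e. $$\tilde{\mathrm V}_K=\mathrm{D}\left(\mathrm{D}^{-1}\sum_{n=0}^M\sum_{j=0}^nk_{nj}\,\mathrm{J}^{n-j}\,\mathrm{D}\,\mathrm{J}^{j}\right).$$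 It can be written $\tilde{\mathrm V}_K=\mathrm{D}(\mathrm{T}[f]+\mathcal K)$ with $\mathcal K$ compact and $\mathrm{T}[f]$ the Toeplitz operator on $\ell^2$ with matrix $(\hat f_{i-j})_{i,j\ge0}$, where $\hat f_k$ are the Fourier coefficients of a continuous function $f$ on the complex unit circle; "the symbol of the Toeplitz part of $\tilde{\mathrm V}_K$" means this $f$. $\mathcal P_n$ truncates a coefficient vector to its first $n$ entries, and $\mathcal P_n^{\mathsf T}$ is its transpose; the truncated system is an $n\times n$ linear system. Well-posedness includes the assumption that the given equation has a solution.
   Formalization: The condition "K(x,x)≠0 for all x in [0,1]" is corrected to "K(1-x,x)≠0 for all x in [0,1]": with limits 0 to 1-x the literal condition fails, e.g. K=x+y-1/2 has constant symbol 1/2 although K(1/4,1/4)=0. *)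

theory Defs
  imports "HOL-Analysis.Analysis"
begin

section \<open>Weighted sequence spaces\<close>

definition ell :: "real \<Rightarrow> (nat \<Rightarrow> complex) set" where
  "ell lam = {u. summable (\<lambda>n. ((1 + real n) powr lam * cmod (u n))\<^sup>2)}"

definition ell_norm :: "real \<Rightarrow> (nat \<Rightarrow> complex) \<Rightarrow> real" where
  "ell_norm lam u = sqrt (\<Sum>n. ((1 + real n) powr lam * cmod (u n))\<^sup>2)"

text \<open>The space of square-summable sequences is \<open>ell 0\<close>.\<close>

definition ell2_tendsto :: "(nat \<Rightarrow> nat \<Rightarrow> complex) \<Rightarrow> (nat \<Rightarrow> complex) \<Rightarrow> bool" where
  "ell2_tendsto X L \<longleftrightarrow> L \<in> ell 0 \<and> (\<forall>\<^sub>F n in sequentially. X n \<in> ell 0) \<and>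
     (\<lambda>n. ell_norm 0 (\<lambda>i. X n i - L i)) \<longlonglongrightarrow> 0"

definition compact_op :: "((nat \<Rightarrow> complex) \<Rightarrow> (nat \<Rightarrow> complex)) \<Rightarrow> bool" where
  "compact_op C \<longleftrightarrow>
     (\<forall>u\<in>ell 0. C u \<in> ell 0) \<and>
     (\<forall>u\<in>ell 0. \<forall>v\<in>ell 0. C (\<lambda>i. u i + v i) = (\<lambda>i. C u i + C v i)) \<and>
     (\<forall>a. \<forall>u\<in>ell 0. C (\<lambda>i. a * u i) = (\<lambda>i. a * C u i)) \<and>
     (\<forall>(X :: nat \<Rightarrow> nat \<Rightarrow> complex) B. (\<forall>n. X n \<in> ell 0 \<and> ell_norm 0 (X n) \<le> B) \<longrightarrow>
        (\<exists>(r :: nat \<Rightarrow> nat) L. strict_mono r \<and> ell2_tendsto (\<lambda>n. C (X (r n))) L))"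

section \<open>Shifted Jacobi polynomials and expansions\<close>

text \<open>Standard normalization, i.e. the value at 1 is \<open>(n + \<alpha>) gchoose n\<close>.\<close>

definition jacobi :: "real \<Rightarrow> real \<Rightarrow> nat \<Rightarrow> real \<Rightarrow> real" where
  "jacobi \<alpha> \<beta> n t =
     (\<Sum>s\<le>n. ((real n + \<alpha>) gchoose (n - s)) * ((real n + \<beta>) gchoose s) *
             ((t - 1) / 2) ^ s * ((t + 1) / 2) ^ (n - s))"

definition shifted_jacobi :: "real \<Rightarrow> real \<Rightarrow> nat \<Rightarrow> real \<Rightarrow> real" where
  "shifted_jacobi \<alpha> \<beta> n x = jacobi \<alpha> \<beta> n (2 * x - 1)"

abbreviation P10 :: "nat \<Rightarrow> real \<Rightarrow> real" where
  "P10 \<equiv> shifted_jacobi 1 0"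

text \<open>\<open>has_expansion f a\<close>: \<open>f = (\<Sum>n. a n * P10 n)\<close>, with convergence in the
  \<open>L\<^sup>2\<close> space of \<open>[0,1]\<close> for the orthogonality weight \<open>1 - x\<close>.\<close>

definition has_expansion :: "(real \<Rightarrow> complex) \<Rightarrow> (nat \<Rightarrow> complex) \<Rightarrow> bool" where
  "has_expansion f a \<longleftrightarrow>
     f \<in> borel_measurable (lebesgue_on {0..1}) \<and>
     integrable (lebesgue_on {0..1}) (\<lambda>x. (1 - x) * (cmod (f x))\<^sup>2) \<and>
     (\<lambda>N. LINT x|lebesgue_on {0..1}.
         (1 - x) * (cmod (f x - (\<Sum>n<N. a n * of_real (P10 n x))))\<^sup>2) \<longlonglongrightarrow> 0"

text \<open>Expansion coefficient of a (polynomial) function, by orthogonality.\<close>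

definition P10_coeff :: "(real \<Rightarrow> real) \<Rightarrow> nat \<Rightarrow> real" where
  "P10_coeff f m =
     integral {0..1} (\<lambda>x. (1 - x) * f x * P10 m x) /
     integral {0..1} (\<lambda>x. (1 - x) * (P10 m x)\<^sup>2)"

section \<open>Operators in coefficient space\<close>

text \<open>Multiplication by \<open>x\<close>. By the three-term recurrence only the terms with
  \<open>n \<le> m + 1\<close> are nonzero, so the series is a finite sum.\<close>

definition J_op :: "(nat \<Rightarrow> complex) \<Rightarrow> nat \<Rightarrow> complex" where
  "J_op u = (\<lambda>m. \<Sum>n. of_real (P10_coeff (\<lambda>x. x * P10 n x) m) * u n)"

text \<open>The diagonal entries \<open>(-1) ^ (n + 1) / n\<close>, \<open>n = 1, 2, \<dots>\<close>, with the index shifted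
  to start at 0.\<close>

definition D_op :: "(nat \<Rightarrow> complex) \<Rightarrow> nat \<Rightarrow> complex" where
  "D_op u = (\<lambda>m. (- 1) ^ m / of_nat (m + 1) * u m)"

definition D_inv :: "(nat \<Rightarrow> complex) \<Rightarrow> nat \<Rightarrow> complex" where
  "D_inv u = (\<lambda>m. (- 1) ^ m * of_nat (m + 1) * u m)"

definition volterra_kernel :: "nat \<Rightarrow> (nat \<Rightarrow> nat \<Rightarrow> complex) \<Rightarrow> real \<Rightarrow> real \<Rightarrow> complex" where
  "volterra_kernel M k x y = (\<Sum>n\<le>M. \<Sum>j\<le>n. k n j * of_real x ^ (n - j) * of_real y ^ j)"

definition Vtilde :: "nat \<Rightarrow> (nat \<Rightarrow> nat \<Rightarrow> complex) \<Rightarrow> (nat \<Rightarrow> complex) \<Rightarrow> nat \<Rightarrow> complex" where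
  "Vtilde M k u =
     D_op (D_inv (\<lambda>m. \<Sum>n\<le>M. \<Sum>j\<le>n. k n j * (J_op ^^ (n - j)) (D_op ((J_op ^^ j) u)) m))"

section \<open>The Toeplitz part and its symbol\<close>

definition fourier_coeff :: "(complex \<Rightarrow> complex) \<Rightarrow> int \<Rightarrow> complex" where
  "fourier_coeff f l =
     integral {0..2 * pi} (\<lambda>\<theta>. f (cis \<theta>) * cis (- of_int l * \<theta>)) / of_real (2 * pi)"

definition toeplitz :: "(complex \<Rightarrow> complex) \<Rightarrow> (nat \<Rightarrow> complex) \<Rightarrow> nat \<Rightarrow> complex" where
  "toeplitz f u = (\<lambda>i. \<Sum>j. fourier_coeff f (int i - int j) * u j)"

definition is_toeplitz_symbol ::
  "((nat \<Rightarrow> complex) \<Rightarrow> nat \<Rightarrow> complex) \<Rightarrow> (complex \<Rightarrow> complex) \<Rightarrow> bool" where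
  "is_toeplitz_symbol A f \<longleftrightarrow> continuous_on (sphere 0 1) f \<and>
     (\<exists>C. compact_op C \<and> (\<forall>u\<in>ell 0. A u = D_op (\<lambda>i. toeplitz f u i + C u i)))"

text \<open>A symbol is uniquely determined on the unit circle, because a compact Toeplitz
  operator is zero.\<close>

definition toeplitz_symbol :: "((nat \<Rightarrow> complex) \<Rightarrow> nat \<Rightarrow> complex) \<Rightarrow> complex \<Rightarrow> complex" where
  "toeplitz_symbol A = (SOME f. is_toeplitz_symbol A f)"

definition symbol_nonvanishing :: "((nat \<Rightarrow> complex) \<Rightarrow> nat \<Rightarrow> complex) \<Rightarrow> bool" where
  "symbol_nonvanishing A \<longleftrightarrow> (\<forall>z\<in>sphere 0 1. toeplitz_symbol A z \<noteq> 0)"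

section \<open>The Volterra equation and the truncated systems\<close>

text \<open>The function with coefficient vector \<open>a\<close> solves the integral equation. It is
  determined by \<open>a\<close> up to null sets; the integral exists for every \<open>x > 0\<close>.\<close>

definition volterra_solution ::
  "nat \<Rightarrow> (nat \<Rightarrow> nat \<Rightarrow> complex) \<Rightarrow> (real \<Rightarrow> complex) \<Rightarrow> (nat \<Rightarrow> complex) \<Rightarrow> bool" where
  "volterra_solution M k g a \<longleftrightarrow> a \<in> ell 0 \<and>
     (\<exists>u. has_expansion u a \<and>
        (AE x in lebesgue_on {0..1}.
           (LINT y:{0..1 - x}|lebesgue. volterra_kernel M k x y * u y) = g x))"

definition well_posed ::
  "nat \<Rightarrow> (nat \<Rightarrow> nat \<Rightarrow> complex) \<Rightarrow> (real \<Rightarrow> complex) \<Rightarrow> bool" where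
  "well_posed M k g \<longleftrightarrow> (\<exists>!a. volterra_solution M k g a)"

definition trunc :: "nat \<Rightarrow> (nat \<Rightarrow> complex) \<Rightarrow> nat \<Rightarrow> complex" where
  "trunc n u = (\<lambda>i. if i < n then u i else 0)"

text \<open>Vectors of length \<open>n\<close> are represented by sequences vanishing from index \<open>n\<close> on, so
  \<open>trunc n\<close> serves both as the truncation and, on its range, as its transpose.\<close>

definition truncated_solution ::
  "nat \<Rightarrow> (nat \<Rightarrow> nat \<Rightarrow> complex) \<Rightarrow> (nat \<Rightarrow> complex) \<Rightarrow> nat \<Rightarrow> (nat \<Rightarrow> complex) \<Rightarrow> bool" where
  "truncated_solution M k q n v \<longleftrightarrow>
     trunc n v = v \<and> trunc n (Vtilde M k (trunc n v)) = trunc n q"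

text \<open>The truncated systems may be singular for small \<open>n\<close>; convergence means that they are
  uniquely solvable for all large \<open>n\<close> and that the solutions tend to \<open>a\<close>.\<close>

definition spectral_method_converges ::
  "nat \<Rightarrow> (nat \<Rightarrow> nat \<Rightarrow> complex) \<Rightarrow> (nat \<Rightarrow> complex) \<Rightarrow> (nat \<Rightarrow> complex) \<Rightarrow> bool" where
  "spectral_method_converges M k q a \<longleftrightarrow>
     (\<forall>\<^sub>F n in sequentially. \<exists>!v. truncated_solution M k q n v) \<and>
     (\<forall>v. (\<forall>\<^sub>F n in sequentially. truncated_solution M k q n (v n)) \<longrightarrow> ell2_tendsto v a)"

text \<open>For the limits \<open>0\<close> to \<open>1 - x\<close> the diagonal of the kernel is where \<open>y\<close> equals the
  upper limit of integration, so the condition written \<open>K(x,x) \<noteq> 0\<close> for an equation with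
  limits \<open>0\<close> to \<open>x\<close> reads \<open>K(1 - x, x) \<noteq> 0\<close> here. It cannot be taken literally: the symbol
  at \<open>cis \<theta>\<close> is \<open>K(1 - s, s)\<close> with \<open>s = (1 + cos \<theta>) / 2\<close>, so \<open>x + y - 1/2\<close> has the
  constant symbol \<open>1/2\<close> although \<open>K(1/4, 1/4) = 0\<close>, and \<open>x - y + 1/2\<close> has
  \<open>K(x,x) = 1/2\<close> but a symbol vanishing at \<open>s = 3/4\<close>.\<close>

end

theory Submission
  imports Defs "HOL-Complex_Analysis.Great_Picard" "HOL-Library.Function_Algebras"
    "HOL-Computational_Algebra.Fundamental_Theorem_Algebra" "HOL-Real_Asymp.Real_Asymp"
begin

text \<open>
  Write the operator as \<open>D A\<close>. By the three-term recurrence, \<open>J\<close> is \<open>\<sigma> = (S + 2 + S\<^sup>*) / 4\<close> up to a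
  compact operator, \<open>S\<close> being the right shift, and \<open>D\<^sup>-\<^sup>1 J D\<close> is \<open>1 - \<sigma>\<close>. Hence \<open>A\<close> is \<open>p(\<sigma>)\<close> up to a
  compact operator, where \<open>p(s) = K(1 - s, s)\<close>, and its symbol at \<open>cis \<theta>\<close> is \<open>p((1 + cos \<theta>) / 2)\<close>.
  If \<open>p\<close> has no zero in \<open>[0, 1]\<close>, every linear factor \<open>\<sigma> - r\<close> of \<open>p(\<sigma>)\<close> is a multiple of
  \<open>(1 - \<rho> S\<^sup>*) (1 - \<rho> S)\<close> with \<open>\<bar>\<rho>\<bar> < 1\<close>. Up to compact operators all lower triangular factors may be
  moved to the left, and the finite sections of a lower triangular times an upper triangular
  operator are bounded below by the triangle inequality. A weak compactness argument carries this
  bound over to the finite sections of \<open>A\<close>, because \<open>A\<close> is injective: an element of its kernel is,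
  by the Riesz-Fischer theorem, the coefficient vector of a solution of the homogeneous integral
  equation, which well-posedness excludes.
\<close>

text \<open>The entries of D tend to 0, so the finite sections of \<open>Vtilde\<close> have no
  uniform lower bound. The estimates are made for A; a diagonal operator with nonzero entries
  commutes with truncation, so the truncated systems are equivalent. The order of the triangular
  factors matters: the first n entries of the image under a lower triangular operator depend only on
  the first n entries of the argument, and an upper triangular operator preserves vectors supported
  there. Truncation therefore splits a product lower times upper, but in general not upper times
  lower. What a root yields directly is upper times lower; exchanging two factors costs an operator
  of rank at most one. The sign (-1)^n in D, which turns x into 1 - x, comes from the reflection
  that integration up to 1 - x brings into the eigenvalue relation of the polynomials. The symbol is
  picked by a choice operator, so its uniqueness on the circle has to be proved as well. The norm of
  \<open>ell 0\<close> dominates the weighted L2 norm of the expanded function, hence every element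
  of the kernel of A belongs to an actual function.\<close>

lemma ell_0_iff: "u \<in> ell 0 \<longleftrightarrow> summable (\<lambda>i. (cmod (u i))\<^sup>2)"
  by (simp add: ell_def)

lemma ell_norm_0: "ell_norm 0 u = sqrt (\<Sum>i. (cmod (u i))\<^sup>2)"
  by (simp add: ell_norm_def)

lemma ell_norm_nonneg: "u \<in> ell lam \<Longrightarrow> 0 \<le> ell_norm lam u"
  unfolding ell_def ell_norm_def by (auto intro: suminf_nonneg)

lemma ell_norm_power2: "u \<in> ell 0 \<Longrightarrow> (ell_norm 0 u)\<^sup>2 = (\<Sum>i. (cmod (u i))\<^sup>2)"
  by (simp add: ell_norm_0 ell_0_iff suminf_nonneg)

lemma L2_set_le_ell_norm:
  assumes "u \<in> ell 0"
  shows "L2_set (\<lambda>i. cmod (u i)) {..<N} \<le> ell_norm 0 u"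
  using assms unfolding L2_set_def ell_norm_0 ell_0_iff
  by (intro real_sqrt_le_mono sum_le_suminf) auto

text \<open>Bounds on finite initial segments, uniform in their length, give membership and norm
  estimate at once; Minkowski's inequality and the limit lemmas below thereby reduce to facts about
  \<open>L2_set\<close>.\<close>

lemma ell_0_I:
  assumes "\<And>N. L2_set (\<lambda>i. cmod (u i)) {..<N} \<le> B"
  shows "u \<in> ell 0" and "ell_norm 0 u \<le> B"
proof -
  have B: "0 \<le> B"
    using assms[of 0] by simp
  have le: "(\<Sum>i<N. (cmod (u i))\<^sup>2) \<le> B\<^sup>2" for N
    using assms[of N] unfolding L2_set_def by (metis real_sqrt_le_iff real_sqrt_unique B)
  show u: "u \<in> ell 0"
    unfolding ell_0_iff by (rule bounded_imp_summable[where B = "B\<^sup>2"])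
      (use le[of "Suc _"] in \<open>auto simp: lessThan_Suc_atMost\<close>)
  have "(\<Sum>i. (cmod (u i))\<^sup>2) \<le> B\<^sup>2"
    using u le unfolding ell_0_iff by (intro suminf_le_const) auto
  then show "ell_norm 0 u \<le> B"
    unfolding ell_norm_0 using B by (simp add: real_le_lsqrt)
qed

lemma ell_0_add:
  assumes "u \<in> ell 0" "v \<in> ell 0"
  shows "(\<lambda>i. u i + v i) \<in> ell 0"
    and "ell_norm 0 (\<lambda>i. u i + v i) \<le> ell_norm 0 u + ell_norm 0 v"
proof -
  have "L2_set (\<lambda>i. cmod (u i + v i)) {..<N} \<le> ell_norm 0 u + ell_norm 0 v" for N
  proof -
    have "L2_set (\<lambda>i. cmod (u i + v i)) {..<N} \<le> L2_set (\<lambda>i. cmod (u i) + cmod (v i)) {..<N}"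
      by (intro L2_set_mono norm_triangle_ineq) auto
    also have "\<dots> \<le> L2_set (\<lambda>i. cmod (u i)) {..<N} + L2_set (\<lambda>i. cmod (v i)) {..<N}"
      by (rule L2_set_triangle_ineq)
    finally show ?thesis
      using L2_set_le_ell_norm[OF assms(1), of N] L2_set_le_ell_norm[OF assms(2), of N] by linarith
  qed
  from ell_0_I[OF this] show "(\<lambda>i. u i + v i) \<in> ell 0"
    and "ell_norm 0 (\<lambda>i. u i + v i) \<le> ell_norm 0 u + ell_norm 0 v" by auto
qed

lemma ell_0_scale:
  assumes "u \<in> ell 0"
  shows "(\<lambda>i. c * u i) \<in> ell 0" and "ell_norm 0 (\<lambda>i. c * u i) = cmod c * ell_norm 0 u"
  using assms unfolding ell_0_iff ell_norm_0
  by (auto simp: norm_mult power_mult_distrib suminf_mult real_sqrt_mult intro: summable_mult)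

lemma ell_0_diff:
  assumes "u \<in> ell 0" "v \<in> ell 0"
  shows "(\<lambda>i. u i - v i) \<in> ell 0"
    and "ell_norm 0 (\<lambda>i. u i - v i) \<le> ell_norm 0 u + ell_norm 0 v"
  using ell_0_add[OF assms(1) ell_0_scale(1)[OF assms(2), of "-1"]] ell_0_scale(2)[OF assms(2), of "-1"]
  by auto

lemma ell_norm_diff_ge:
  assumes "u \<in> ell 0" "v \<in> ell 0"
  shows "ell_norm 0 u - ell_norm 0 v \<le> ell_norm 0 (\<lambda>i. u i - v i)"
  using ell_0_add(2)[OF ell_0_diff(1)[OF assms] assms(2)] by simp

lemma ell_norm_minus_commute: "ell_norm 0 (\<lambda>i. u i - v i) = ell_norm 0 (\<lambda>i. v i - u i)"
  by (simp add: ell_norm_0 norm_minus_commute)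

lemma ell_0_mono:
  assumes "v \<in> ell 0" "\<And>i. cmod (u i) \<le> cmod (v i)"
  shows "u \<in> ell 0" and "ell_norm 0 u \<le> ell_norm 0 v"
proof -
  have "L2_set (\<lambda>i. cmod (u i)) {..<N} \<le> ell_norm 0 v" for N
    using L2_set_mono[of "{..<N}" "\<lambda>i. cmod (u i)" "\<lambda>i. cmod (v i)"] assms
      L2_set_le_ell_norm[OF assms(1), of N] by fastforce
  from ell_0_I[OF this] show "u \<in> ell 0" and "ell_norm 0 u \<le> ell_norm 0 v" by auto
qed

lemma cmod_le_ell_norm:
  assumes "u \<in> ell 0"
  shows "cmod (u i) \<le> ell_norm 0 u"
proof -
  have "cmod (u i) \<le> L2_set (\<lambda>i. cmod (u i)) {..<Suc i}"
    by (rule member_le_L2_set) auto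
  then show ?thesis
    using L2_set_le_ell_norm[OF assms, of "Suc i"] by linarith
qed

lemma ell_norm_0_zero [simp]: "ell_norm 0 (\<lambda>i. 0) = 0" "(\<lambda>i. 0) \<in> ell 0"
  by (auto simp: ell_norm_0 ell_0_iff)

lemma ell_norm_eq_0D:
  assumes "u \<in> ell 0" "ell_norm 0 u = 0"
  shows "u = (\<lambda>i. 0)"
  using cmod_le_ell_norm[OF assms(1)] assms(2) by (auto simp: fun_eq_iff)

lemma ell_0_finite_support:
  assumes "\<And>i. i \<ge> n \<Longrightarrow> u i = 0"
  shows "u \<in> ell 0"
  unfolding ell_0_iff by (rule summable_finite[of "{..<n}"]) (use assms in auto)

text \<open>Each finite segment passes to the limit, so the norm is lower semicontinuous under
  coordinatewise convergence.\<close>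

lemma ell_0_pointwise_limit:
  assumes "\<And>n. X n \<in> ell 0 \<and> ell_norm 0 (X n) \<le> B" "\<And>i. (\<lambda>n. X n i) \<longlonglongrightarrow> u i"
  shows "u \<in> ell 0" and "ell_norm 0 u \<le> B"
proof -
  have "L2_set (\<lambda>i. cmod (u i)) {..<N} \<le> B" for N
  proof (rule tendsto_upperbound)
    show "(\<lambda>n. L2_set (\<lambda>i. cmod (X n i)) {..<N}) \<longlonglongrightarrow> L2_set (\<lambda>i. cmod (u i)) {..<N}"
      unfolding L2_set_def by (intro tendsto_intros assms)
    show "\<forall>\<^sub>F n in sequentially. L2_set (\<lambda>i. cmod (X n i)) {..<N} \<le> B"
      by (intro always_eventually allI order_trans[OF L2_set_le_ell_norm]) (use assms(1) in auto)
  qed auto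
  from ell_0_I[OF this] show "u \<in> ell 0" and "ell_norm 0 u \<le> B" by auto
qed

text \<open>Weak sequential compactness of balls: for bounded sequences coordinatewise convergence
  plays the role of weak convergence, and a diagonal subsequence provides it.\<close>

lemma ell_0_bounded_subseq:
  assumes "\<And>n. X n \<in> ell 0 \<and> ell_norm 0 (X n) \<le> B"
  obtains r u where "strict_mono (r :: nat \<Rightarrow> nat)" "\<And>i. (\<lambda>n. X (r n) i) \<longlonglongrightarrow> u i"
    "u \<in> ell 0" "ell_norm 0 u \<le> B"
proof -
  have "cmod (X n i) \<le> B" for n i
    using cmod_le_ell_norm[of "X n" i] assms[of n] by linarith
  from function_convergent_subsequence[of "UNIV :: nat set" X B, OF countableI_type this]
  obtain r where r: "strict_mono r" "\<And>i. i \<in> UNIV \<Longrightarrow> \<exists>l. (\<lambda>n. X (r n) i) \<longlonglongrightarrow> l"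
    by blast
  then obtain u where u: "\<And>i. (\<lambda>n. X (r n) i) \<longlonglongrightarrow> u i"
    using choice[of "\<lambda>i l. (\<lambda>n. X (r n) i) \<longlonglongrightarrow> l"] by auto
  have "u \<in> ell 0" "ell_norm 0 u \<le> B"
    by (rule ell_0_pointwise_limit[of "\<lambda>n. X (r n)" B u]; use assms u in blast)+
  from that[of r u, OF r(1) u this] show ?thesis .
qed

lemma trunc_nth: "trunc n u i = (if i < n then u i else 0)"
  by (simp add: trunc_def)

lemma ell_0_trunc [simp]: "trunc n u \<in> ell 0"
  by (rule ell_0_finite_support[of n]) (simp add: trunc_nth)

lemma ell_norm_trunc_le: "u \<in> ell 0 \<Longrightarrow> ell_norm 0 (trunc n u) \<le> ell_norm 0 u"
  by (rule ell_0_mono) (auto simp: trunc_nth)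

lemma ell_0_diff_trunc_tendsto:
  assumes "u \<in> ell 0"
  shows "(\<lambda>n. ell_norm 0 (\<lambda>i. u i - trunc n u i)) \<longlonglongrightarrow> 0"
proof -
  have s: "summable (\<lambda>i. (cmod (u i))\<^sup>2)"
    using assms by (simp add: ell_0_iff)
  have "(\<Sum>i. (cmod (u i - trunc n u i))\<^sup>2) = (\<Sum>i. (cmod (u (i + n)))\<^sup>2)" for n
  proof -
    have "summable (\<lambda>i. (cmod (u i - trunc n u i))\<^sup>2)"
      using ell_0_diff(1)[OF assms ell_0_trunc] by (simp add: ell_0_iff)
    from suminf_split_initial_segment[OF this, of n] show ?thesis
      by (simp add: trunc_nth)
  qed
  moreover have "(\<lambda>n. sqrt (\<Sum>i. (cmod (u (i + n)))\<^sup>2)) \<longlonglongrightarrow> sqrt 0"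
    by (intro tendsto_real_sqrt suminf_exist_split2 s)
  ultimately show ?thesis
    by (simp add: ell_norm_0)
qed

section \<open>Operators\<close>

text \<open>Linearity is demanded on all sequences, not only on \<open>ell 0\<close>, so that
  operator identities can be rewritten without membership conditions.\<close>

definition lin_op :: "((nat \<Rightarrow> complex) \<Rightarrow> nat \<Rightarrow> complex) \<Rightarrow> bool" where
  "lin_op A \<longleftrightarrow> (\<forall>u v. A (\<lambda>i. u i + v i) = (\<lambda>i. A u i + A v i)) \<and>
     (\<forall>c u. A (\<lambda>i. c * u i) = (\<lambda>i. c * A u i))"

text \<open>Continuity for coordinatewise convergence of arbitrary sequences expresses that the rows of
  the matrix of the operator are finite.\<close>

definition bounded_op :: "((nat \<Rightarrow> complex) \<Rightarrow> nat \<Rightarrow> complex) \<Rightarrow> bool" where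
  "bounded_op A \<longleftrightarrow> lin_op A \<and>
     (\<forall>X. (\<forall>i. (\<lambda>n :: nat. X n i) \<longlonglongrightarrow> 0) \<longrightarrow> (\<forall>i. (\<lambda>n. A (X n) i) \<longlonglongrightarrow> 0)) \<and>
     (\<exists>B\<ge>0. \<forall>u\<in>ell 0. A u \<in> ell 0 \<and> ell_norm 0 (A u) \<le> B * ell_norm 0 u)"

text \<open>Compactness in the form that weakly null sequences are mapped to norm null sequences.\<close>

definition cc_op :: "((nat \<Rightarrow> complex) \<Rightarrow> nat \<Rightarrow> complex) \<Rightarrow> bool" where
  "cc_op A \<longleftrightarrow> bounded_op A \<and>
     (\<forall>X B. (\<forall>n :: nat. X n \<in> ell 0 \<and> ell_norm 0 (X n) \<le> B) \<and> (\<forall>i. (\<lambda>n. X n i) \<longlonglongrightarrow> 0) \<longrightarrow>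
        (\<lambda>n. ell_norm 0 (A (X n))) \<longlonglongrightarrow> 0)"

text \<open>Equality modulo compact operators, as in the Calkin algebra. Boundedness of both sides
  is part of the relation, so that sums, multiples, compositions and powers preserve it without side
  conditions.\<close>

definition eq_cc :: "((nat \<Rightarrow> complex) \<Rightarrow> nat \<Rightarrow> complex) \<Rightarrow> ((nat \<Rightarrow> complex) \<Rightarrow> nat \<Rightarrow> complex) \<Rightarrow> bool"
    (infix "\<simeq>" 50) where
  "A \<simeq> B \<longleftrightarrow> bounded_op A \<and> bounded_op B \<and> cc_op (\<lambda>u i. A u i - B u i)"

lemma lin_op_add: "lin_op A \<Longrightarrow> A (\<lambda>i. u i + v i) = (\<lambda>i. A u i + A v i)"
  and lin_op_scale: "lin_op A \<Longrightarrow> A (\<lambda>i. c * u i) = (\<lambda>i. c * A u i)"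
  by (auto simp: lin_op_def)

lemma lin_op_diff:
  assumes "lin_op A"
  shows "A (\<lambda>i. u i - v i) = (\<lambda>i. A u i - A v i)"
  using lin_op_add[OF assms, of u "\<lambda>i. - 1 * v i"] lin_op_scale[OF assms, of "- 1" v] by simp

lemma lin_op_zero:
  assumes "lin_op A"
  shows "A (\<lambda>i. 0) = (\<lambda>i. 0)"
  using lin_op_scale[OF assms, of 0 "\<lambda>i. 0"] by simp

lemma bounded_op_lin: "bounded_op A \<Longrightarrow> lin_op A"
  by (simp add: bounded_op_def)

lemma bounded_op_bound:
  assumes "bounded_op A"
  obtains B where "0 \<le> B" "\<And>u. u \<in> ell 0 \<Longrightarrow> A u \<in> ell 0 \<and> ell_norm 0 (A u) \<le> B * ell_norm 0 u"
  using assms by (auto simp: bounded_op_def)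

lemma bounded_op_ell_0: "bounded_op A \<Longrightarrow> u \<in> ell 0 \<Longrightarrow> A u \<in> ell 0"
  using bounded_op_bound by metis

lemma bounded_op_pointwise_0:
  "bounded_op A \<Longrightarrow> (\<And>i. (\<lambda>n. X n i) \<longlonglongrightarrow> 0) \<Longrightarrow> (\<lambda>n. A (X n) i) \<longlonglongrightarrow> 0"
  by (auto simp: bounded_op_def)

lemma bounded_op_pointwise:
  assumes "bounded_op A" "\<And>i. (\<lambda>n. X n i) \<longlonglongrightarrow> u i"
  shows "(\<lambda>n. A (X n) i) \<longlonglongrightarrow> A u i"
proof -
  have "(\<lambda>n. A (\<lambda>i. X n i - u i) i) \<longlonglongrightarrow> 0"
    by (intro bounded_op_pointwise_0[OF assms(1)]) (use assms(2) LIM_zero in blast)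
  then show ?thesis
    by (simp add: lin_op_diff[OF bounded_op_lin[OF assms(1)]] LIM_zero_iff)
qed

lemma bounded_op_norm_tendsto_0:
  assumes "bounded_op A" "\<And>n. X n \<in> ell 0" "(\<lambda>n. ell_norm 0 (X n)) \<longlonglongrightarrow> 0"
  shows "(\<lambda>n. ell_norm 0 (A (X n))) \<longlonglongrightarrow> 0"
proof -
  obtain B where B: "\<And>u. u \<in> ell 0 \<Longrightarrow> A u \<in> ell 0 \<and> ell_norm 0 (A u) \<le> B * ell_norm 0 u"
    using bounded_op_bound[OF assms(1)] by metis
  have "(\<lambda>n. B * ell_norm 0 (X n)) \<longlonglongrightarrow> 0"
    using tendsto_mult_right_zero[OF assms(3)] .
  then show ?thesis
    by (rule Lim_null_comparison[rotated]) (use B assms(2) ell_norm_nonneg in auto)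
qed

lemma bounded_op_add:
  assumes "bounded_op A" "bounded_op B"
  shows "bounded_op (\<lambda>u i. A u i + B u i)"
proof -
  obtain a b where ab: "0 \<le> a" "\<And>u. u \<in> ell 0 \<Longrightarrow> A u \<in> ell 0 \<and> ell_norm 0 (A u) \<le> a * ell_norm 0 u"
    "0 \<le> b" "\<And>u. u \<in> ell 0 \<Longrightarrow> B u \<in> ell 0 \<and> ell_norm 0 (B u) \<le> b * ell_norm 0 u"
    using bounded_op_bound[OF assms(1)] bounded_op_bound[OF assms(2)] by metis
  have "lin_op (\<lambda>u i. A u i + B u i)"
    using assms unfolding bounded_op_def lin_op_def by (auto simp: algebra_simps)
  moreover have "\<forall>u\<in>ell 0. (\<lambda>i. A u i + B u i) \<in> ell 0 \<and>
      ell_norm 0 (\<lambda>i. A u i + B u i) \<le> (a + b) * ell_norm 0 u"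
    using ab(2,4) ell_0_add by (fastforce simp: algebra_simps)
  moreover have "(\<lambda>n. A (X n) i + B (X n) i) \<longlonglongrightarrow> 0" if "\<forall>i. (\<lambda>n :: nat. X n i) \<longlonglongrightarrow> 0" for X i
    using tendsto_add[OF bounded_op_pointwise_0[OF assms(1)] bounded_op_pointwise_0[OF assms(2)], of X X i i]
      that by auto
  ultimately show ?thesis
    unfolding bounded_op_def using ab(1,3) by (intro conjI exI[of _ "a + b"]) auto
qed

lemma bounded_op_scale:
  assumes "bounded_op A"
  shows "bounded_op (\<lambda>u i. c * A u i)"
proof -
  obtain a where a: "0 \<le> a" "\<And>u. u \<in> ell 0 \<Longrightarrow> A u \<in> ell 0 \<and> ell_norm 0 (A u) \<le> a * ell_norm 0 u"
    using bounded_op_bound[OF assms(1)] by metis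
  have "lin_op (\<lambda>u i. c * A u i)"
    using assms unfolding bounded_op_def lin_op_def by (auto simp: algebra_simps)
  moreover have "\<forall>u\<in>ell 0. (\<lambda>i. c * A u i) \<in> ell 0 \<and>
      ell_norm 0 (\<lambda>i. c * A u i) \<le> (cmod c * a) * ell_norm 0 u"
    using a ell_0_scale by (auto simp: mult.assoc intro!: mult_left_mono)
  moreover have "(\<lambda>n. c * A (X n) i) \<longlonglongrightarrow> 0" if "\<forall>i. (\<lambda>n :: nat. X n i) \<longlonglongrightarrow> 0" for X i
    using tendsto_mult_right_zero[OF bounded_op_pointwise_0[OF assms(1), of X i], of c] that by auto
  ultimately show ?thesis
    unfolding bounded_op_def using a(1) by (intro conjI exI[of _ "cmod c * a"]) auto
qed

lemma bounded_op_diff: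
  assumes "bounded_op A" "bounded_op B"
  shows "bounded_op (\<lambda>u i. A u i - B u i)"
  using bounded_op_add[OF assms(1) bounded_op_scale[OF assms(2), of "- 1"]] by simp

lemma bounded_op_comp:
  assumes "bounded_op A" "bounded_op B"
  shows "bounded_op (\<lambda>u. A (B u))"
proof -
  obtain a b where ab: "0 \<le> a" "\<And>u. u \<in> ell 0 \<Longrightarrow> A u \<in> ell 0 \<and> ell_norm 0 (A u) \<le> a * ell_norm 0 u"
    "0 \<le> b" "\<And>u. u \<in> ell 0 \<Longrightarrow> B u \<in> ell 0 \<and> ell_norm 0 (B u) \<le> b * ell_norm 0 u"
    using bounded_op_bound[OF assms(1)] bounded_op_bound[OF assms(2)] by metis
  have "lin_op (\<lambda>u. A (B u))"
    using assms unfolding bounded_op_def lin_op_def by simp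
  moreover have "A (B u) \<in> ell 0 \<and> ell_norm 0 (A (B u)) \<le> (a * b) * ell_norm 0 u" if "u \<in> ell 0" for u
    using ab(2)[of "B u"] ab(4)[OF that] mult_left_mono[OF conjunct2[OF ab(4)[OF that]] ab(1)]
    by (simp add: mult.assoc)
  moreover have "(\<lambda>n. A (B (X n)) i) \<longlonglongrightarrow> 0" if "\<forall>i. (\<lambda>n :: nat. X n i) \<longlonglongrightarrow> 0" for X i
    by (rule bounded_op_pointwise_0[OF assms(1)], rule bounded_op_pointwise_0[OF assms(2)])
      (use that in auto)
  ultimately show ?thesis
    unfolding bounded_op_def using ab(1,3) by (intro conjI exI[of _ "a * b"]) auto
qed

lemma bounded_op_id: "bounded_op (\<lambda>u. u)"
  unfolding bounded_op_def lin_op_def by (auto intro: exI[of _ 1])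

lemma bounded_op_zero: "bounded_op (\<lambda>u i. 0)"
  unfolding bounded_op_def lin_op_def by (auto intro: exI[of _ 0])

lemma bounded_op_funpow: "bounded_op A \<Longrightarrow> bounded_op (\<lambda>u. (A ^^ n) u)"
proof (induction n)
  case (Suc n)
  then show ?case
    using bounded_op_comp[of A "\<lambda>u. (A ^^ n) u"] by simp
qed (simp add: bounded_op_id id_def)

lemma bounded_op_sum:
  assumes "\<And>k. k \<in> I \<Longrightarrow> bounded_op (A k)"
  shows "bounded_op (\<lambda>u i. \<Sum>k\<in>I. A k u i)"
  using assms by (induction I rule: infinite_finite_induct) (auto intro: bounded_op_add bounded_op_zero)

lemma cc_op_bounded: "cc_op A \<Longrightarrow> bounded_op A"
  by (simp add: cc_op_def)

lemma cc_op_tendsto: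
  "cc_op A \<Longrightarrow> (\<And>n. X n \<in> ell 0) \<Longrightarrow> (\<And>n. ell_norm 0 (X n) \<le> B) \<Longrightarrow> (\<And>i. (\<lambda>n. X n i) \<longlonglongrightarrow> 0) \<Longrightarrow>
    (\<lambda>n. ell_norm 0 (A (X n))) \<longlonglongrightarrow> 0"
  unfolding cc_op_def by blast

lemma cc_op_add:
  assumes "cc_op A" "cc_op B"
  shows "cc_op (\<lambda>u i. A u i + B u i)"
  unfolding cc_op_def
proof (intro conjI allI impI bounded_op_add cc_op_bounded assms)
  fix X :: "nat \<Rightarrow> nat \<Rightarrow> complex" and c
  assume X: "(\<forall>n. X n \<in> ell 0 \<and> ell_norm 0 (X n) \<le> c) \<and> (\<forall>i. (\<lambda>n. X n i) \<longlonglongrightarrow> 0)"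
  have mem: "A (X n) \<in> ell 0" "B (X n) \<in> ell 0" for n
    using X assms bounded_op_ell_0 cc_op_bounded by blast+
  have "(\<lambda>n. ell_norm 0 (A (X n)) + ell_norm 0 (B (X n))) \<longlonglongrightarrow> 0 + 0"
    by (intro tendsto_add cc_op_tendsto[OF assms(1), of X c] cc_op_tendsto[OF assms(2), of X c])
      (use X in auto)
  then show "(\<lambda>n. ell_norm 0 (\<lambda>i. A (X n) i + B (X n) i)) \<longlonglongrightarrow> 0"
    by (intro Lim_null_comparison[of "\<lambda>n. ell_norm 0 (\<lambda>i. A (X n) i + B (X n) i)"])
      (use ell_0_add[OF mem] ell_norm_nonneg in \<open>auto intro!: always_eventually\<close>)
qed

lemma cc_op_comp_left:
  assumes "bounded_op A" "cc_op B"
  shows "cc_op (\<lambda>u. A (B u))"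
  unfolding cc_op_def
proof (intro conjI allI impI bounded_op_comp[OF assms(1) cc_op_bounded[OF assms(2)]])
  fix X :: "nat \<Rightarrow> nat \<Rightarrow> complex" and c
  assume X: "(\<forall>n. X n \<in> ell 0 \<and> ell_norm 0 (X n) \<le> c) \<and> (\<forall>i. (\<lambda>n. X n i) \<longlonglongrightarrow> 0)"
  show "(\<lambda>n. ell_norm 0 (A (B (X n)))) \<longlonglongrightarrow> 0"
    by (intro bounded_op_norm_tendsto_0[OF assms(1)] cc_op_tendsto[OF assms(2), of X c]
          bounded_op_ell_0[OF cc_op_bounded[OF assms(2)]]) (use X in auto)
qed

lemma cc_op_comp_right:
  assumes "cc_op A" "bounded_op B"
  shows "cc_op (\<lambda>u. A (B u))"
  unfolding cc_op_def
proof (intro conjI allI impI bounded_op_comp[OF cc_op_bounded[OF assms(1)] assms(2)])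
  fix X :: "nat \<Rightarrow> nat \<Rightarrow> complex" and c
  assume X: "(\<forall>n. X n \<in> ell 0 \<and> ell_norm 0 (X n) \<le> c) \<and> (\<forall>i. (\<lambda>n. X n i) \<longlonglongrightarrow> 0)"
  obtain b where b: "0 \<le> b" "\<And>u. u \<in> ell 0 \<Longrightarrow> B u \<in> ell 0 \<and> ell_norm 0 (B u) \<le> b * ell_norm 0 u"
    using bounded_op_bound[OF assms(2)] by metis
  show "(\<lambda>n. ell_norm 0 (A (B (X n)))) \<longlonglongrightarrow> 0"
  proof (rule cc_op_tendsto[OF assms(1), where B = "b * c"])
    show "ell_norm 0 (B (X n)) \<le> b * c" for n
      using b(2)[of "X n"] X mult_left_mono[OF _ b(1), of "ell_norm 0 (X n)" c] order_trans by blast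
  qed (use X b bounded_op_pointwise_0[OF assms(2)] in auto)
qed

lemma cc_op_scale: "cc_op A \<Longrightarrow> cc_op (\<lambda>u i. c * A u i)"
  by (rule cc_op_comp_left) (auto intro: bounded_op_scale[OF bounded_op_id])

lemma cc_op_zero: "cc_op (\<lambda>u i. 0)"
  by (simp add: cc_op_def bounded_op_zero)

text \<open>A coordinatewise limit \<open>u\<close> of a subsequence lies in the same ball, so the
  differences from \<open>u\<close> are bounded by \<open>B + B\<close> and weakly null. Their
  images tend to 0 in norm, that is, the images of the subsequence converge to
  \<open>C u\<close>.\<close>

lemma cc_op_imp_compact_op:
  assumes "cc_op C"
  shows "compact_op C"
proof -
  have bd: "bounded_op C"
    by (rule cc_op_bounded[OF assms])
  have lin: "lin_op C"
    by (rule bounded_op_lin[OF bd])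
  have "\<exists>r L. strict_mono r \<and> ell2_tendsto (\<lambda>n. C (X (r n))) L"
    if X: "\<And>n :: nat. X n \<in> ell 0 \<and> ell_norm 0 (X n) \<le> B" for X B
  proof -
    obtain r u where r: "strict_mono (r :: nat \<Rightarrow> nat)" "\<And>i. (\<lambda>n. X (r n) i) \<longlonglongrightarrow> u i"
      "u \<in> ell 0" "ell_norm 0 u \<le> B"
      using ell_0_bounded_subseq[of X B, OF X] by blast
    have "(\<lambda>n. ell_norm 0 (C (\<lambda>i. X (r n) i - u i))) \<longlonglongrightarrow> 0"
    proof (rule cc_op_tendsto[OF assms, where B = "B + B"])
      show "(\<lambda>i. X (r n) i - u i) \<in> ell 0" for n
        using ell_0_diff X r(3) by blast
      show "ell_norm 0 (\<lambda>i. X (r n) i - u i) \<le> B + B" for n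
        using ell_0_diff(2)[of "X (r n)" u] X[of "r n"] r(3,4) by linarith
    qed (use r(2) LIM_zero in blast)
    then show ?thesis
      using r X bounded_op_ell_0[OF bd]
      by (intro exI[of _ r] exI[of _ "C u"]) (auto simp: ell2_tendsto_def lin_op_diff[OF lin])
  qed
  then show ?thesis
    unfolding compact_op_def
    using bounded_op_ell_0[OF bd] lin_op_add[OF lin] lin_op_scale[OF lin] by auto
qed

lemma eq_cc_refl: "bounded_op A \<Longrightarrow> A \<simeq> A"
  by (simp add: eq_cc_def cc_op_zero)

lemma eq_cc_I: "bounded_op B \<Longrightarrow> cc_op C \<Longrightarrow> (\<And>u i. A u i = B u i + C u i) \<Longrightarrow> A \<simeq> B"
proof -
  assume *: "bounded_op B" "cc_op C" "\<And>u i. A u i = B u i + C u i"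
  have A: "A = (\<lambda>u i. B u i + C u i)"
    using *(3) by (intro ext)
  show ?thesis
    unfolding eq_cc_def A using * bounded_op_add[OF *(1) cc_op_bounded[OF *(2)]] by simp
qed

lemma eq_cc_sym: "A \<simeq> B \<Longrightarrow> B \<simeq> A"
  unfolding eq_cc_def using cc_op_scale[of "\<lambda>u i. A u i - B u i" "- 1"] by simp

lemma eq_cc_trans [trans]: "A \<simeq> B \<Longrightarrow> B \<simeq> C \<Longrightarrow> A \<simeq> C"
  unfolding eq_cc_def using cc_op_add[of "\<lambda>u i. A u i - B u i" "\<lambda>u i. B u i - C u i"] by simp

lemma eq_eq_cc_trans [trans]: "A = B \<Longrightarrow> B \<simeq> C \<Longrightarrow> A \<simeq> C"
  by simp

lemma eq_cc_eq_trans [trans]: "A \<simeq> B \<Longrightarrow> B = C \<Longrightarrow> A \<simeq> C"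
  by simp

lemma eq_cc_add: "A \<simeq> B \<Longrightarrow> C \<simeq> D \<Longrightarrow> (\<lambda>u i. A u i + C u i) \<simeq> (\<lambda>u i. B u i + D u i)"
  unfolding eq_cc_def using cc_op_add[of "\<lambda>u i. A u i - B u i" "\<lambda>u i. C u i - D u i"]
  by (auto simp: algebra_simps intro: bounded_op_add)

lemma eq_cc_scale: "A \<simeq> B \<Longrightarrow> (\<lambda>u i. c * A u i) \<simeq> (\<lambda>u i. c * B u i)"
  unfolding eq_cc_def using cc_op_scale[of "\<lambda>u i. A u i - B u i" c]
  by (auto simp: algebra_simps intro: bounded_op_scale)

text \<open>The difference is \<open>(A - B) C + B (C - D)\<close>, and a product of a compact and a
  bounded operator is compact in either order.\<close>

lemma eq_cc_comp:
  assumes "A \<simeq> B" "C \<simeq> D"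
  shows "(\<lambda>u. A (C u)) \<simeq> (\<lambda>u. B (D u))"
proof -
  have bd: "bounded_op A" "bounded_op B" "bounded_op C" "bounded_op D"
    using assms by (auto simp: eq_cc_def)
  have 1: "cc_op (\<lambda>u i. A (C u) i - B (C u) i)"
    using cc_op_comp_right[OF _ bd(3), of "\<lambda>u i. A u i - B u i"] assms(1) by (simp add: eq_cc_def)
  have 2: "cc_op (\<lambda>u. B (\<lambda>i. C u i - D u i))"
    by (rule cc_op_comp_left[OF bd(2)]) (use assms(2) in \<open>simp add: eq_cc_def\<close>)
  show ?thesis
    unfolding eq_cc_def
    using cc_op_add[OF 1 2] bounded_op_comp[OF bd(1,3)] bounded_op_comp[OF bd(2,4)]
    by (simp add: lin_op_diff[OF bounded_op_lin[OF bd(2)]])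
qed

lemma eq_cc_funpow: "A \<simeq> B \<Longrightarrow> (\<lambda>u. (A ^^ n) u) \<simeq> (\<lambda>u. (B ^^ n) u)"
proof (induction n)
  case (Suc n)
  then show ?case
    using eq_cc_comp[of A B "\<lambda>u. (A ^^ n) u" "\<lambda>u. (B ^^ n) u"] by simp
qed (simp add: eq_cc_refl bounded_op_id id_def)

section \<open>Shifts and diagonal operators\<close>

definition rshift :: "(nat \<Rightarrow> complex) \<Rightarrow> nat \<Rightarrow> complex" where
  "rshift u i = (if i = 0 then 0 else u (i - 1))"

definition lshift :: "(nat \<Rightarrow> complex) \<Rightarrow> nat \<Rightarrow> complex" where
  "lshift u i = u (Suc i)"

lemma ell_0_rshift:
  assumes "u \<in> ell 0"
  shows "rshift u \<in> ell 0" "ell_norm 0 (rshift u) = ell_norm 0 u"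
proof -
  have "rshift u (Suc i) = u i" for i
    by (simp add: rshift_def)
  then have "(\<lambda>i. (cmod (rshift u (Suc i)))\<^sup>2) = (\<lambda>i. (cmod (u i))\<^sup>2)"
    by simp
  then show 1: "rshift u \<in> ell 0"
    using assms summable_Suc_iff[of "\<lambda>i. (cmod (rshift u i))\<^sup>2"] unfolding ell_0_iff by simp
  show "ell_norm 0 (rshift u) = ell_norm 0 u"
    using suminf_split_head[of "\<lambda>i. (cmod (rshift u i))\<^sup>2"] 1
    by (simp add: ell_norm_0 ell_0_iff rshift_def)
qed

lemma ell_0_lshift:
  assumes "u \<in> ell 0"
  shows "lshift u \<in> ell 0" "ell_norm 0 (lshift u) \<le> ell_norm 0 u"
proof -
  show "lshift u \<in> ell 0"
    using assms summable_Suc_iff[of "\<lambda>i. (cmod (u i))\<^sup>2"] by (simp add: ell_0_iff lshift_def)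
  show "ell_norm 0 (lshift u) \<le> ell_norm 0 u"
    using suminf_split_head[of "\<lambda>i. (cmod (u i))\<^sup>2"] assms
    by (simp add: ell_norm_0 ell_0_iff lshift_def)
qed

lemma bounded_op_rshift: "bounded_op rshift"
  unfolding bounded_op_def lin_op_def
proof (intro conjI exI[of _ 1] allI impI)
  show "(\<lambda>n. rshift (X n) i) \<longlonglongrightarrow> 0" if "\<forall>i. (\<lambda>n :: nat. X n i) \<longlonglongrightarrow> 0" for X i
    using that by (cases i) (auto simp: rshift_def)
qed (auto simp: ell_0_rshift, auto simp: rshift_def)

lemma bounded_op_lshift: "bounded_op lshift"
  unfolding bounded_op_def lin_op_def
  by (intro conjI exI[of _ 1]) (auto simp: ell_0_lshift, auto simp: lshift_def)

lemma bounded_op_diag: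
  assumes "\<And>i. cmod (d i) \<le> B"
  shows "bounded_op (\<lambda>u i. d i * u i)"
proof -
  have B: "0 \<le> B"
    using assms[of 0] norm_ge_zero order_trans by blast
  have "(\<lambda>i. d i * u i) \<in> ell 0 \<and> ell_norm 0 (\<lambda>i. d i * u i) \<le> B * ell_norm 0 u" if "u \<in> ell 0" for u
  proof -
    have "cmod (d i * u i) \<le> cmod (of_real B * u i)" for i
      using B by (simp add: norm_mult mult_right_mono assms)
    from ell_0_mono[OF ell_0_scale(1)[OF that] this] show ?thesis
      using ell_0_scale(2)[OF that, of "of_real B"] B by simp
  qed
  moreover have "(\<lambda>n. d i * X n i) \<longlonglongrightarrow> 0" if "\<forall>i. (\<lambda>n :: nat. X n i) \<longlonglongrightarrow> 0" for X i
    using tendsto_mult_right_zero that by blast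
  ultimately show ?thesis
    unfolding bounded_op_def lin_op_def using B
    by (intro conjI exI[of _ B]) (auto simp: algebra_simps)
qed

text \<open>Beyond some index the multipliers are small, and the finitely many coordinates before it
  tend to 0 along a weakly null sequence.\<close>

lemma cc_op_diag:
  assumes "d \<longlonglongrightarrow> 0"
  shows "cc_op (\<lambda>u i. d i * u i)"
  unfolding cc_op_def
proof (intro conjI allI impI)
  obtain D where D: "\<And>i. cmod (d i) \<le> D"
    using Bseq_def convergent_imp_Bseq[OF convergentI[OF assms]] by metis
  show "bounded_op (\<lambda>u i. d i * u i)"
    by (rule bounded_op_diag[OF D])
  have D0: "0 \<le> D"
    using D[of 0] norm_ge_zero order_trans by blast
  fix X :: "nat \<Rightarrow> nat \<Rightarrow> complex" and B
  assume "(\<forall>n. X n \<in> ell 0 \<and> ell_norm 0 (X n) \<le> B) \<and> (\<forall>i. (\<lambda>n. X n i) \<longlonglongrightarrow> 0)"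
  then have X: "X n \<in> ell 0" "ell_norm 0 (X n) \<le> B" "(\<lambda>n. X n i) \<longlonglongrightarrow> 0" for n i
    by auto
  have B0: "0 \<le> B"
    using X(1,2)[of 0] ell_norm_nonneg order_trans by blast
  have mem: "(\<lambda>i. d i * X n i) \<in> ell 0" for n
    using bounded_op_ell_0[OF bounded_op_diag[OF D] X(1)] by simp
  show "(\<lambda>n. ell_norm 0 (\<lambda>i. d i * X n i)) \<longlonglongrightarrow> 0"
  proof (rule LIMSEQ_I)
    fix r :: real assume "0 < r"
    \<comment> \<open>Half of \<open>r\<close> is reserved for the tail, where multipliers below
      \<open>e\<close> act on vectors of norm at most \<open>B\<close>; the summand 1 covers
      \<open>B = 0\<close>.\<close>
    define e where "e = r / (2 * (B + 1))"
    have e: "0 < e"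
      using \<open>0 < r\<close> B0 by (simp add: e_def)
    obtain N where N: "\<And>i. i \<ge> N \<Longrightarrow> cmod (d i) < e"
      using LIMSEQ_D[OF assms e] by auto
    have "(\<lambda>n. ell_norm 0 (trunc N (X n))) \<longlonglongrightarrow> 0"
    proof -
      have "ell_norm 0 (trunc N (X n)) = sqrt (\<Sum>i<N. (cmod (X n i))\<^sup>2)" for n
        unfolding ell_norm_0 by (subst suminf_finite[of "{..<N}"]) (auto simp: trunc_nth)
      moreover have "(\<lambda>n. sqrt (\<Sum>i<N. (cmod (X n i))\<^sup>2)) \<longlonglongrightarrow> sqrt (\<Sum>i<N. (cmod 0)\<^sup>2)"
        by (intro tendsto_intros X)
      ultimately show ?thesis by simp
    qed
    then have "(\<lambda>n. D * ell_norm 0 (trunc N (X n))) \<longlonglongrightarrow> 0"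
      by (rule tendsto_mult_right_zero)
    from order_tendstoD(2)[OF this, of "r / 2"] \<open>0 < r\<close>
    obtain n0 where n0: "\<And>n. n \<ge> n0 \<Longrightarrow> D * ell_norm 0 (trunc N (X n)) < r / 2"
      by (auto simp: eventually_sequentially)
    have "ell_norm 0 (\<lambda>i. d i * X n i) < r" if "n \<ge> n0" for n
    proof -
      define v where "v = (\<lambda>i. X n i - trunc N (X n) i)"
      have v: "v \<in> ell 0" "ell_norm 0 v \<le> ell_norm 0 (X n)"
        using ell_0_mono[OF X(1), of v n] by (auto simp: v_def trunc_nth)
      have 1: "(\<lambda>i. d i * trunc N (X n) i) \<in> ell 0"
        "ell_norm 0 (\<lambda>i. d i * trunc N (X n) i) \<le> D * ell_norm 0 (trunc N (X n))"
        using ell_0_mono[OF ell_0_scale(1)[OF ell_0_trunc, of "of_real D" N "X n"], of "\<lambda>i. d i * trunc N (X n) i"]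
          D D0 ell_0_scale(2)[OF ell_0_trunc, of "of_real D" N "X n"]
        by (auto simp: norm_mult mult_right_mono)
      have "cmod (d i) * cmod (v i) \<le> e * cmod (v i)" for i
        using N[of i] by (cases "i < N") (auto simp: v_def trunc_nth mult_right_mono)
      then have 2: "(\<lambda>i. d i * v i) \<in> ell 0" "ell_norm 0 (\<lambda>i. d i * v i) \<le> e * ell_norm 0 v"
        using ell_0_mono[OF ell_0_scale(1)[OF v(1), of "of_real e"], of "\<lambda>i. d i * v i"]
          e ell_0_scale(2)[OF v(1), of "of_real e"]
        by (auto simp: norm_mult)
      have "ell_norm 0 (\<lambda>i. d i * X n i) \<le> D * ell_norm 0 (trunc N (X n)) + e * ell_norm 0 (X n)"
      proof -
        have eq: "(\<lambda>i. d i * X n i) = (\<lambda>i. d i * trunc N (X n) i + d i * v i)"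
          by (simp add: v_def algebra_simps)
        show ?thesis
          unfolding eq using ell_0_add(2)[OF 1(1) 2(1)] 1(2) 2(2) mult_left_mono[OF v(2) less_imp_le[OF e]]
          by linarith
      qed
      also have "\<dots> < r / 2 + e * (B + 1)"
        using n0[OF that] X(2)[of n] e by (intro add_strict_mono mult_strict_left_mono) auto
      also have "\<dots> = r"
        using B0 by (simp add: e_def field_simps)
      finally show ?thesis .
    qed
    then show "\<exists>no. \<forall>n\<ge>no. norm (ell_norm 0 (\<lambda>i. d i * X n i) - 0) < r"
      using ell_norm_nonneg[OF mem] by (intro exI[of _ n0]) auto
  qed
qed

section \<open>Finite sections\<close>

text \<open>Bidiagonal Toeplitz factors; the symbols on the circle are 1 - \<rho> z for
  \<open>lfac\<close> and 1 - \<rho> / z for \<open>ufac\<close>.\<close>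

definition lfac :: "complex \<Rightarrow> (nat \<Rightarrow> complex) \<Rightarrow> nat \<Rightarrow> complex" where
  "lfac \<rho> u i = u i - \<rho> * rshift u i"

definition ufac :: "complex \<Rightarrow> (nat \<Rightarrow> complex) \<Rightarrow> nat \<Rightarrow> complex" where
  "ufac \<rho> u i = u i - \<rho> * lshift u i"

primrec lprod :: "complex list \<Rightarrow> (nat \<Rightarrow> complex) \<Rightarrow> nat \<Rightarrow> complex" where
  "lprod [] u = u"
| "lprod (\<rho> # \<rho>s) u = lfac \<rho> (lprod \<rho>s u)"

primrec uprod :: "complex list \<Rightarrow> (nat \<Rightarrow> complex) \<Rightarrow> nat \<Rightarrow> complex" where
  "uprod [] u = u"
| "uprod (\<rho> # \<rho>s) u = ufac \<rho> (uprod \<rho>s u)"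

lemma bounded_op_lfac: "bounded_op (lfac \<rho>)"
  using bounded_op_diff[OF bounded_op_id bounded_op_scale[OF bounded_op_rshift, of \<rho>]]
  by (simp add: lfac_def[abs_def])

lemma bounded_op_ufac: "bounded_op (ufac \<rho>)"
  using bounded_op_diff[OF bounded_op_id bounded_op_scale[OF bounded_op_lshift, of \<rho>]]
  by (simp add: ufac_def[abs_def])

lemma bounded_op_lprod: "bounded_op (lprod \<rho>s)"
proof (induction \<rho>s)
  case Nil
  have "lprod [] = (\<lambda>u. u)" by auto
  then show ?case using bounded_op_id by metis
next
  case (Cons \<rho> \<rho>s)
  have "lprod (\<rho> # \<rho>s) = (\<lambda>u. lfac \<rho> (lprod \<rho>s u))" by auto
  then show ?case using bounded_op_comp[OF bounded_op_lfac Cons, of \<rho>] by metis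
qed

lemma bounded_op_uprod: "bounded_op (uprod \<rho>s)"
proof (induction \<rho>s)
  case Nil
  have "uprod [] = (\<lambda>u. u)" by auto
  then show ?case using bounded_op_id by metis
next
  case (Cons \<rho> \<rho>s)
  have "uprod (\<rho> # \<rho>s) = (\<lambda>u. ufac \<rho> (uprod \<rho>s u))" by auto
  then show ?case using bounded_op_comp[OF bounded_op_ufac Cons, of \<rho>] by metis
qed

text \<open>The first \<open>n\<close> entries of \<open>lfac \<rho> u\<close> involve only the
  first \<open>n\<close> entries of \<open>u\<close>, so the shift can be applied to the truncated
  vector, where it does not increase the norm. The bound thus holds for arbitrary sequences
  \<open>u\<close>.\<close>

lemma trunc_lfac_lower_bound:
  "(1 - cmod \<rho>) * ell_norm 0 (trunc n u) \<le> ell_norm 0 (trunc n (lfac \<rho> u))"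
proof -
  have eq: "trunc n (lfac \<rho> u) = (\<lambda>i. trunc n u i - \<rho> * trunc n (rshift (trunc n u)) i)"
    by (auto simp: trunc_nth lfac_def rshift_def fun_eq_iff)
  have "ell_norm 0 (\<lambda>i. \<rho> * trunc n (rshift (trunc n u)) i) \<le> cmod \<rho> * ell_norm 0 (trunc n u)"
    using ell_norm_trunc_le[OF ell_0_rshift(1)[OF ell_0_trunc], of n n u]
      ell_0_rshift(2)[OF ell_0_trunc, of n u] ell_0_scale(2)[OF ell_0_trunc, of \<rho> n "rshift (trunc n u)"]
    by (simp add: mult_left_mono)
  then show ?thesis
    using ell_norm_diff_ge[OF ell_0_trunc[of n u] ell_0_scale(1)[OF ell_0_trunc[of n "rshift (trunc n u)"], of \<rho>]]
    by (simp add: eq algebra_simps)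
qed

lemma ufac_lower_bound:
  assumes "u \<in> ell 0"
  shows "(1 - cmod \<rho>) * ell_norm 0 u \<le> ell_norm 0 (ufac \<rho> u)"
proof -
  have "ell_norm 0 (\<lambda>i. \<rho> * lshift u i) \<le> cmod \<rho> * ell_norm 0 u"
    using ell_0_lshift[OF assms] ell_0_scale(2)[of "lshift u" \<rho>] by (simp add: mult_left_mono)
  then show ?thesis
    using ell_norm_diff_ge[OF assms ell_0_scale(1)[OF ell_0_lshift(1)[OF assms], of \<rho>]]
    by (simp add: ufac_def[abs_def] algebra_simps)
qed

text \<open>The left shift never enlarges the support, so a truncation inserted between the upper
  and the lower factors changes nothing.\<close>

lemma trunc_uprod:
  assumes "trunc n u = u"
  shows "trunc n (uprod \<rho>s u) = uprod \<rho>s u"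
proof (induction \<rho>s)
  case (Cons \<rho> \<rho>s)
  then have "uprod \<rho>s u i = 0" if "i \<ge> n" for i
    using that by (metis leD trunc_nth)
  then show ?case
    by (auto simp: trunc_nth ufac_def lshift_def fun_eq_iff)
qed (use assms in simp)

lemma prod_list_one_minus_pos:
  assumes "\<And>\<rho>. \<rho> \<in> set \<rho>s \<Longrightarrow> cmod \<rho> < 1"
  shows "0 < (\<Prod>\<rho>\<leftarrow>\<rho>s. 1 - cmod \<rho>)"
  using assms by (induction \<rho>s) auto

lemma trunc_lprod_lower_bound:
  assumes "\<And>\<rho>. \<rho> \<in> set \<rho>s \<Longrightarrow> cmod \<rho> < 1"
  shows "(\<Prod>\<rho>\<leftarrow>\<rho>s. 1 - cmod \<rho>) * ell_norm 0 (trunc n u) \<le> ell_norm 0 (trunc n (lprod \<rho>s u))"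
  using assms
proof (induction \<rho>s)
  case (Cons \<rho> \<rho>s)
  then have "(1 - cmod \<rho>) * ((\<Prod>\<rho>\<leftarrow>\<rho>s. 1 - cmod \<rho>) * ell_norm 0 (trunc n u))
      \<le> (1 - cmod \<rho>) * ell_norm 0 (trunc n (lprod \<rho>s u))"
    by (intro mult_left_mono) (auto simp: less_imp_le)
  then show ?case
    using trunc_lfac_lower_bound[of \<rho> n "lprod \<rho>s u"] by (simp add: mult.assoc)
qed simp

lemma uprod_lower_bound:
  assumes "\<And>\<rho>. \<rho> \<in> set \<rho>s \<Longrightarrow> cmod \<rho> < 1" "u \<in> ell 0"
  shows "(\<Prod>\<rho>\<leftarrow>\<rho>s. 1 - cmod \<rho>) * ell_norm 0 u \<le> ell_norm 0 (uprod \<rho>s u)"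
  using assms
proof (induction \<rho>s)
  case (Cons \<rho> \<rho>s)
  then have "(1 - cmod \<rho>) * ((\<Prod>\<rho>\<leftarrow>\<rho>s. 1 - cmod \<rho>) * ell_norm 0 u)
      \<le> (1 - cmod \<rho>) * ell_norm 0 (uprod \<rho>s u)"
    by (intro mult_left_mono) (auto simp: less_imp_le)
  then show ?case
    using ufac_lower_bound[OF bounded_op_ell_0[OF bounded_op_uprod Cons.prems(2)], of \<rho> \<rho>s]
    by (simp add: mult.assoc)
qed simp

text \<open>Suppose unit vectors \<open>V m\<close> of growing length contradict the bound. A coordinatewise limit of
  a subsequence lies in the kernel of \<open>A\<close>, so it is zero; hence the compact part of \<open>A\<close> maps the
  subsequence to a null sequence, contrary to the lower bound for the triangular factors.\<close>

lemma finite_section_stable: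
  assumes eq: "A \<simeq> (\<lambda>u i. c * lprod \<rho>s (uprod \<rho>s u) i)" and "c \<noteq> 0"
    and \<rho>s: "\<And>\<rho>. \<rho> \<in> set \<rho>s \<Longrightarrow> cmod \<rho> < 1"
    and inj: "\<And>u. u \<in> ell 0 \<Longrightarrow> A u = (\<lambda>i. 0) \<Longrightarrow> u = (\<lambda>i. 0)"
  shows "\<exists>\<delta>>0. \<forall>\<^sub>F n in sequentially. \<forall>v. trunc n v = v \<longrightarrow>
           \<delta> * ell_norm 0 v \<le> ell_norm 0 (trunc n (A v))"
proof (rule ccontr)
  assume contr: "\<not> ?thesis"
  define B where "B = (\<lambda>u i. c * lprod \<rho>s (uprod \<rho>s u) i)"
  define P where "P = (\<Prod>\<rho>\<leftarrow>\<rho>s. 1 - cmod \<rho>)"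
  have P: "0 < P"
    unfolding P_def using \<rho>s by (rule prod_list_one_minus_pos)
  have bdA: "bounded_op A" and bdB: "bounded_op B" and cc: "cc_op (\<lambda>u i. A u i - B u i)"
    using eq by (auto simp: eq_cc_def B_def)
  note linA = bounded_op_lin[OF bdA]
  have "\<exists>n v. m \<le> n \<and> trunc n v = v \<and> ell_norm 0 v = 1 \<and> ell_norm 0 (trunc n (A v)) < inverse (real (Suc m))" for m
  proof -
    have "0 < inverse (real (Suc m))" by simp
    with contr have "\<not> (\<forall>\<^sub>F n in sequentially. \<forall>v. trunc n v = v \<longrightarrow>
           inverse (real (Suc m)) * ell_norm 0 v \<le> ell_norm 0 (trunc n (A v)))" by blast
    then obtain n v where nv: "m \<le> n" "trunc n v = v"
      "ell_norm 0 (trunc n (A v)) < inverse (real (Suc m)) * ell_norm 0 v"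
      unfolding eventually_sequentially by (meson not_le)
    have v: "v \<in> ell 0"
      using ell_0_trunc[of n v] nv(2) by simp
    have pos: "0 < ell_norm 0 v"
      using nv(3) ell_norm_nonneg[OF v] ell_norm_nonneg[OF ell_0_trunc, of n "A v"]
      by (cases "ell_norm 0 v = 0") auto
    define a where "a = complex_of_real (inverse (ell_norm 0 v))"
    have ca: "cmod a = inverse (ell_norm 0 v)"
      using pos by (simp add: a_def norm_inverse)
    have "trunc n (\<lambda>i. a * v i) = (\<lambda>i. a * trunc n v i)" and
      tA: "trunc n (A (\<lambda>i. a * v i)) = (\<lambda>i. a * trunc n (A v) i)"
      by (auto simp: lin_op_scale[OF linA] trunc_nth)
    moreover have "ell_norm 0 (\<lambda>i. a * v i) = 1"
      using ell_0_scale(2)[OF v, of a] pos ca by simp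
    moreover have "ell_norm 0 (trunc n (A (\<lambda>i. a * v i))) < inverse (real (Suc m))"
      unfolding tA ell_0_scale(2)[OF ell_0_trunc] ca using pos nv(3) by (simp add: field_simps)
    ultimately show ?thesis
      using nv(1,2) by (intro exI[of _ n] exI[of _ "\<lambda>i. a * v i"]) simp
  qed
  then obtain N V where NV: "\<And>m. m \<le> N m" "\<And>m. trunc (N m) (V m) = V m" "\<And>m. ell_norm 0 (V m) = 1"
    "\<And>m. ell_norm 0 (trunc (N m) (A (V m))) < inverse (real (Suc m))"
    by metis
  have V: "V m \<in> ell 0" for m
    using ell_0_trunc[of "N m" "V m"] NV(2) by simp
  obtain r u where r: "strict_mono (r :: nat \<Rightarrow> nat)" "\<And>i. (\<lambda>n. V (r n) i) \<longlonglongrightarrow> u i" "u \<in> ell 0"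
    using ell_0_bounded_subseq[of V 1] V NV(3) by (metis order_refl)
  have AV: "(\<lambda>m. ell_norm 0 (trunc (N (r m)) (A (V (r m))))) \<longlonglongrightarrow> 0"
  proof (rule Lim_null_comparison)
    show "\<forall>\<^sub>F m in sequentially. norm (ell_norm 0 (trunc (N (r m)) (A (V (r m))))) \<le> inverse (real (Suc (r m)))"
      using NV(4) less_imp_le ell_norm_nonneg[OF ell_0_trunc] by (auto intro!: always_eventually)
    show "(\<lambda>m. inverse (real (Suc (r m)))) \<longlonglongrightarrow> 0"
      using LIMSEQ_subseq_LIMSEQ[OF LIMSEQ_inverse_real_of_nat r(1)] by (simp add: o_def)
  qed
  have "A u i = 0" for i
  proof -
    have "(\<lambda>m. A (V (r m)) i) \<longlonglongrightarrow> A u i"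
      by (rule bounded_op_pointwise[OF bdA r(2)])
    moreover have "(\<lambda>m. A (V (r m)) i) \<longlonglongrightarrow> 0"
    proof (rule Lim_null_comparison[OF _ AV])
      \<comment> \<open>Coordinate \<open>i\<close> survives the truncation as soon as
        \<open>m > i\<close>, since \<open>m \<le> r m \<le> N (r m)\<close>.\<close>
      show "\<forall>\<^sub>F m in sequentially. norm (A (V (r m)) i) \<le> ell_norm 0 (trunc (N (r m)) (A (V (r m))))"
        using eventually_gt_at_top[of i]
      proof eventually_elim
        case (elim m)
        then have "i < N (r m)"
          using NV(1)[of "r m"] strict_mono_imp_increasing[OF r(1), of m] by linarith
        then show ?case
          using cmod_le_ell_norm[OF ell_0_trunc, of "N (r m)" "A (V (r m))" i] by (simp add: trunc_nth)
      qed
    qed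
    ultimately show ?thesis
      using LIMSEQ_unique by blast
  qed
  then have "u = (\<lambda>i. 0)"
    using inj[OF r(3)] by auto
  then have K: "(\<lambda>m. ell_norm 0 (\<lambda>i. A (V (r m)) i - B (V (r m)) i)) \<longlonglongrightarrow> 0"
    by (intro cc_op_tendsto[OF cc, of "\<lambda>m. V (r m)" 1]) (use V NV(3) r(2) in auto)
  \<comment> \<open>Each of the two triangular products contributes one factor \<open>P\<close>. The
    upper one leaves the vector supported below \<open>N (r m)\<close>, so the truncation in the
    bound for the lower one is already present.\<close>
  have "cmod c * (P * P) \<le> ell_norm 0 (trunc (N (r m)) (A (V (r m)))) + ell_norm 0 (\<lambda>i. A (V (r m)) i - B (V (r m)) i)" for m
  proof -
    let ?n = "N (r m)" and ?v = "V (r m)"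
    have "P * 1 \<le> ell_norm 0 (uprod \<rho>s ?v)"
      using uprod_lower_bound[of \<rho>s "V (r m)", OF \<rho>s V] NV(3) by (simp add: P_def)
    then have "P * P \<le> P * ell_norm 0 (trunc ?n (uprod \<rho>s ?v))"
      using trunc_uprod[OF NV(2), of "r m" \<rho>s] P by simp
    also have "\<dots> \<le> ell_norm 0 (trunc ?n (lprod \<rho>s (uprod \<rho>s ?v)))"
      unfolding P_def by (rule trunc_lprod_lower_bound[OF \<rho>s])
    finally have "cmod c * (P * P) \<le> cmod c * ell_norm 0 (trunc ?n (lprod \<rho>s (uprod \<rho>s ?v)))"
      by (rule mult_left_mono) simp
    also have "\<dots> = ell_norm 0 (trunc ?n (B ?v))"
    proof -
      have "trunc ?n (B ?v) = (\<lambda>i. c * trunc ?n (lprod \<rho>s (uprod \<rho>s ?v)) i)"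
        by (auto simp: B_def trunc_nth)
      then show ?thesis
        using ell_0_scale(2)[OF ell_0_trunc] by simp
    qed
    also have "\<dots> \<le> ell_norm 0 (trunc ?n (A ?v)) + ell_norm 0 (trunc ?n (\<lambda>i. A ?v i - B ?v i))"
    proof -
      have "trunc ?n (B ?v) = (\<lambda>i. trunc ?n (A ?v) i - trunc ?n (\<lambda>i. A ?v i - B ?v i) i)"
        by (auto simp: trunc_nth)
      then show ?thesis
        using ell_0_diff(2)[OF ell_0_trunc ell_0_trunc] by metis
    qed
    also have "ell_norm 0 (trunc ?n (\<lambda>i. A ?v i - B ?v i)) \<le> ell_norm 0 (\<lambda>i. A ?v i - B ?v i)"
      by (intro ell_norm_trunc_le ell_0_diff bounded_op_ell_0[OF bdA] bounded_op_ell_0[OF bdB] V)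
    finally show ?thesis by simp
  qed
  from tendsto_lowerbound[OF tendsto_add[OF AV K] always_eventually[OF allI[OF this]]]
  have "cmod c * (P * P) \<le> 0" by simp
  then show False
    using \<open>c \<noteq> 0\<close> P by (simp add: mult_le_0_iff)
qed

section \<open>Solvability of the square truncated systems\<close>

lemma trunc_lin: "lin_op (trunc n)"
  unfolding lin_op_def by (auto simp: trunc_nth)

text \<open>Injectivity gives surjectivity by counting dimensions in the span \<open>E\<close> of
  the first \<open>n\<close> unit sequences: the \<open>n\<close> images of the basis are
  independent, and an \<open>f\<close> outside their span would make \<open>n + 1\<close>
  independent vectors there.\<close>

lemma finite_section_surj:
  assumes lin: "lin_op A" and inj: "\<And>v. trunc n v = v \<Longrightarrow> trunc n (A v) = (\<lambda>i. 0) \<Longrightarrow> v = (\<lambda>i. 0)"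
    and f: "trunc n f = f"
  shows "\<exists>v. trunc n v = v \<and> trunc n (A v) = f"
proof -
  define sc where "sc = (\<lambda>(c :: complex) (v :: nat \<Rightarrow> complex) i. c * v i)"
  define T where "T = (\<lambda>v. trunc n (A v))"
  interpret V: vector_space sc
    by unfold_locales (auto simp: sc_def fun_eq_iff algebra_simps)
  interpret T: Vector_Spaces.linear sc sc T
    by unfold_locales (auto simp: T_def sc_def lin_op_scale[OF lin] lin_op_add[OF lin] plus_fun_def trunc_nth fun_eq_iff)
  define e where "e = (\<lambda>j (i :: nat). if i = j then 1 else (0 :: complex))"
  define E where "E = e ` {..<n}"
  have sum_apply: "(\<Sum>i\<in>I. F i) j = (\<Sum>i\<in>I. F i j)" for F :: "nat \<Rightarrow> nat \<Rightarrow> complex" and I j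
    by (induction I rule: infinite_finite_induct) auto
  have span: "v \<in> V.span E \<longleftrightarrow> trunc n v = v" for v
  proof
    assume "v \<in> V.span E"
    then show "trunc n v = v"
    proof (induction rule: V.span_induct_alt)
      case (step c x y)
      then show ?case
        by (auto simp: E_def e_def sc_def trunc_nth fun_eq_iff) metis
    qed (simp add: trunc_nth fun_eq_iff)
  next
    assume "trunc n v = v"
    then have "v i = 0" if "\<not> i < n" for i
      using that by (metis trunc_nth)
    then have "v = (\<Sum>j<n. sc (v j) (e j))"
      by (auto simp: fun_eq_iff sum_apply sc_def e_def trunc_nth if_distrib cong: if_cong)
    also have "\<dots> \<in> V.span E"
      by (intro V.span_sum V.span_scale V.span_base) (auto simp: E_def)
    finally show "v \<in> V.span E" .
  qed
  have inj_e: "inj_on e {..<n}"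
    by (auto simp: inj_on_def e_def fun_eq_iff split: if_splits)
  have "V.independent E"
  proof (rule V.independent_if_scalars_zero)
    show "finite E" by (simp add: E_def)
    fix g x assume g: "(\<Sum>x\<in>E. sc (g x) x) = 0" and "x \<in> E"
    then obtain j where j: "j < n" "x = e j" by (auto simp: E_def)
    have "(\<Sum>i<n. sc (g (e i)) (e i)) j = 0"
      using g inj_e by (simp add: E_def sum.reindex)
    moreover have "(\<Sum>i<n. sc (g (e i)) (e i)) j = g (e j)"
      using j(1) by (simp add: sum_apply sc_def e_def sum.delta if_distrib cong: if_cong)
    ultimately show "g x = 0" using j by simp
  qed
  moreover have injT: "inj_on T (V.span E)"
    unfolding T.inj_on_iff_eq_0[OF V.subspace_span]
    using inj span by (auto simp: T_def zero_fun_def)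
  ultimately have ind: "V.independent (T ` E)"
    by (rule T.independent_injective_image)
  have "finite E" "card (T ` E) = card E"
    using inj_on_subset[OF injT V.span_superset] by (auto simp: E_def card_image)
  have TE: "T ` E \<subseteq> V.span E"
    by (auto simp: span T_def trunc_nth fun_eq_iff)
  have "f \<in> V.span (T ` E)"
  proof (rule ccontr)
    assume nf: "f \<notin> V.span (T ` E)"
    then have "V.independent (insert f (T ` E))" "f \<notin> T ` E"
      using V.independent_insertI[OF _ ind] V.span_base by auto
    then have "card (insert f (T ` E)) \<le> card E"
      using V.independent_span_bound[OF \<open>finite E\<close>] TE span f by auto
    then show False
      using \<open>f \<notin> T ` E\<close> \<open>finite E\<close> \<open>card (T ` E) = card E\<close> by simp
  qed
  then obtain v where "v \<in> V.span E" "f = T v"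
    unfolding T.span_image by blast
  then show ?thesis
    using span by (auto simp: T_def)
qed

section \<open>Polynomials in the symmetric shift\<close>

definition sshift :: "(nat \<Rightarrow> complex) \<Rightarrow> nat \<Rightarrow> complex" where
  "sshift u i = (rshift u i + 2 * u i + lshift u i) / 4"

lemma bounded_op_sshift: "bounded_op sshift"
proof -
  have "bounded_op (\<lambda>u i. 1 / 4 * ((rshift u i + 2 * u i) + lshift u i))"
    by (rule bounded_op_scale[OF bounded_op_add[OF bounded_op_add[OF bounded_op_rshift
          bounded_op_scale[OF bounded_op_id]] bounded_op_lshift]])
  then show ?thesis
    by (simp add: sshift_def[abs_def])
qed

text \<open>Horner's scheme, patterned on the evaluation \<open>poly\<close> with
  \<open>sshift\<close> in place of the argument, so that induction over \<open>pCons\<close>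
  applies.\<close>

definition poly_op :: "complex poly \<Rightarrow> (nat \<Rightarrow> complex) \<Rightarrow> nat \<Rightarrow> complex" where
  "poly_op p = fold_coeffs (\<lambda>a F u i. a * u i + sshift (F u) i) p (\<lambda>u i. 0)"

lemma poly_op_0 [simp]: "poly_op 0 = (\<lambda>u i. 0)"
  by (simp add: poly_op_def)

lemma sshift_0 [simp]: "sshift (\<lambda>i. 0) = (\<lambda>i. 0)"
  by (simp add: lin_op_zero[OF bounded_op_lin[OF bounded_op_sshift]])

lemma poly_op_pCons [simp]: "poly_op (pCons a p) = (\<lambda>u i. a * u i + sshift (poly_op p u) i)"
  by (cases "p = 0 \<and> a = 0") (auto simp: poly_op_def)

lemma poly_op_add: "poly_op (p + q) u i = poly_op p u i + poly_op q u i"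
proof (induction p q arbitrary: i rule: poly_induct2)
  case (pCons a p b q)
  then have "poly_op (p + q) u = (\<lambda>i. poly_op p u i + poly_op q u i)" by auto
  then show ?case
    by (simp add: lin_op_add[OF bounded_op_lin[OF bounded_op_sshift]] algebra_simps)
qed simp

lemma poly_op_smult: "poly_op (smult c p) u i = c * poly_op p u i"
proof (induction p arbitrary: i)
  case (pCons a p)
  then have "poly_op (smult c p) u = (\<lambda>i. c * poly_op p u i)" by auto
  then show ?case
    by (simp add: lin_op_scale[OF bounded_op_lin[OF bounded_op_sshift]] algebra_simps)
qed simp

text \<open>Exact and not only up to compact operators, since both factors are polynomials in one
  and the same operator.\<close>

lemma poly_op_mult: "poly_op (p * q) u i = poly_op p (poly_op q u) i"
proof (induction p arbitrary: i)
  case (pCons a p)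
  then have "poly_op (p * q) u = poly_op p (poly_op q u)" by auto
  then show ?case
    by (simp add: poly_op_add poly_op_smult)
qed simp

lemma poly_op_sum: "poly_op (\<Sum>k\<in>I. p k) u i = (\<Sum>k\<in>I. poly_op (p k) u i)"
  by (induction I rule: infinite_finite_induct) (auto simp: poly_op_add)

lemma poly_op_1 [simp]: "poly_op 1 u = u"
  by (simp add: one_pCons)

lemma poly_op_power: "poly_op (p ^ n) u = (poly_op p ^^ n) u"
proof (induction n)
  case (Suc n)
  have "poly_op (p ^ Suc n) u = poly_op p (poly_op (p ^ n) u)"
    by (rule ext) (simp add: poly_op_mult)
  then show ?case using Suc by simp
qed simp

section \<open>Factorization\<close>

lemma cc_op_first_coord: "cc_op (\<lambda>u i. if i = 0 then u 0 else 0)"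
proof -
  have "(\<lambda>i. if i = 0 then 1 else 0 :: complex) \<longlonglongrightarrow> 0"
    by (rule tendsto_eventually) (auto simp: eventually_sequentially intro!: exI[of _ 1])
  from cc_op_diag[OF this] show ?thesis
    by (rule back_subst[of cc_op]) (auto simp: fun_eq_iff)
qed

text \<open>The left shift undoes the right shift, whereas the right shift after the left one erases
  entry 0. The two orders therefore differ by \<open>\<rho> * \<mu>\<close> times the projection
  onto entry 0.\<close>

lemma ufac_lfac_commute: "(\<lambda>u. ufac \<rho> (lfac \<mu> u)) \<simeq> (\<lambda>u. lfac \<mu> (ufac \<rho> u))"
proof (rule eq_cc_I)
  show "cc_op (\<lambda>u i. (\<rho> * \<mu>) * (if i = 0 then u 0 else 0))"
    by (rule cc_op_scale[OF cc_op_first_coord])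
  show "bounded_op (\<lambda>u. lfac \<mu> (ufac \<rho> u))"
    by (rule bounded_op_comp[OF bounded_op_lfac bounded_op_ufac])
qed (auto simp: lfac_def ufac_def lshift_def rshift_def algebra_simps)

lemma ufac_lprod_commute: "(\<lambda>u. ufac \<rho> (lprod \<mu>s u)) \<simeq> (\<lambda>u. lprod \<mu>s (ufac \<rho> u))"
proof (induction \<mu>s)
  case Nil
  show ?case by (simp add: eq_cc_refl bounded_op_ufac)
next
  case (Cons \<mu> \<mu>s)
  have "(\<lambda>u. ufac \<rho> (lfac \<mu> (lprod \<mu>s u))) \<simeq> (\<lambda>u. lfac \<mu> (ufac \<rho> (lprod \<mu>s u)))"
    by (rule eq_cc_comp[OF ufac_lfac_commute eq_cc_refl[OF bounded_op_lprod]])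
  also have "\<dots> \<simeq> (\<lambda>u. lfac \<mu> (lprod \<mu>s (ufac \<rho> u)))"
    by (rule eq_cc_comp[OF eq_cc_refl[OF bounded_op_lfac] Cons])
  finally show ?case by simp
qed

text \<open>The parametrization of \<open>r\<close> by the Joukowsky map \<open>\<rho> + 1 / \<rho>\<close>, which maps the unit circle
  onto the segment excluded here.\<close>

lemma joukowsky_parameter:
  assumes "\<And>x. 0 \<le> x \<Longrightarrow> x \<le> 1 \<Longrightarrow> r \<noteq> complex_of_real x"
  obtains \<rho> where "\<rho> \<noteq> 0" "cmod \<rho> < 1" "1 + \<rho>\<^sup>2 = (4 * r - 2) * \<rho>"
proof -
  \<comment> \<open>\<open>a\<close> and \<open>b\<close> are the roots of z^2 - (4 r - 2) z + 1.
    Their product is 1, so one of them lies inside the unit disc unless both lie on the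
    circle.\<close>
  define d where "d = csqrt ((2 * r - 1)\<^sup>2 - 1)"
  define a b where "a = (2 * r - 1) + d" and "b = (2 * r - 1) - d"
  have d2: "d\<^sup>2 = (2 * r - 1)\<^sup>2 - 1"
    by (simp add: d_def)
  have ab: "a * b = 1"
    using d2 by (simp add: a_def b_def power2_eq_square algebra_simps)
  have eqs: "1 + a\<^sup>2 = (4 * r - 2) * a" "1 + b\<^sup>2 = (4 * r - 2) * b"
    using d2 by (simp_all add: a_def b_def power2_eq_square algebra_simps)
  \<comment> \<open>On the circle 1 / z is the conjugate of z, so 4 r - 2 = 2 Re z and
    \<open>r\<close> would lie in [0, 1].\<close>
  have ne: "cmod z \<noteq> 1" if z: "1 + z\<^sup>2 = (4 * r - 2) * z" for z
  proof
    assume 1: "cmod z = 1"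
    then have "z * cnj z = 1" by (simp add: complex_norm_square[symmetric])
    then have "(1 + z\<^sup>2) * cnj z = cnj z + z"
      by (simp add: power2_eq_square algebra_simps)
    moreover have "(1 + z\<^sup>2) * cnj z = 4 * r - 2"
      using \<open>z * cnj z = 1\<close> by (simp add: z mult.assoc)
    ultimately have "4 * r = 2 + 2 * complex_of_real (Re z)"
      using complex_add_cnj[of z] by (simp add: algebra_simps)
    then have "r = (2 + 2 * complex_of_real (Re z)) / 4"
      by (metis nonzero_mult_div_cancel_left zero_neq_numeral)
    moreover have "(2 + 2 * w) / 4 = (1 + w) / 2" for w :: complex
      by (simp add: field_simps)
    ultimately have "r = complex_of_real ((1 + Re z) / 2)"
      by simp
    moreover have "0 \<le> (1 + Re z) / 2" "(1 + Re z) / 2 \<le> 1"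
      using abs_Re_le_cmod[of z] 1 by auto
    ultimately show False using assms by blast
  qed
  have "cmod a * cmod b = 1"
    using ab by (metis norm_mult norm_one)
  then consider "cmod a < 1" | "cmod b < 1"
    using ne[OF eqs(1)] by (metis less_1_mult linorder_neqE_linordered_idom mult.right_neutral order_less_irrefl)
  moreover have "a \<noteq> 0" "b \<noteq> 0"
    using ab by auto
  ultimately show ?thesis
    using that[of a] that[of b] eqs by cases blast+
qed

text \<open>Induction on the degree, splitting off a root. The hypothesis keeps the root out of
  [0, 1], so \<open>joukowsky_parameter\<close> applies, and its \<rho> enters the lower and the
  upper product alike.\<close>

lemma poly_op_factorization:
  assumes "\<And>x. 0 \<le> x \<Longrightarrow> x \<le> 1 \<Longrightarrow> poly p (complex_of_real x) \<noteq> 0"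
  shows "\<exists>c \<rho>s. c \<noteq> 0 \<and> (\<forall>\<rho>\<in>set \<rho>s. cmod \<rho> < 1) \<and> poly_op p \<simeq> (\<lambda>u i. c * lprod \<rho>s (uprod \<rho>s u) i)"
  using assms
proof (induction "degree p" arbitrary: p rule: less_induct)
  case less
  show ?case
  proof (cases "degree p = 0")
    case True
    then obtain c where c: "p = [:c:]"
      using degree_eq_zeroE by blast
    then have "c \<noteq> 0"
      using less.prems[of 0] by auto
    then show ?thesis
      using c by (intro exI[of _ c] exI[of _ "[]"])
        (use eq_cc_refl[OF bounded_op_scale[OF bounded_op_id, of c]] in simp)
  next
    case False
    then obtain r where r: "poly p r = 0"
      using fundamental_theorem_of_algebra[of p] constant_degree[of p] by auto
    then obtain q where q: "p = [:- r, 1:] * q"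
      by (metis dvdE poly_eq_0_iff_dvd)
    have "q \<noteq> 0"
      using q False by auto
    then have "degree q < degree p"
      unfolding q by (subst degree_mult_eq) auto
    moreover have "poly q (complex_of_real x) \<noteq> 0" if "0 \<le> x" "x \<le> 1" for x
      using less.prems[OF that] by (simp add: q)
    ultimately have "\<exists>c \<rho>s. c \<noteq> 0 \<and> (\<forall>\<rho>\<in>set \<rho>s. cmod \<rho> < 1) \<and>
        poly_op q \<simeq> (\<lambda>u i. c * lprod \<rho>s (uprod \<rho>s u) i)"
      by (rule less.hyps)
    then obtain c \<rho>s where IH: "c \<noteq> 0" "\<forall>\<rho>\<in>set \<rho>s. cmod \<rho> < 1"
      "poly_op q \<simeq> (\<lambda>u i. c * lprod \<rho>s (uprod \<rho>s u) i)"
      by (elim exE conjE)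
    obtain \<rho> where \<rho>: "\<rho> \<noteq> 0" "cmod \<rho> < 1" "1 + \<rho>\<^sup>2 = (4 * r - 2) * \<rho>"
      by (rule joukowsky_parameter[of r]) (use r less.prems in blast)+
    \<comment> \<open>Expanding \<open>ufac \<rho>\<close> after \<open>lfac \<rho>\<close> gives 1
      + \<rho>^2 minus \<rho> times both shifts, which is -4 \<rho> times \<open>sshift\<close>
      minus \<open>r\<close>. This is exact because the left shift undoes the right one; only moving
      \<open>ufac \<rho>\<close> past the lower factors afterwards costs compact terms.\<close>
    define d where "d = - 1 / (4 * \<rho>)"
    have fac: "poly_op [:- r, 1:] u i = d * ufac \<rho> (lfac \<rho> u) i" for u i
    proof -
      have "ufac \<rho> (lfac \<rho> u) i = (1 + \<rho>\<^sup>2) * u i - \<rho> * (rshift u i + lshift u i)"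
        by (simp add: ufac_def lfac_def lshift_def rshift_def power2_eq_square algebra_simps)
      also have "\<dots> = - (4 * \<rho>) * poly_op [:- r, 1:] u i"
        by (simp add: \<rho>(3) sshift_def field_simps)
      finally show ?thesis
        using \<rho>(1) by (simp add: d_def)
    qed
    have lin: "lin_op (\<lambda>u. lfac \<rho> u)" "lin_op (\<lambda>u. ufac \<rho> u)"
      using bounded_op_lin bounded_op_lfac bounded_op_ufac by metis+
    have bd: "bounded_op (\<lambda>u. ufac \<rho> (lfac \<rho> u))"
      by (rule bounded_op_comp[OF bounded_op_ufac bounded_op_lfac])
    have "poly_op p = (\<lambda>u. poly_op [:- r, 1:] (poly_op q u))"
      unfolding q by (intro ext poly_op_mult)
    also have "\<dots> = (\<lambda>u i. d * ufac \<rho> (lfac \<rho> (poly_op q u)) i)"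
      by (intro ext fac)
    also have "\<dots> \<simeq> (\<lambda>u i. d * ufac \<rho> (lfac \<rho> (\<lambda>i. c * lprod \<rho>s (uprod \<rho>s u) i)) i)"
      by (rule eq_cc_scale[OF eq_cc_comp[OF eq_cc_refl[OF bd] IH(3)]])
    also have "\<dots> = (\<lambda>u i. (d * c) * ufac \<rho> (lprod (\<rho> # \<rho>s) (uprod \<rho>s u)) i)"
      by (simp add: lin_op_scale[OF lin(1)] lin_op_scale[OF lin(2)] mult.assoc)
    also have "\<dots> \<simeq> (\<lambda>u i. (d * c) * lprod (\<rho> # \<rho>s) (ufac \<rho> (uprod \<rho>s u)) i)"
      by (rule eq_cc_scale[OF eq_cc_comp[OF ufac_lprod_commute eq_cc_refl[OF bounded_op_uprod]]])
    also have "\<dots> = (\<lambda>u i. (d * c) * lprod (\<rho> # \<rho>s) (uprod (\<rho> # \<rho>s) u) i)"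
      by simp
    finally show ?thesis
      using IH(1,2) \<rho> by (intro exI[of _ "d * c"] exI[of _ "\<rho> # \<rho>s"]) (auto simp: d_def)
  qed
qed

declare binomial_Suc_Suc [simp del]

section \<open>The Jacobi polynomials with parameters 1 and 0\<close>

text \<open>The same polynomials as elements of \<open>real poly\<close>, which gives access to
  degrees, coefficients and derivatives. Symmetry of the binomials replaces \<open>n - s\<close> by
  \<open>Suc s\<close> in the first coefficient.\<close>

definition P10_poly :: "nat \<Rightarrow> real poly" where
  "P10_poly n = (\<Sum>s\<le>n. smult (real (Suc n choose Suc s) * real (n choose s)) ([:- 1, 1:] ^ s * [:0, 1:] ^ (n - s)))"

lemma P10_explicit:
  "P10 n x = (\<Sum>s\<le>n. real (Suc n choose Suc s) * real (n choose s) * (x - 1) ^ s * x ^ (n - s))"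
proof -
  have 1: "((real n + 1) gchoose (n - s)) = real (Suc n choose Suc s)" if "s \<le> n" for s
  proof -
    have "real (Suc n) gchoose (n - s) = real (Suc n choose (n - s))"
      by (rule binomial_gbinomial[symmetric])
    also have "Suc n choose (n - s) = Suc n choose Suc s"
      using binomial_symmetric[of "Suc s" "Suc n"] that by simp
    finally show ?thesis by (simp add: add.commute)
  qed
  have 2: "(real n + 0) gchoose s = real (n choose s)" for s
    by (simp add: binomial_gbinomial)
  have 3: "(2 * x - 1 - 1) / 2 = x - 1" "(2 * x - 1 + 1) / 2 = x"
    by simp_all
  show ?thesis
    unfolding shifted_jacobi_def jacobi_def
    by (rule sum.cong) (simp_all only: 1 2 3 atMost_iff)
qed

lemma poly_P10_poly: "poly (P10_poly n) x = P10 n x"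
  unfolding P10_explicit P10_poly_def by (simp add: poly_sum mult.assoc)

lemma P10_at_0: "P10 n 0 = (- 1) ^ n"
proof -
  have "P10 n 0 = (\<Sum>s\<le>n. if s = n then (- 1) ^ n else 0)"
    unfolding P10_explicit by (intro sum.cong) auto
  then show ?thesis by simp
qed

lemma P10_at_1: "P10 n 1 = real n + 1"
proof -
  have "P10 n 1 = (\<Sum>s\<le>n. if s = 0 then real n + 1 else 0)"
    unfolding P10_explicit by (intro sum.cong) auto
  then show ?thesis by simp
qed

lemma degree_P10_poly_le: "degree (P10_poly n) \<le> n"
  unfolding P10_poly_def
proof (rule degree_sum_le)
  fix s assume "s \<in> {..n}"
  then have "degree ([:- 1, 1:] ^ s * [:0, 1:] ^ (n - s) :: real poly) \<le> n"
    by (subst degree_mult_eq) (auto simp: degree_power_eq)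
  then show "degree (smult (real (Suc n choose Suc s) * real (n choose s)) ([:- 1, 1:] ^ s * [:0, 1:] ^ (n - s))) \<le> n"
    using degree_smult_le order_trans by blast
qed simp

text \<open>Every summand is a positive multiple of a monic polynomial of degree \<open>n\<close>,
  so nothing cancels and the degree is exactly \<open>n\<close>.\<close>

lemma coeff_P10_poly_pos: "0 < coeff (P10_poly n) n"
proof -
  have "coeff ([:- 1, 1:] ^ s * [:0, 1:] ^ (n - s)) n = (1 :: real)" if "s \<le> n" for s
  proof -
    have "degree ([:- 1, 1:] ^ s * [:0, 1:] ^ (n - s) :: real poly) = n"
      using that by (subst degree_mult_eq) (auto simp: degree_power_eq)
    moreover have "lead_coeff ([:- 1, 1:] ^ s * [:0, 1:] ^ (n - s) :: real poly) = 1"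
      by (simp add: lead_coeff_mult lead_coeff_power)
    ultimately show ?thesis by simp
  qed
  then have "coeff (P10_poly n) n = (\<Sum>s\<le>n. real (Suc n choose Suc s) * real (n choose s))"
    unfolding P10_poly_def by (simp add: coeff_sum)
  also have "\<dots> > 0"
    by (intro sum_pos) auto
  finally show ?thesis .
qed

text \<open>This compares the coefficients of z^s (1 - z)^(n - s) in
  \<open>P10_reflected_deriv\<close>, up to sign. Two absorption identities extract the common
  factor (n + 1) \<open>n choose s\<close> from the terms on the left, and Pascal's rule adds what
  remains.\<close>

lemma P10_coeff_identity:
  assumes "s \<le> n"
  defines "c \<equiv> \<lambda>s. real (Suc n choose Suc s) * real (n choose s)"
  shows "(real s + 1) * c s + (if s = 0 then 0 else c (s - 1) * (real n - real s + 1)) = (real n + 1) * c (n - s)"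
proof -
  have cns: "c (n - s) = real (Suc n choose s) * real (n choose s)"
  proof -
    have "Suc n choose Suc (n - s) = Suc n choose s"
      using binomial_symmetric[of s "Suc n"] assms by (simp add: Suc_diff_le)
    moreover have "n choose (n - s) = n choose s"
      using binomial_symmetric[of s n] assms by simp
    ultimately show ?thesis by (simp add: c_def)
  qed
  have 1: "(real s + 1) * real (Suc n choose Suc s) = (real n + 1) * real (n choose s)"
    using arg_cong[OF Suc_times_binomial_eq[of n s], of real] by (simp add: algebra_simps)
  show ?thesis
  proof (cases s)
    case 0
    then show ?thesis using cns 1 by (simp add: c_def)
  next
    case (Suc t)
    have 2: "(real n - real t) * real (Suc n choose Suc t) = (real n + 1) * real (n choose Suc t)"
    proof -
      have "(Suc n - Suc t) * (Suc n choose Suc t) = Suc n * (n choose Suc t)"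
        using binomial_absorb_comp[of "Suc n" "Suc t"] by simp
      from arg_cong[OF this, of real] show ?thesis
        using assms(1) Suc by (simp add: of_nat_diff algebra_simps)
    qed
    have pascal: "real (Suc n choose s) = real (n choose s) + real (n choose t)"
      by (simp add: Suc binomial_Suc_Suc)
    have "(real s + 1) * c s + c t * (real n - real t) =
        ((real s + 1) * real (Suc n choose Suc s)) * real (n choose s) +
        ((real n - real t) * real (Suc n choose Suc t)) * real (n choose t)"
      by (simp add: c_def algebra_simps)
    also have "\<dots> = (real n + 1) * (real (n choose s) * (real (n choose s) + real (n choose t)))"
      unfolding 1 2 by (simp add: Suc algebra_simps)
    also have "\<dots> = (real n + 1) * c (n - s)"
      unfolding cns pascal by simp
    finally show ?thesis
      using Suc by simp
  qed
qed

text \<open>The origin of the diagonal of \<open>D_op\<close>: integrated from 0 to 1 - x, it says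
  that averaging over [0, 1 - x] multiplies \<open>P10 n\<close> by (-1)^n / (n + 1). The proof
  differentiates in the basis z^s (1 - z)^(n - s) and compares coefficients.\<close>

lemma P10_reflected_deriv:
  "((\<lambda>z. z * P10 n (1 - z)) has_real_derivative (- 1) ^ n * (real n + 1) * P10 n z) (at z)"
proof -
  define c where "c = (\<lambda>s. real (Suc n choose Suc s) * real (n choose s))"
  \<comment> \<open>The part of the product rule that differentiates the power of 1 - z, with
    \<open>s\<close> raised by one so that both parts use the same basis; nothing arrives at
    \<open>s = 0\<close>.\<close>
  define G where "G = (\<lambda>s. if s = 0 then 0 else c (s - 1) * (real n - real s + 1) * (- 1) ^ s * z ^ s * (1 - z) ^ (n - s))"
  have fun_eq: "(\<lambda>z. z * P10 n (1 - z)) = (\<lambda>z. \<Sum>s\<le>n. c s * (- 1) ^ s * (z ^ Suc s * (1 - z) ^ (n - s)))"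
  proof
    fix z :: real
    have "(1 - z - 1) ^ s = (- 1) ^ s * z ^ s" for s
      by (simp flip: power_mult_distrib)
    then show "z * P10 n (1 - z) = (\<Sum>s\<le>n. c s * (- 1) ^ s * (z ^ Suc s * (1 - z) ^ (n - s)))"
      unfolding P10_explicit c_def sum_distrib_left
      by (intro sum.cong) auto
  qed
  have "((\<lambda>z. \<Sum>s\<le>n. c s * (- 1) ^ s * (z ^ Suc s * (1 - z) ^ (n - s))) has_real_derivative
      (\<Sum>s\<le>n. c s * (- 1) ^ s * ((real s + 1) * z ^ s * (1 - z) ^ (n - s) -
         z ^ Suc s * (real (n - s) * (1 - z) ^ (n - s - 1))))) (at z)"
    by (intro DERIV_sum DERIV_cmult)
      (auto intro!: derivative_eq_intros simp: algebra_simps simp del: power_Suc)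
  also have "(\<Sum>s\<le>n. c s * (- 1) ^ s * ((real s + 1) * z ^ s * (1 - z) ^ (n - s) -
         z ^ Suc s * (real (n - s) * (1 - z) ^ (n - s - 1)))) =
      (\<Sum>s\<le>n. (real s + 1) * c s * (- 1) ^ s * z ^ s * (1 - z) ^ (n - s)) +
      (\<Sum>s\<le>n. - (c s * (- 1) ^ s * z ^ Suc s * (real (n - s) * (1 - z) ^ (n - s - 1))))"
    by (simp flip: sum.distrib add: algebra_simps)
  also have "(\<Sum>s\<le>n. - (c s * (- 1) ^ s * z ^ Suc s * (real (n - s) * (1 - z) ^ (n - s - 1)))) =
      (\<Sum>s<n. - (c s * (- 1) ^ s * z ^ Suc s * (real (n - s) * (1 - z) ^ (n - s - 1))))"
    by (simp flip: lessThan_Suc_atMost)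
  also have "\<dots> = (\<Sum>s<n. G (Suc s))"
    by (intro sum.cong) (auto simp: G_def algebra_simps of_nat_diff)
  also have "\<dots> = (\<Sum>s\<le>n. G s)"
    by (simp add: sum.atMost_shift G_def)
  also have "(\<Sum>s\<le>n. (real s + 1) * c s * (- 1) ^ s * z ^ s * (1 - z) ^ (n - s)) + (\<Sum>s\<le>n. G s) =
      (\<Sum>s\<le>n. (real n + 1) * c (n - s) * (- 1) ^ s * z ^ s * (1 - z) ^ (n - s))"
    unfolding sum.distrib[symmetric]
  proof (rule sum.cong[OF refl])
    fix s assume "s \<in> {..n}"
    then have id: "(real s + 1) * c s + (if s = 0 then 0 else c (s - 1) * (real n - real s + 1)) = (real n + 1) * c (n - s)"
      using P10_coeff_identity[of s n] by (cases s) (simp_all add: c_def)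
    have "(real s + 1) * c s * (- 1) ^ s * z ^ s * (1 - z) ^ (n - s) + G s =
        ((real s + 1) * c s + (if s = 0 then 0 else c (s - 1) * (real n - real s + 1))) * ((- 1) ^ s * z ^ s * (1 - z) ^ (n - s))"
      by (simp add: G_def algebra_simps)
    then show "(real s + 1) * c s * (- 1) ^ s * z ^ s * (1 - z) ^ (n - s) + G s =
        (real n + 1) * c (n - s) * (- 1) ^ s * z ^ s * (1 - z) ^ (n - s)"
      unfolding id by (simp add: mult.assoc)
  qed
  also have "\<dots> = (\<Sum>s\<le>n. (real n + 1) * c s * (- 1) ^ (n - s) * z ^ (n - s) * (1 - z) ^ s)"
    by (rule sum.reindex_bij_witness[of _ "\<lambda>s. n - s" "\<lambda>s. n - s"]) auto
  also have "\<dots> = (- 1) ^ n * (real n + 1) * P10 n z"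
    unfolding P10_explicit sum_distrib_left
  proof (rule sum.cong[OF refl])
    fix s assume "s \<in> {..n}"
    then have "(- 1) ^ (n - s) * (1 - z) ^ s = (- 1) ^ n * (z - 1) ^ s"
    proof -
      have "(1 - z) ^ s = (- 1) ^ s * (z - 1) ^ s"
        by (simp flip: power_mult_distrib)
      moreover have "(- 1 :: real) ^ (n - s) * (- 1) ^ s = (- 1) ^ n"
        using \<open>s \<in> {..n}\<close> by (simp flip: power_add)
      ultimately show ?thesis by (metis mult.assoc)
    qed
    then have "(real n + 1) * c s * z ^ (n - s) * ((- 1) ^ (n - s) * (1 - z) ^ s) =
        (real n + 1) * c s * z ^ (n - s) * ((- 1) ^ n * (z - 1) ^ s)"
      by simp
    then show "(real n + 1) * c s * (- 1) ^ (n - s) * z ^ (n - s) * (1 - z) ^ s =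
        (- 1) ^ n * (real n + 1) * (real (Suc n choose Suc s) * real (n choose s) * (z - 1) ^ s * z ^ (n - s))"
      by (simp add: c_def mult_ac)
  qed
  finally show ?thesis
    by (simp add: fun_eq)
qed

lemma P10_antiderivative:
  "((\<lambda>z. (- 1) ^ n / (real n + 1) * (z * P10 n (1 - z))) has_real_derivative P10 n x) (at x)"
proof -
  have "((\<lambda>z. (- 1) ^ n / (real n + 1) * (z * P10 n (1 - z))) has_real_derivative
      (- 1) ^ n / (real n + 1) * ((- 1) ^ n * (real n + 1) * P10 n x)) (at x)"
    by (rule DERIV_cmult[OF P10_reflected_deriv])
  moreover have "(- 1) ^ n / (real n + 1) * ((- 1) ^ n * (real n + 1) * P10 n x) = ((- 1) ^ n * (- 1) ^ n) * P10 n x"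
    by (simp add: field_simps)
  moreover have "(- 1) ^ n * (- 1) ^ n = (1 :: real)"
    by (simp flip: power_mult_distrib)
  ultimately show ?thesis by simp
qed

lemma has_integral_P10:
  assumes "0 \<le> z"
  shows "(P10 n has_integral (- 1) ^ n / (real n + 1) * z * P10 n (1 - z)) {0..z}"
proof -
  have "((\<lambda>z. (- 1) ^ n / (real n + 1) * (z * P10 n (1 - z))) has_vector_derivative P10 n x) (at x within {0..z})" for x
    using P10_antiderivative[of n x]
    by (simp add: has_real_derivative_iff_has_vector_derivative has_vector_derivative_at_within)
  from fundamental_theorem_of_calculus[OF assms this] show ?thesis
    by (simp add: mult.assoc)
qed

lemma continuous_on_P10: "continuous_on S (P10 n)"
  unfolding poly_P10_poly[symmetric, abs_def] by (intro continuous_intros)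

section \<open>Orthogonality and norms\<close>

lemma integral_01_reflect:
  fixes f :: "real \<Rightarrow> real"
  assumes "continuous_on {0..1} f"
  shows "integral {0..1} (\<lambda>x. f (1 - x)) = integral {0..1} f"
proof -
  have "(f has_integral integral {0..1} f) (cbox 0 1)"
    using integrable_continuous_real[OF assms] by (simp add: integrable_integral)
  from has_integral_affinity[OF this, of "- 1" 1] show ?thesis
    by (auto simp: integral_unique)
qed

definition P10_ip :: "(real \<Rightarrow> real) \<Rightarrow> (real \<Rightarrow> real) \<Rightarrow> real" where
  "P10_ip f g = integral {0..1} (\<lambda>x. (1 - x) * f x * g x)"

text \<open>The eigenvalue relation of the symmetric operator mapping \<open>f\<close> to
  \<open>(\<integral>\<^sub>0\<^bsup>1-x\<^esup> f) / (1 - x)\<close>.\<close>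

lemma P10_ip_eigen:
  "(- 1) ^ n / (real n + 1) * P10_ip (P10 n) (P10 m) = (- 1) ^ m / (real m + 1) * P10_ip (P10 n) (P10 m)"
proof -
  define F where "F = (\<lambda>n z. (- 1) ^ n / (real n + 1) * (z * P10 n (1 - z)))"
  have F: "(F n has_real_derivative P10 n x) (at x)" for n x
    unfolding F_def by (rule P10_antiderivative)
  have cont: "continuous_on S (F n)" for S n
    using F DERIV_isCont continuous_at_imp_continuous_on by blast
  \<comment> \<open>Integration by parts of the product of \<open>F n (1 - x)\<close> and
    \<open>F m x\<close>; both boundary terms vanish because \<open>F\<close> is 0 at 0.\<close>
  have "((\<lambda>x. F n (1 - x) * P10 m x - P10 n (1 - x) * F m x) has_integral F n (1 - 1) * F m 1 - F n (1 - 0) * F m 0) {0..1}"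
  proof (rule fundamental_theorem_of_calculus)
    fix x :: real
    have "((\<lambda>x. F n (1 - x) * F m x) has_real_derivative (P10 n (1 - x) * - 1) * F m x + P10 m x * F n (1 - x)) (at x)"
      by (intro DERIV_mult F DERIV_chain2[OF F, of "\<lambda>x. 1 - x"]) (auto intro!: derivative_eq_intros)
    then show "((\<lambda>x. F n (1 - x) * F m x) has_vector_derivative F n (1 - x) * P10 m x - P10 n (1 - x) * F m x) (at x within {0..1})"
      by (simp add: has_real_derivative_iff_has_vector_derivative has_vector_derivative_at_within algebra_simps)
  qed simp
  then have "integral {0..1} (\<lambda>x. F n (1 - x) * P10 m x - P10 n (1 - x) * F m x) = 0"
    by (simp add: F_def integral_unique)
  moreover have cr: "continuous_on {0..1} (\<lambda>x. F n (1 - x))" "continuous_on {0..1} (\<lambda>x. P10 n (1 - x))"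
    by (rule continuous_on_compose2[OF cont[of UNIV n]] continuous_on_compose2[OF continuous_on_P10[of UNIV n]];
        auto intro!: continuous_intros)+
  ultimately have "integral {0..1} (\<lambda>x. F n (1 - x) * P10 m x) = integral {0..1} (\<lambda>x. P10 n (1 - x) * F m x)"
    by (subst (asm) integral_diff) (auto intro!: integrable_continuous_real continuous_intros continuous_on_P10 cont)
  \<comment> \<open>The reflection produces \<open>F m (1 - x)\<close>, which is the eigenvalue for
    \<open>m\<close> times (1 - x) \<open>P10 m x\<close>; the left-hand side contains
    \<open>F n (1 - x)\<close> in the same way.\<close>
  also have "\<dots> = integral {0..1} (\<lambda>x. P10 n (1 - (1 - x)) * F m (1 - x))"
    by (rule integral_01_reflect[symmetric]) (intro continuous_intros cr cont)
  also have "\<dots> = integral {0..1} (\<lambda>x. (- 1) ^ m / (real m + 1) * ((1 - x) * P10 n x * P10 m x))"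
    by (simp add: F_def mult_ac)
  finally have "integral {0..1} (\<lambda>x. (- 1) ^ n / (real n + 1) * ((1 - x) * P10 n x * P10 m x)) =
      integral {0..1} (\<lambda>x. (- 1) ^ m / (real m + 1) * ((1 - x) * P10 n x * P10 m x))"
    by (simp add: F_def mult_ac)
  then show ?thesis
    unfolding P10_ip_def integral_mult_right .
qed

text \<open>The eigenvalues (-1)^n / (n + 1) have pairwise distinct moduli.\<close>

lemma P10_orthogonal:
  assumes "n \<noteq> m"
  shows "P10_ip (P10 n) (P10 m) = 0"
proof (rule ccontr)
  assume "P10_ip (P10 n) (P10 m) \<noteq> 0"
  then have "(- 1) ^ n / (real n + 1) = (- 1 :: real) ^ m / (real m + 1)"
    by (rule mult_right_cancel[THEN iffD1, OF _ P10_ip_eigen])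
  then have "\<bar>(- 1) ^ n / (real n + 1)\<bar> = \<bar>(- 1 :: real) ^ m / (real m + 1)\<bar>"
    by simp
  then show False
    using assms by (simp add: abs_divide power_abs)
qed

lemma integrable_P10_ip:
  "continuous_on {0..1} f \<Longrightarrow> continuous_on {0..1} g \<Longrightarrow> (\<lambda>x. (1 - x) * f x * g x) integrable_on {0..1 :: real}"
  by (intro integrable_continuous_real continuous_intros) auto

lemma P10_poly_span:
  assumes "degree p \<le> n"
  shows "\<exists>c. p = (\<Sum>m\<le>n. smult (c m) (P10_poly m))"
  using assms
proof (induction n arbitrary: p)
  case 0
  have "degree (P10_poly 0) = 0"
    using degree_P10_poly_le[of 0] by simp
  then obtain b where b: "P10_poly 0 = [:b:]"
    using degree_eq_zeroE by blast
  with coeff_P10_poly_pos[of 0] have "b \<noteq> 0" by auto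
  moreover obtain a where "p = [:a:]"
    using 0 degree_eq_zeroE by blast
  ultimately show ?case
    by (intro exI[of _ "\<lambda>_. a / b"]) (simp add: b)
next
  case (Suc n)
  define a where "a = coeff p (Suc n) / coeff (P10_poly (Suc n)) (Suc n)"
  define q where "q = p - smult a (P10_poly (Suc n))"
  have "coeff q i = 0" if "i > n" for i
  proof (cases "i = Suc n")
    case True
    then show ?thesis
      using coeff_P10_poly_pos[of "Suc n"] by (simp add: q_def a_def)
  next
    case False
    then show ?thesis
      using that Suc.prems degree_P10_poly_le[of "Suc n"] by (simp add: q_def coeff_eq_0)
  qed
  then have "degree q \<le> n"
    by (meson degree_le)
  from Suc.IH[OF this] obtain c where c: "q = (\<Sum>m\<le>n. smult (c m) (P10_poly m))" ..
  have "p = (\<Sum>m\<le>Suc n. smult ((c(Suc n := a)) m) (P10_poly m))"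
    using c by (simp add: q_def algebra_simps)
  then show ?case
    by (rule exI[of _ "c(Suc n := a)"])
qed

lemma P10_ip_sum_left:
  assumes "finite I" "\<And>i. i \<in> I \<Longrightarrow> continuous_on {0..1} (f i)" "continuous_on {0..1} g"
  shows "P10_ip (\<lambda>x. \<Sum>i\<in>I. c i * f i x) g = (\<Sum>i\<in>I. c i * P10_ip (f i) g)"
proof -
  have "P10_ip (\<lambda>x. \<Sum>i\<in>I. c i * f i x) g = integral {0..1} (\<lambda>x. \<Sum>i\<in>I. c i * ((1 - x) * f i x * g x))"
    unfolding P10_ip_def by (simp add: sum_distrib_left sum_distrib_right mult_ac)
  also have "\<dots> = (\<Sum>i\<in>I. integral {0..1} (\<lambda>x. c i * ((1 - x) * f i x * g x)))"
    by (rule integral_sum) (use assms in \<open>auto intro!: integrable_on_mult_right integrable_P10_ip\<close>)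
  finally show ?thesis
    by (simp add: P10_ip_def)
qed

lemma P10_ip_lower_degree:
  assumes "degree p < n"
  shows "P10_ip (poly p) (P10 n) = 0"
proof -
  have "degree p \<le> n - 1"
    using assms by simp
  from P10_poly_span[OF this] obtain c where "p = (\<Sum>m\<le>n - 1. smult (c m) (P10_poly m))"
    by blast
  then have "poly p = (\<lambda>x. \<Sum>m\<le>n - 1. c m * P10 m x)"
    by (simp add: fun_eq_iff poly_sum poly_P10_poly)
  then show ?thesis
    using assms by (simp add: P10_ip_sum_left continuous_on_P10 P10_orthogonal)
qed

text \<open>Write P for \<open>P10 n\<close>. Integrating the derivative of (1 - x) P^2 gives 1 for
  the unweighted integral of P^2, because P' has lower degree. Integrating that of x (1 - x) P^2
  then gives (2 n + 2) h = 1 for the weighted integral h.\<close>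

lemma P10_ip_self: "P10_ip (P10 n) (P10 n) = 1 / (2 * (real n + 1))"
proof -
  let ?p = "P10_poly n"
  define h I where "h = P10_ip (P10 n) (P10 n)" and "I = integral {0..1} (\<lambda>x. (P10 n x)\<^sup>2)"
  have D: "(P10 n has_real_derivative poly (pderiv ?p) x) (at x)" for x
    using poly_DERIV[of ?p x] by (simp add: poly_P10_poly[abs_def])
  have cD: "continuous_on S (poly (pderiv ?p))" for S
    by (intro continuous_intros)
  have 1: "P10_ip (poly (pderiv ?p)) (P10 n) = 0"
  proof (cases "degree ?p = 0")
    case True
    then have "pderiv ?p = 0"
      by (simp add: pderiv_eq_0_iff)
    then show ?thesis by (simp add: P10_ip_def)
  next
    case False
    then show ?thesis
      using degree_pderiv[of ?p] degree_P10_poly_le[of n] by (intro P10_ip_lower_degree) simp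
  qed
  \<comment> \<open>The leading terms of x P' and n P cancel, so this remainder is orthogonal to
    P.\<close>
  define r where "r = [:0, 1:] * pderiv ?p - smult (real n) ?p"
  have 2: "P10_ip (poly r) (P10 n) = 0"
  proof (cases "n = 0")
    case True
    then have "pderiv ?p = 0"
      using degree_P10_poly_le[of n] by (simp add: pderiv_eq_0_iff)
    then show ?thesis
      using True by (simp add: r_def P10_ip_def)
  next
    case False
    have "coeff r i = 0" if "i \<ge> n" for i
    proof (cases "i = n")
      case True
      then show ?thesis
        using False by (cases n) (auto simp: r_def coeff_pCons coeff_pderiv)
    next
      case 2: False
      then show ?thesis
        using that degree_P10_poly_le[of n] by (cases i) (auto simp: r_def coeff_pderiv coeff_eq_0)
    qed
    then have "degree r \<le> n - 1"
      by (intro degree_le) (use False in auto)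
    then show ?thesis
      using False by (intro P10_ip_lower_degree) simp
  qed
  have "((\<lambda>x. - (P10 n x)\<^sup>2 + 2 * ((1 - x) * poly (pderiv ?p) x * P10 n x)) has_integral
      (1 - 1) * (P10 n 1)\<^sup>2 - (1 - 0) * (P10 n 0)\<^sup>2) {0..1}"
  proof (rule fundamental_theorem_of_calculus)
    show "((\<lambda>x. (1 - x) * (P10 n x)\<^sup>2) has_vector_derivative - (P10 n x)\<^sup>2 + 2 * ((1 - x) * poly (pderiv ?p) x * P10 n x)) (at x within {0..1})" for x
      unfolding has_real_derivative_iff_has_vector_derivative[symmetric]
      by (rule DERIV_subset[OF _ subset_UNIV]) (auto intro!: derivative_eq_intros D simp: power2_eq_square algebra_simps)
  qed simp
  then have "integral {0..1} (\<lambda>x. - (P10 n x)\<^sup>2 + 2 * ((1 - x) * poly (pderiv ?p) x * P10 n x)) = - 1"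
    by (simp add: integral_unique P10_at_0 flip: power_mult)
  moreover have "integral {0..1} (\<lambda>x. - (P10 n x)\<^sup>2 + 2 * ((1 - x) * poly (pderiv ?p) x * P10 n x)) =
      - I + 2 * P10_ip (poly (pderiv ?p)) (P10 n)"
    unfolding I_def P10_ip_def
    by (subst integral_add)
      (auto intro!: integrable_continuous_real continuous_intros continuous_on_P10 cD)
  ultimately have I: "I = 1" by (simp add: 1)
  have "((\<lambda>x. 2 * ((1 - x) * P10 n x * P10 n x) + (2 * real n * ((1 - x) * P10 n x * P10 n x) + (2 * ((1 - x) * poly r x * P10 n x) - (P10 n x)\<^sup>2))) has_integral
      1 * (1 - 1) * (P10 n 1)\<^sup>2 - 0 * (1 - 0) * (P10 n 0)\<^sup>2) {0..1}"
  proof (rule fundamental_theorem_of_calculus)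
    show "((\<lambda>x. x * (1 - x) * (P10 n x)\<^sup>2) has_vector_derivative 2 * ((1 - x) * P10 n x * P10 n x) + (2 * real n * ((1 - x) * P10 n x * P10 n x) + (2 * ((1 - x) * poly r x * P10 n x) - (P10 n x)\<^sup>2))) (at x within {0..1})" for x
      unfolding has_real_derivative_iff_has_vector_derivative[symmetric]
      by (rule DERIV_subset[OF _ subset_UNIV])
        (auto intro!: derivative_eq_intros D simp: power2_eq_square algebra_simps r_def poly_P10_poly)
  qed simp
  then have "integral {0..1} (\<lambda>x. 2 * ((1 - x) * P10 n x * P10 n x) + (2 * real n * ((1 - x) * P10 n x * P10 n x) + (2 * ((1 - x) * poly r x * P10 n x) - (P10 n x)\<^sup>2))) = 0"
    by (simp add: integral_unique)
  moreover have "integral {0..1} (\<lambda>x. 2 * ((1 - x) * P10 n x * P10 n x) + (2 * real n * ((1 - x) * P10 n x * P10 n x) + (2 * ((1 - x) * poly r x * P10 n x) - (P10 n x)\<^sup>2))) =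
      2 * h + (2 * real n * h + (2 * P10_ip (poly r) (P10 n) - I))"
    unfolding I_def h_def P10_ip_def
    by (subst integral_add integral_diff, (auto intro!: integrable_continuous_real continuous_intros continuous_on_P10)[2])+ simp
  ultimately have "2 * h + 2 * real n * h = 1"
    using I 2 by simp
  then show ?thesis
    unfolding h_def[symmetric] by (simp add: field_simps)
qed

text \<open>Closed forms of the coefficients in the three-term recurrence for x
  \<open>P10 n\<close>. The diagonal one is the sum of the others because the values at 0 alternate
  in sign; \<open>rec_down 0 = 0\<close> accounts for the missing predecessor of
  \<open>P10 0\<close>.\<close>

definition rec_up :: "nat \<Rightarrow> real" where "rec_up n = (real n + 2) / (2 * (2 * real n + 3))"
definition rec_down :: "nat \<Rightarrow> real" where "rec_down n = real n / (2 * (2 * real n + 1))"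
definition rec_diag :: "nat \<Rightarrow> real" where "rec_diag n = rec_up n + rec_down n"

lemma P10_coeff_eq: "P10_coeff f m = 2 * (real m + 1) * P10_ip f (P10 m)"
proof -
  have "integral {0..1} (\<lambda>x. (1 - x) * (P10 m x)\<^sup>2) = 1 / (2 * (real m + 1))"
    using P10_ip_self[of m] by (simp add: P10_ip_def power2_eq_square mult.assoc)
  then show ?thesis
    by (simp add: P10_coeff_def P10_ip_def)
qed

lemma P10_coeff_sum:
  assumes "m < N"
  shows "P10_coeff (\<lambda>x. \<Sum>n<N. c n * P10 n x) m = c m"
proof -
  have "P10_ip (\<lambda>x. \<Sum>n<N. c n * P10 n x) (P10 m) = (\<Sum>n<N. c n * P10_ip (P10 n) (P10 m))"
    by (rule P10_ip_sum_left) (auto simp: continuous_on_P10)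
  also have "\<dots> = (\<Sum>n<N. if n = m then c m / (2 * (real m + 1)) else 0)"
    by (intro sum.cong) (auto simp: P10_orthogonal P10_ip_self)
  finally have "P10_ip (\<lambda>x. \<Sum>n<N. c n * P10 n x) (P10 m) = (\<Sum>n<N. if n = m then c m / (2 * (real m + 1)) else 0)" .
  then show ?thesis
    using assms by (simp add: P10_coeff_eq)
qed

text \<open>One case is a degree count; the other follows as multiplication by x is symmetric for
  the inner product.\<close>

lemma P10_coeff_mult_x_eq_0:
  assumes "m > Suc n \<or> n > Suc m"
  shows "P10_coeff (\<lambda>x. x * P10 n x) m = 0"
proof -
  have deg: "degree ([:0, 1:] * P10_poly n) \<le> Suc n" for n
    using degree_mult_le[of "[:0, 1:]" "P10_poly n"] degree_P10_poly_le[of n] by simp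
  have "P10_ip (\<lambda>x. x * P10 n x) (P10 m) = 0" if "m > Suc n" for n m
  proof -
    have "poly ([:0, 1:] * P10_poly n) = (\<lambda>x. x * P10 n x)"
      by (simp add: fun_eq_iff poly_P10_poly)
    then show ?thesis
      using P10_ip_lower_degree[OF le_less_trans[OF deg that]] by simp
  qed
  moreover have "P10_ip (\<lambda>x. x * P10 n x) (P10 m) = P10_ip (\<lambda>x. x * P10 m x) (P10 n)"
    by (simp add: P10_ip_def mult_ac)
  ultimately show ?thesis
    using assms by (auto simp: P10_coeff_eq)
qed

lemma mult_x_P10:
  "x * P10 n x = (\<Sum>m\<le>Suc n. P10_coeff (\<lambda>x. x * P10 n x) m * P10 m x)"
proof -
  have "degree ([:0, 1:] * P10_poly n) \<le> Suc n"
    using degree_mult_le[of "[:0, 1:]" "P10_poly n"] degree_P10_poly_le[of n] by simp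
  from P10_poly_span[OF this] obtain c where "[:0, 1:] * P10_poly n = (\<Sum>m\<le>Suc n. smult (c m) (P10_poly m))"
    by blast
  then have "poly ([:0, 1:] * P10_poly n) x = (\<Sum>m\<le>Suc n. c m * poly (P10_poly m) x)" for x
    by (simp only: poly_sum poly_smult)
  then have c: "x * P10 n x = (\<Sum>m<Suc (Suc n). c m * P10 m x)" for x
    by (simp only: poly_P10_poly lessThan_Suc_atMost) (simp add: poly_P10_poly)
  have "P10_coeff (\<lambda>x. x * P10 n x) m = c m" if "m < Suc (Suc n)" for m
    unfolding c using P10_coeff_sum[OF that] .
  then show ?thesis
    unfolding c by (intro sum.cong) (auto simp: less_Suc_eq_le)
qed

text \<open>The diagonal coefficient and, inductively, the upper one are determined by the values of the
  polynomials at 0 and 1.\<close>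

lemma P10_coeff_mult_x:
  "P10_coeff (\<lambda>x. x * P10 n x) (Suc n) = rec_up n"
  "P10_coeff (\<lambda>x. x * P10 n x) n = rec_diag n"
  "P10_coeff (\<lambda>x. x * P10 (Suc n) x) n = rec_down (Suc n)"
proof -
  define e where "e = (\<lambda>n. P10_coeff (\<lambda>x. x * P10 n x))"
  \<comment> \<open>Symmetry of multiplication by x; the ratio comes from the squared norms of the
    two neighbouring polynomials.\<close>
  have step: "e (Suc n) n = e n (Suc n) * (real n + 1) / (real n + 2)" for n
    by (simp add: e_def P10_coeff_eq P10_ip_def mult_ac field_simps)
  define g where "g = (\<lambda>n. if n = 0 then 0 else e n (n - 1))"
  have sum3: "x * P10 n x = e n (Suc n) * P10 (Suc n) x + e n n * P10 n x + g n * P10 (n - 1) x" for n x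
  proof (cases n)
    case 0
    then show ?thesis
      using mult_x_P10[of x n] by (simp add: g_def e_def)
  next
    case (Suc k)
    have "(\<Sum>m<k. e n m * P10 m x) = 0"
      using Suc by (intro sum.neutral) (auto simp: e_def P10_coeff_mult_x_eq_0)
    moreover have "x * P10 n x = (\<Sum>m<Suc (Suc (Suc k)). e n m * P10 m x)"
      using mult_x_P10[of x n] Suc by (simp add: e_def lessThan_Suc_atMost)
    ultimately show ?thesis
      using Suc by (simp add: g_def)
  qed
  have at0: "e n n = e n (Suc n) + g n" for n
  proof -
    have "(- 1) ^ n * e n n = (- 1) ^ n * (e n (Suc n) + g n)"
      using sum3[of 0 n] by (cases n) (auto simp: P10_at_0 g_def algebra_simps)
    then show ?thesis by simp
  qed
  have at1: "real n + 1 = e n (Suc n) * (real n + 2) + e n n * (real n + 1) + g n * real n" for n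
    using sum3[of 1 n] by (cases n) (auto simp: P10_at_1 g_def add.commute)
  have eq: "e n (Suc n) * (2 * real n + 3) + g n * (2 * real n + 1) = real n + 1" for n
    using at1[of n] unfolding at0[of n] by (simp add: algebra_simps)
  \<comment> \<open>The two claims advance together: \<open>step\<close> carries the upper
    coefficient at \<open>n\<close> to the lower one at \<open>Suc n\<close>, and \<open>eq\<close>
    then yields the upper one there.\<close>
  have up: "e n (Suc n) = rec_up n" and down: "g n = rec_down n" for n
  proof (induction n)
    case 0
    {
      case 1
      show ?case using eq[of 0] by (simp add: g_def rec_up_def)
    next
      case 2
      show ?case by (simp add: g_def rec_down_def)
    }
  next
    case (Suc n)
    have g: "g (Suc n) = rec_down (Suc n)"
    proof -
      have "g (Suc n) = rec_up n * (real n + 1) / (real n + 2)"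
        using step[of n] Suc by (simp add: g_def)
      also have "\<dots> = rec_down (Suc n)"
      proof -
        have "a / b * c / a = c / b" if "a \<noteq> 0" for a b c :: real
          using that by simp
        from this[of "real n + 2" "2 * (2 * real n + 3)" "real n + 1"]
        have "rec_up n * (real n + 1) / (real n + 2) = (real n + 1) / (2 * (2 * real n + 3))"
          unfolding rec_up_def by simp
        moreover have "rec_down (Suc n) = (real n + 1) / (2 * (2 * real n + 3))"
          by (simp add: rec_down_def algebra_simps)
        ultimately show ?thesis by simp
      qed
      finally show ?thesis .
    qed
    {
      case 1
      have "e (Suc n) (Suc (Suc n)) * (2 * real n + 5) = (real n + 3) / 2"
      proof -
        have "rec_down (Suc n) * (2 * real n + 3) = (real n + 1) / 2"
          by (simp add: rec_down_def field_simps)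
        then show ?thesis
          using eq[of "Suc n"] g by (simp add: field_simps)
      qed
      then show ?case
        by (simp add: rec_up_def field_simps)
    next
      case 2
      show ?case by (rule g)
    }
  qed
  show "P10_coeff (\<lambda>x. x * P10 n x) (Suc n) = rec_up n"
    using up[of n] by (simp add: e_def)
  show "P10_coeff (\<lambda>x. x * P10 n x) n = rec_diag n"
    using at0[of n] up[of n] down[of n] by (simp add: e_def rec_diag_def)
  show "P10_coeff (\<lambda>x. x * P10 (Suc n) x) n = rec_down (Suc n)"
    using down[of "Suc n"] by (simp add: e_def g_def)
qed

section \<open>The operators in coefficient space\<close>

text \<open>Only the columns m - 1, m and m + 1 meet row \<open>m\<close>. The weight
  \<open>rec_up\<close> stands inside the shift because it belongs to the source index m - 1; in
  this form row 0 needs no predecessor.\<close>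

lemma J_op_eq:
  "J_op u m = of_real (rec_down (Suc m)) * lshift u m + of_real (rec_diag m) * u m +
     rshift (\<lambda>i. of_real (rec_up i) * u i) m"
proof -
  let ?f = "\<lambda>n. of_real (P10_coeff (\<lambda>x. x * P10 n x) m) * u n"
  have "J_op u m = (\<Sum>n<Suc (Suc m). ?f n)"
    unfolding J_op_def by (rule suminf_finite) (auto simp: P10_coeff_mult_x_eq_0)
  also have "\<dots> = (\<Sum>n<m. ?f n) + of_real (rec_diag m) * u m + of_real (rec_down (Suc m)) * u (Suc m)"
    by (simp add: P10_coeff_mult_x)
  also have "(\<Sum>n<m. ?f n) = rshift (\<lambda>i. of_real (rec_up i) * u i) m"
  proof (cases m)
    case (Suc k)
    have "(\<Sum>n<k. ?f n) = 0"
      using Suc by (intro sum.neutral) (auto simp: P10_coeff_mult_x_eq_0)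
    then show ?thesis
      using Suc by (simp add: rshift_def P10_coeff_mult_x)
  qed (simp add: rshift_def)
  finally show ?thesis
    by (simp add: lshift_def)
qed

definition J_conj :: "(nat \<Rightarrow> complex) \<Rightarrow> nat \<Rightarrow> complex" where
  "J_conj u = D_inv (J_op (D_op u))"

lemma D_op_D_inv [simp]: "D_op (D_inv u) = u" "D_inv (D_op u) = u"
proof -
  have "(- 1) ^ i * (- 1) ^ i = (1 :: complex)" for i
    by (simp flip: power_mult_distrib)
  then have *: "(- 1) ^ i * ((- 1) ^ i * x) = x" for i and x :: complex
    by (simp flip: mult.assoc)
  have nz: "(of_nat (Suc i) :: complex) \<noteq> 0" for i
    using of_nat_eq_0_iff by blast
  show "D_op (D_inv u) = u" "D_inv (D_op u) = u"
    using nz * by (auto simp: D_op_def D_inv_def fun_eq_iff simp del: of_nat_Suc)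
qed

text \<open>The signs of \<open>D_op\<close> and \<open>D_inv\<close> cancel on the diagonal and
  leave -1 on both neighbouring diagonals, together with a ratio of consecutive integers that tends
  to 1. Hence the limits 1/4, 1/2, 1/4 of \<open>J_op\<close> become -1/4, 1/2, -1/4, the entries of
  1 minus \<open>sshift\<close>.\<close>

lemma J_conj_eq:
  "J_conj u m = - of_real (rec_down (Suc m) * (real m + 1) / (real m + 2)) * lshift u m + of_real (rec_diag m) * u m -
     rshift (\<lambda>i. of_real (rec_up i * (real i + 2) / (real i + 1)) * u i) m"
proof -
  define s :: complex where "s = (- 1) ^ m"
  have s: "s * s = 1" "s * (s * x) = x" for x
    by (simp_all add: s_def flip: power_mult_distrib mult.assoc)
  have nz: "1 + complex_of_nat i \<noteq> 0" "2 + complex_of_nat i \<noteq> 0" for i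
    using of_nat_neq_0[of i, where 'a = complex] of_nat_neq_0[of "Suc i", where 'a = complex] by auto
  have l: "lshift (D_op u) m = - s / (of_nat m + 2) * lshift u m"
    by (simp add: lshift_def D_op_def s_def add.commute)
  have d: "D_op u m = s / (of_nat m + 1) * u m"
    by (simp add: D_op_def s_def add.commute)
  have r: "rshift (\<lambda>i. of_real (rec_up i) * D_op u i) m =
      - s / (of_nat m + 1) * rshift (\<lambda>i. of_real (rec_up i * (real i + 2) / (real i + 1)) * u i) m"
  proof (cases m)
    case (Suc k)
    have "w * (t / b * x) = t / a * ((w * a / b) * x)" if "a \<noteq> 0" for a b t w x :: complex
      using that by simp
    from this[OF nz(2)[of k], of "of_real (rec_up k)" "(- 1) ^ k" "of_nat k + 1" "u k"] show ?thesis
      using Suc by (simp add: rshift_def D_op_def s_def algebra_simps)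
  qed (simp add: rshift_def)
  have alg: "s * a * (D * (- s / b * L) + G * (s / a * x) + - s / a * R) = - (D * a / b) * L + G * x - R"
    if "a \<noteq> 0" for a b D L G x R :: complex
  proof -
    have "s * a * (D * (- s / b * L) + G * (s / a * x) + - s / a * R) = (s * s) * (- (D * a / b) * L + G * x - R)"
      using that by (simp add: algebra_simps)
    then show ?thesis by (simp add: s)
  qed
  have "J_conj u m = s * (of_nat m + 1) * (of_real (rec_down (Suc m)) * (- s / (of_nat m + 2) * lshift u m) +
      of_real (rec_diag m) * (s / (of_nat m + 1) * u m) +
      - s / (of_nat m + 1) * rshift (\<lambda>i. of_real (rec_up i * (real i + 2) / (real i + 1)) * u i) m)"
    unfolding J_conj_def D_inv_def J_op_eq l d r s_def[symmetric] by (simp add: add.commute)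
  also have "\<dots> = - (of_real (rec_down (Suc m)) * (of_nat m + 1) / (of_nat m + 2)) * lshift u m + of_real (rec_diag m) * u m -
      rshift (\<lambda>i. of_real (rec_up i * (real i + 2) / (real i + 1)) * u i) m"
    by (rule alg) (use nz(1)[of m] in \<open>simp add: add.commute\<close>)
  finally show ?thesis by simp
qed

text \<open>Replacing the coefficients by their limits leaves an error made of diagonal operators
  with null entries, composed with shifts.\<close>

lemma eq_cc_tridiagonal:
  assumes "a \<longlonglongrightarrow> a'" "b \<longlonglongrightarrow> b'" "c \<longlonglongrightarrow> c'"
  shows "(\<lambda>u m. a m * lshift u m + b m * u m + rshift (\<lambda>i. c i * u i) m) \<simeq>
    (\<lambda>u m. a' * lshift u m + b' * u m + c' * rshift u m)"
proof (rule eq_cc_I)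
  have "cc_op (\<lambda>u i. (a i - a') * u i)" "cc_op (\<lambda>u i. (b i - b') * u i)" "cc_op (\<lambda>u i. (c i - c') * u i)"
    using assms by (auto intro!: cc_op_diag simp: LIM_zero)
  note cc = cc_op_add[OF cc_op_add[OF cc_op_comp_right[OF this(1) bounded_op_lshift] this(2)]
      cc_op_comp_left[OF bounded_op_rshift this(3)]]
  show "cc_op (\<lambda>u i. (a i - a') * lshift u i + (b i - b') * u i + rshift (\<lambda>i. (c i - c') * u i) i)"
    by (rule cc)
  show "bounded_op (\<lambda>u m. a' * lshift u m + b' * u m + c' * rshift u m)"
    by (rule bounded_op_add[OF bounded_op_add[OF bounded_op_scale[OF bounded_op_lshift]
          bounded_op_scale[OF bounded_op_id]] bounded_op_scale[OF bounded_op_rshift]])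
qed (auto simp: rshift_def algebra_simps)

lemma J_op_eq_cc: "J_op \<simeq> poly_op [:0, 1:]"
proof -
  have lim: "(\<lambda>n. complex_of_real (rec_down (Suc n))) \<longlonglongrightarrow> of_real (1 / 4)"
    "(\<lambda>n. complex_of_real (rec_diag n)) \<longlonglongrightarrow> of_real (1 / 2)"
    "(\<lambda>n. complex_of_real (rec_up n)) \<longlonglongrightarrow> of_real (1 / 4)"
    unfolding rec_up_def rec_down_def rec_diag_def by (rule tendsto_of_real, real_asymp)+
  have "J_op = (\<lambda>u m. of_real (rec_down (Suc m)) * lshift u m + of_real (rec_diag m) * u m +
     rshift (\<lambda>i. of_real (rec_up i) * u i) m)"
    by (intro ext J_op_eq)
  also have "\<dots> \<simeq> (\<lambda>u m. of_real (1 / 4) * lshift u m + of_real (1 / 2) * u m + of_real (1 / 4) * rshift u m)"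
    by (rule eq_cc_tridiagonal[OF lim])
  also have "\<dots> = poly_op [:0, 1:]"
    by (simp add: fun_eq_iff sshift_def lshift_def rshift_def field_simps)
  finally show ?thesis .
qed

lemma J_conj_eq_cc: "J_conj \<simeq> poly_op [:1, - 1:]"
proof -
  have lim: "(\<lambda>n. complex_of_real (- (rec_down (Suc n) * (real n + 1) / (real n + 2)))) \<longlonglongrightarrow> of_real (- (1 / 4))"
    "(\<lambda>n. complex_of_real (rec_diag n)) \<longlonglongrightarrow> of_real (1 / 2)"
    "(\<lambda>n. complex_of_real (- (rec_up n * (real n + 2) / (real n + 1)))) \<longlonglongrightarrow> of_real (- (1 / 4))"
    unfolding rec_up_def rec_down_def rec_diag_def by (rule tendsto_of_real, real_asymp)+
  have "J_conj = (\<lambda>u m. of_real (- (rec_down (Suc m) * (real m + 1) / (real m + 2))) * lshift u m + of_real (rec_diag m) * u m +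
     rshift (\<lambda>i. of_real (- (rec_up i * (real i + 2) / (real i + 1))) * u i) m)"
    by (auto simp: fun_eq_iff J_conj_eq rshift_def)
  also have "\<dots> \<simeq> (\<lambda>u m. of_real (- (1 / 4)) * lshift u m + of_real (1 / 2) * u m + of_real (- (1 / 4)) * rshift u m)"
    by (rule eq_cc_tridiagonal[OF lim])
  also have "\<dots> = poly_op [:1, - 1:]"
    by (simp add: fun_eq_iff sshift_def lshift_def rshift_def field_simps)
  finally show ?thesis .
qed

text \<open>The expression to which \<open>Vtilde\<close> applies \<open>D_op\<close>, with the
  \<open>D_inv\<close> and \<open>D_op\<close> around the outer power of \<open>J_op\<close>
  absorbed into a power of \<open>J_conj\<close>.\<close>

definition volterra_op :: "nat \<Rightarrow> (nat \<Rightarrow> nat \<Rightarrow> complex) \<Rightarrow> (nat \<Rightarrow> complex) \<Rightarrow> nat \<Rightarrow> complex" where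
  "volterra_op M k u = (\<lambda>m. \<Sum>n\<le>M. \<Sum>j\<le>n. k n j * (J_conj ^^ (n - j)) ((J_op ^^ j) u) m)"

definition symbol_poly :: "nat \<Rightarrow> (nat \<Rightarrow> nat \<Rightarrow> complex) \<Rightarrow> complex poly" where
  "symbol_poly M k = (\<Sum>n\<le>M. \<Sum>j\<le>n. smult (k n j) ([:1, - 1:] ^ (n - j) * [:0, 1:] ^ j))"

lemma poly_symbol_poly: "poly (symbol_poly M k) (of_real x) = volterra_kernel M k (1 - x) x"
  by (simp add: symbol_poly_def volterra_kernel_def poly_sum mult.assoc)

lemma D_inv_sum: "D_inv (\<lambda>m. \<Sum>n\<in>I. f n m) = (\<lambda>m. \<Sum>n\<in>I. D_inv (f n) m)"
  by (simp add: D_inv_def sum_distrib_left)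

lemma D_inv_scale: "D_inv (\<lambda>m. c * f m) = (\<lambda>m. c * D_inv f m)"
  by (simp add: D_inv_def mult_ac)

lemma funpow_J_conj: "(J_conj ^^ n) u = D_inv ((J_op ^^ n) (D_op u))"
  by (induction n) (auto simp: J_conj_def)

lemma Vtilde_eq: "Vtilde M k u = D_op (volterra_op M k u)"
proof -
  have "D_inv (\<lambda>m. \<Sum>n\<le>M. \<Sum>j\<le>n. k n j * (J_op ^^ (n - j)) (D_op ((J_op ^^ j) u)) m) = volterra_op M k u"
    by (simp add: D_inv_sum D_inv_scale volterra_op_def funpow_J_conj)
  then show ?thesis
    by (simp add: Vtilde_def)
qed

lemma eq_cc_sum:
  assumes "\<And>n. n \<in> I \<Longrightarrow> A n \<simeq> B n"
  shows "(\<lambda>u i. \<Sum>n\<in>I. A n u i) \<simeq> (\<lambda>u i. \<Sum>n\<in>I. B n u i)"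
  using assms
proof (induction I rule: infinite_finite_induct)
  case (insert n I)
  then show ?case
    using eq_cc_add[of "A n" "B n" "\<lambda>u i. \<Sum>n\<in>I. A n u i" "\<lambda>u i. \<Sum>n\<in>I. B n u i"] by simp
qed (simp_all add: eq_cc_refl bounded_op_zero)

lemma volterra_op_eq_cc: "volterra_op M k \<simeq> poly_op (symbol_poly M k)"
proof -
  have "(\<lambda>u i. \<Sum>n\<le>M. \<Sum>j\<le>n. k n j * (J_conj ^^ (n - j)) ((J_op ^^ j) u) i) \<simeq>
    (\<lambda>u i. \<Sum>n\<le>M. \<Sum>j\<le>n. k n j * (poly_op [:1, - 1:] ^^ (n - j)) ((poly_op [:0, 1:] ^^ j) u) i)"
    by (intro eq_cc_sum eq_cc_scale eq_cc_comp[OF eq_cc_funpow[OF J_conj_eq_cc] eq_cc_funpow[OF J_op_eq_cc]])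
  moreover have "(\<Sum>n\<le>M. \<Sum>j\<le>n. k n j * (poly_op [:1, - 1:] ^^ (n - j)) ((poly_op [:0, 1:] ^^ j) u) i) =
      poly_op (symbol_poly M k) u i" for u i
    by (simp only: symbol_poly_def poly_op_sum poly_op_smult poly_op_mult poly_op_power)
  ultimately show ?thesis
    by (simp only: volterra_op_def[abs_def])
qed

lemma bounded_op_volterra_op: "bounded_op (volterra_op M k)"
  using volterra_op_eq_cc by (simp add: eq_cc_def)

section \<open>The Toeplitz symbol\<close>

lemma continuous_on_circle:
  assumes "continuous_on (sphere 0 1) f"
  shows "continuous_on S (\<lambda>\<theta>. f (cis \<theta>))"
  by (rule continuous_on_compose2[OF assms]) (auto intro!: continuous_intros)

lemma integrable_circle:
  assumes "continuous_on (sphere 0 1) f"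
  shows "(\<lambda>\<theta>. f (cis \<theta>) * cis (- of_int l * \<theta>)) integrable_on {0..2 * pi}"
  by (intro integrable_continuous_real continuous_intros continuous_on_circle assms)

lemma fourier_coeff_add:
  assumes "continuous_on (sphere 0 1) f" "continuous_on (sphere 0 1) g"
  shows "fourier_coeff (\<lambda>z. f z + g z) l = fourier_coeff f l + fourier_coeff g l"
  unfolding fourier_coeff_def distrib_right
  by (simp only: integral_add[OF integrable_circle[OF assms(1)] integrable_circle[OF assms(2)]] add_divide_distrib)

lemma fourier_coeff_scale: "fourier_coeff (\<lambda>z. c * f z) l = c * fourier_coeff f l"
  unfolding fourier_coeff_def by (simp add: mult.assoc)

lemma fourier_coeff_mult_z: "fourier_coeff (\<lambda>z. z * f z) l = fourier_coeff f (l - 1)"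
  unfolding fourier_coeff_def
  by (intro arg_cong2[of _ _ _ _ "(/)"] integral_cong refl) (auto simp: cis_mult algebra_simps)

lemma fourier_coeff_mult_cnj: "fourier_coeff (\<lambda>z. cnj z * f z) l = fourier_coeff f (l + 1)"
  unfolding fourier_coeff_def
  by (intro arg_cong2[of _ _ _ _ "(/)"] integral_cong refl) (auto simp: cis_mult cis_cnj algebra_simps)

lemma fourier_coeff_const: "fourier_coeff (\<lambda>z. a) l = (if l = 0 then a else 0)"
proof (cases "l = 0")
  case False
  define F where "F = (\<lambda>\<theta>. (\<i> / of_int l) * cis (- of_int l * \<theta>))"
  have "((\<lambda>\<theta>. cis (- of_int l * \<theta>)) has_integral F (2 * pi) - F 0) {0..2 * pi}"
  proof (rule fundamental_theorem_of_calculus)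
    fix x :: real
    have "((\<lambda>z. (\<i> / of_int l) * exp (- (\<i> * of_int l * z))) has_field_derivative exp (- (\<i> * of_int l * of_real x))) (at (of_real x))"
      using False by (auto intro!: derivative_eq_intros)
    from has_vector_derivative_real_field[OF this, of "{0..2 * pi}"]
    show "(F has_vector_derivative cis (- of_int l * x)) (at x within {0..2 * pi})"
      by (simp add: F_def cis_conv_exp mult.assoc)
  qed simp
  moreover have "F (2 * pi) = F 0"
    using cis_multiple_2pi[of "of_int (- l)"] by (simp add: F_def mult_ac)
  ultimately have "integral {0..2 * pi} (\<lambda>\<theta>. cis (- of_int l * \<theta>)) = 0"
    by (simp add: integral_unique)
  then show ?thesis
    using False by (simp add: fourier_coeff_def)
qed (simp add: fourier_coeff_def scaleR_conv_of_real)

text \<open>Written with \<open>Re z\<close> rather than (z + 1 / z) / 2, which agrees on the circle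
  and is continuous in the whole plane.\<close>

definition poly_symbol :: "complex poly \<Rightarrow> complex \<Rightarrow> complex" where
  "poly_symbol p z = poly p (of_real ((1 + Re z) / 2))"

lemma continuous_on_poly_symbol: "continuous_on S (poly_symbol p)"
  unfolding poly_symbol_def[abs_def] by (intro continuous_intros) auto

text \<open>Horner's step for Fourier coefficients: since (1 + Re z) / 2 is a quarter of z + 2 +
  \<open>cnj z\<close>, multiplying by it mixes neighbouring coefficients with the weights that
  occur in \<open>sshift\<close>.\<close>

lemma fourier_coeff_poly_symbol_pCons:
  "fourier_coeff (poly_symbol (pCons a p)) l = (if l = 0 then a else 0) +
     (fourier_coeff (poly_symbol p) (l - 1) + 2 * fourier_coeff (poly_symbol p) l + fourier_coeff (poly_symbol p) (l + 1)) / 4"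
proof -
  let ?g = "poly_symbol p"
  note cont = continuous_on_poly_symbol[of "sphere 0 1" p]
  have "complex_of_real ((1 + Re z) / 2) = (z + 2 + cnj z) / 4" for z
    by (auto simp: complex_eq_iff)
  then have eq: "poly_symbol (pCons a p) = (\<lambda>z. a + 1 / 4 * (z * ?g z + (2 * ?g z + cnj z * ?g z)))"
    by (auto simp: poly_symbol_def fun_eq_iff algebra_simps add_divide_distrib)
  have "fourier_coeff (poly_symbol (pCons a p)) l =
      fourier_coeff (\<lambda>z. a) l + fourier_coeff (\<lambda>z. 1 / 4 * (z * ?g z + (2 * ?g z + cnj z * ?g z))) l"
    unfolding eq by (rule fourier_coeff_add) (intro continuous_intros cont)+
  also have "fourier_coeff (\<lambda>z. 1 / 4 * (z * ?g z + (2 * ?g z + cnj z * ?g z))) l =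
      1 / 4 * fourier_coeff (\<lambda>z. z * ?g z + (2 * ?g z + cnj z * ?g z)) l"
    by (rule fourier_coeff_scale)
  also have "fourier_coeff (\<lambda>z. z * ?g z + (2 * ?g z + cnj z * ?g z)) l =
      fourier_coeff (\<lambda>z. z * ?g z) l + fourier_coeff (\<lambda>z. 2 * ?g z + cnj z * ?g z) l"
    by (rule fourier_coeff_add) (intro continuous_intros cont)+
  also have "fourier_coeff (\<lambda>z. 2 * ?g z + cnj z * ?g z) l =
      fourier_coeff (\<lambda>z. 2 * ?g z) l + fourier_coeff (\<lambda>z. cnj z * ?g z) l"
    by (rule fourier_coeff_add) (intro continuous_intros cont)+
  finally show ?thesis
    by (simp add: fourier_coeff_scale fourier_coeff_const fourier_coeff_mult_z fourier_coeff_mult_cnj)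
qed

text \<open>Bandedness turns the series in \<open>toeplitz\<close> into finite row sums, valid for
  arbitrary sequences as \<open>bounded_op\<close> demands.\<close>

lemma fourier_coeff_poly_symbol_band:
  "\<exists>N. \<forall>l. \<bar>l\<bar> > int N \<longrightarrow> fourier_coeff (poly_symbol p) l = 0"
proof (induction p)
  case 0
  then show ?case by (simp add: fourier_coeff_def poly_symbol_def)
next
  case (pCons a p)
  then obtain N where "\<And>l. \<bar>l\<bar> > int N \<Longrightarrow> fourier_coeff (poly_symbol p) l = 0" by blast
  then show ?case
    by (intro exI[of _ "Suc N"]) (auto simp: fourier_coeff_poly_symbol_pCons)
qed

lemma toeplitz_band:
  assumes "\<And>l. \<bar>l\<bar> > int N \<Longrightarrow> fourier_coeff f l = 0" "K > i + N"
  shows "toeplitz f u i = (\<Sum>j<K. fourier_coeff f (int i - int j) * u j)"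
  unfolding toeplitz_def by (rule suminf_finite) (use assms in auto)

lemma lshift_funpow: "(lshift ^^ j) u i = u (i + j)"
  by (induction j arbitrary: i) (auto simp: lshift_def)

text \<open>The first row of \<open>sshift\<close> lacks one entry of the Laurent operator; this makes
  the only difference between the two operators.\<close>

lemma toeplitz_poly_symbol: "toeplitz (poly_symbol p) \<simeq> poly_op p"
proof (induction p)
  case 0
  have "toeplitz (poly_symbol 0) = (\<lambda>u i. 0)"
    by (auto simp: toeplitz_def fun_eq_iff fourier_coeff_def poly_symbol_def)
  then show ?case
    by (simp add: eq_cc_refl bounded_op_zero)
next
  case (pCons a p)
  let ?c = "fourier_coeff (poly_symbol p)" and ?T = "toeplitz (poly_symbol p)"
  obtain N where N: "\<And>l. \<bar>l\<bar> > int N \<Longrightarrow> ?c l = 0"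
    using fourier_coeff_poly_symbol_band by blast
  obtain N' where N': "\<And>l. \<bar>l\<bar> > int N' \<Longrightarrow> fourier_coeff (poly_symbol (pCons a p)) l = 0"
    using fourier_coeff_poly_symbol_band by blast
  \<comment> \<open>\<open>R u 0\<close> is a quarter of row -1 of the Laurent matrix applied to
    \<open>u\<close>, the entry that \<open>rshift\<close> replaces by 0. Powers of
    \<open>lshift\<close> express it so that boundedness is inherited.\<close>
  define R where "R = (\<lambda>u i. \<Sum>j<Suc N. (?c (- int j - 1) / 4) * (lshift ^^ j) u i)"
  have bdT: "bounded_op ?T"
    using pCons.IH by (simp add: eq_cc_def)
  have bdR: "bounded_op R"
    unfolding R_def by (intro bounded_op_sum bounded_op_scale bounded_op_funpow bounded_op_lshift)
  have ccR: "cc_op (\<lambda>u i. if i = 0 then R u 0 else 0)"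
    by (rule cc_op_comp_right[OF cc_op_first_coord bdR])
  have bd: "bounded_op (\<lambda>u i. a * u i + sshift (?T u) i)"
    by (rule bounded_op_add[OF bounded_op_scale[OF bounded_op_id] bounded_op_comp[OF bounded_op_sshift bdT]])
  have "toeplitz (poly_symbol (pCons a p)) \<simeq> (\<lambda>u i. a * u i + sshift (?T u) i)"
  proof (rule eq_cc_I[OF bd ccR])
    fix u i
    \<comment> \<open>One cutoff that is large enough for the rows i - 1, i and i + 1 and for both
      bandwidths.\<close>
    define K where "K = Suc (Suc (i + N + N'))"
    have "i < K" by (simp add: K_def)
    have row: "(\<Sum>j<K. ?c (int i - int j - 1) * u j) = rshift (?T u) i + (if i = 0 then 4 * R u 0 else 0)"
    proof (cases i)
      case 0
      have "(\<Sum>j<K. ?c (- int j - 1) * u j) = (\<Sum>j<Suc N. ?c (- int j - 1) * u j)"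
        by (rule sum.mono_neutral_right) (auto simp: K_def intro!: N)
      then show ?thesis
        using 0 by (simp add: rshift_def R_def lshift_funpow sum_distrib_left algebra_simps)
    next
      case (Suc i')
      have "?T u i' = (\<Sum>j<K. ?c (int i' - int j) * u j)"
        by (rule toeplitz_band[of N]) (use N Suc in \<open>auto simp: K_def\<close>)
      then show ?thesis
        using Suc by (simp add: rshift_def)
    qed
    have mid: "(\<Sum>j<K. ?c (int i - int j) * u j) = ?T u i"
      by (rule toeplitz_band[of N, symmetric]) (use N in \<open>auto simp: K_def\<close>)
    have up: "(\<Sum>j<K. ?c (int i - int j + 1) * u j) = lshift (?T u) i"
    proof -
      have "?T u (Suc i) = (\<Sum>j<K. ?c (int (Suc i) - int j) * u j)"
        by (rule toeplitz_band[of N]) (use N in \<open>auto simp: K_def\<close>)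
      then show ?thesis
        by (simp add: lshift_def algebra_simps)
    qed
    have "toeplitz (poly_symbol (pCons a p)) u i =
        (\<Sum>j<K. fourier_coeff (poly_symbol (pCons a p)) (int i - int j) * u j)"
      by (rule toeplitz_band[of N']) (use N' in \<open>auto simp: K_def\<close>)
    also have "\<dots> = (\<Sum>j<K. (if j = i then a * u i else 0) +
        (?c (int i - int j - 1) * u j + 2 * (?c (int i - int j) * u j) + ?c (int i - int j + 1) * u j) / 4)"
      by (intro sum.cong) (auto simp: fourier_coeff_poly_symbol_pCons algebra_simps add_divide_distrib)
    also have "\<dots> = a * u i + (rshift (?T u) i + (if i = 0 then 4 * R u 0 else 0) + 2 * ?T u i + lshift (?T u) i) / 4"
      using \<open>i < K\<close>
      by (simp add: sum.distrib sum_divide_distrib[symmetric] sum_distrib_left[symmetric] row mid up)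
    also have "\<dots> = a * u i + sshift (?T u) i + (if i = 0 then R u 0 else 0)"
      by (simp add: sshift_def field_simps)
    finally show "toeplitz (poly_symbol (pCons a p)) u i =
        a * u i + sshift (?T u) i + (if i = 0 then R u 0 else 0)" .
  qed
  also have "\<dots> \<simeq> (\<lambda>u i. a * u i + sshift (poly_op p u) i)"
    by (rule eq_cc_add[OF eq_cc_refl[OF bounded_op_scale[OF bounded_op_id]]
          eq_cc_comp[OF eq_cc_refl[OF bounded_op_sshift] pCons.IH]])
  finally show ?case by simp
qed

lemma is_toeplitz_symbol_Vtilde: "is_toeplitz_symbol (Vtilde M k) (poly_symbol (symbol_poly M k))"
proof -
  let ?T = "toeplitz (poly_symbol (symbol_poly M k))"
  have "volterra_op M k \<simeq> ?T"
    by (rule eq_cc_trans[OF volterra_op_eq_cc eq_cc_sym[OF toeplitz_poly_symbol]])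
  then have "cc_op (\<lambda>u i. volterra_op M k u i - ?T u i)"
    by (simp add: eq_cc_def)
  from cc_op_imp_compact_op[OF this] show ?thesis
    unfolding is_toeplitz_symbol_def
    by (intro conjI continuous_on_poly_symbol exI[of _ "\<lambda>u i. volterra_op M k u i - ?T u i"]) (auto simp: Vtilde_eq)
qed

section \<open>Uniqueness of the symbol\<close>

definition unit_seq :: "nat \<Rightarrow> nat \<Rightarrow> complex" where
  "unit_seq n i = (if i = n then 1 else 0)"

lemma ell_0_unit_seq: "unit_seq n \<in> ell 0" "ell_norm 0 (unit_seq n) = 1"
proof -
  show "unit_seq n \<in> ell 0"
    by (rule ell_0_finite_support[of "Suc n"]) (simp add: unit_seq_def)
  have "(\<Sum>i. (cmod (unit_seq n i))\<^sup>2) = (\<Sum>i\<in>{n}. (cmod (unit_seq n i))\<^sup>2)"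
    by (rule suminf_finite) (auto simp: unit_seq_def)
  then show "ell_norm 0 (unit_seq n) = 1"
    by (simp add: ell_norm_0 unit_seq_def)
qed

lemma toeplitz_unit_seq: "toeplitz f (unit_seq n) i = fourier_coeff f (int i - int n)"
proof -
  have "toeplitz f (unit_seq n) i = (\<Sum>j\<in>{n}. fourier_coeff f (int i - int j) * unit_seq n j)"
    unfolding toeplitz_def by (rule suminf_finite) (auto simp: unit_seq_def)
  then show ?thesis
    by (simp add: unit_seq_def)
qed

text \<open>Along a subsequence the images of the unit sequences converge in norm to some
  \<open>L\<close> in \<open>ell 0\<close>, whose entries tend to 0, so the matrix entries on
  diagonal \<open>l\<close> tend to 0 too. Starting from a subsequence \<open>s\<close> allows two
  operators to be treated in turn; \<open>nat\<close> cuts off only finitely many indices.\<close>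

lemma compact_op_diagonal_tendsto_0:
  assumes C: "compact_op C" and s: "strict_mono (s :: nat \<Rightarrow> nat)"
  shows "\<exists>r. strict_mono (r :: nat \<Rightarrow> nat) \<and>
           (\<lambda>n. C (unit_seq (s (r n))) (nat (int (s (r n)) + l))) \<longlonglongrightarrow> 0"
proof -
  have "\<forall>n. unit_seq (s n) \<in> ell 0 \<and> ell_norm 0 (unit_seq (s n)) \<le> 1"
    by (simp add: ell_0_unit_seq)
  then obtain r L where r: "strict_mono (r :: nat \<Rightarrow> nat)" and L: "ell2_tendsto (\<lambda>n. C (unit_seq (s (r n)))) L"
    using C unfolding compact_op_def by meson
  define i where "i = (\<lambda>n. nat (int (s (r n)) + l))"
  have mono: "n \<le> s (r n)" for n
    using strict_mono_imp_increasing[OF r, of n] strict_mono_imp_increasing[OF s, of "r n"] by linarith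
  have i: "filterlim i at_top sequentially"
    unfolding filterlim_at_top
  proof
    fix Z :: nat
    show "\<forall>\<^sub>F n in sequentially. Z \<le> i n"
      using eventually_ge_at_top[of "nat (int Z + \<bar>l\<bar>)"]
    proof eventually_elim
      case (elim n)
      then show ?case using mono[of n] by (simp add: i_def)
    qed
  qed
  have LE: "L \<in> ell 0" and dist: "(\<lambda>n. ell_norm 0 (\<lambda>i. C (unit_seq (s (r n))) i - L i)) \<longlonglongrightarrow> 0"
    using L by (auto simp: ell2_tendsto_def)
  have Cell: "C (unit_seq m) \<in> ell 0" for m
    using C ell_0_unit_seq by (auto simp: compact_op_def)
  have "(\<lambda>n. (cmod (L n))\<^sup>2) \<longlonglongrightarrow> 0"
    by (rule summable_LIMSEQ_zero[OF LE[unfolded ell_0_iff]])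
  then have "(\<lambda>n. sqrt ((cmod (L n))\<^sup>2)) \<longlonglongrightarrow> sqrt 0"
    by (rule tendsto_real_sqrt)
  then have "(\<lambda>n. cmod (L n)) \<longlonglongrightarrow> 0" by simp
  from filterlim_compose[OF this i] have "(\<lambda>n. cmod (L (i n))) \<longlonglongrightarrow> 0" .
  from tendsto_add[OF dist this]
  have lim: "(\<lambda>n. ell_norm 0 (\<lambda>i. C (unit_seq (s (r n))) i - L i) + cmod (L (i n))) \<longlonglongrightarrow> 0" by simp
  have "(\<lambda>n. C (unit_seq (s (r n))) (i n)) \<longlonglongrightarrow> 0"
  proof (rule Lim_null_comparison[OF always_eventually lim], rule allI)
    fix n
    have "cmod (C (unit_seq (s (r n))) (i n) - L (i n)) \<le> ell_norm 0 (\<lambda>i. C (unit_seq (s (r n))) i - L i)"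
      by (rule cmod_le_ell_norm[OF ell_0_diff(1)[OF Cell LE]])
    then show "norm (C (unit_seq (s (r n))) (i n)) \<le> ell_norm 0 (\<lambda>i. C (unit_seq (s (r n))) i - L i) + cmod (L (i n))"
      using norm_triangle_sub[of "C (unit_seq (s (r n))) (i n)" "L (i n)"] by linarith
  qed
  then show ?thesis
    using r by (auto simp: i_def)
qed

text \<open>A Toeplitz matrix is constant along each diagonal. There the difference of the two
  compact parts is the constant difference of the Fourier coefficients, and along a common
  subsequence it tends to 0.\<close>

lemma toeplitz_symbol_fourier_unique:
  assumes "is_toeplitz_symbol A f" "is_toeplitz_symbol A g"
  shows "fourier_coeff f l = fourier_coeff g l"
proof -
  from assms(1) obtain C where C: "compact_op C" "\<And>u. u \<in> ell 0 \<Longrightarrow> A u = D_op (\<lambda>i. toeplitz f u i + C u i)"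
    unfolding is_toeplitz_symbol_def by blast
  from assms(2) obtain D where D: "compact_op D" "\<And>u. u \<in> ell 0 \<Longrightarrow> A u = D_op (\<lambda>i. toeplitz g u i + D u i)"
    unfolding is_toeplitz_symbol_def by blast
  have eq: "fourier_coeff f (int i - int n) + C (unit_seq n) i = fourier_coeff g (int i - int n) + D (unit_seq n) i" for i n
  proof -
    have "D_inv (D_op (\<lambda>i. toeplitz f (unit_seq n) i + C (unit_seq n) i)) =
        D_inv (D_op (\<lambda>i. toeplitz g (unit_seq n) i + D (unit_seq n) i))"
      using C(2) D(2) ell_0_unit_seq by metis
    then show ?thesis
      by (simp add: fun_eq_iff toeplitz_unit_seq)
  qed
  obtain r where r: "strict_mono (r :: nat \<Rightarrow> nat)" "(\<lambda>n. C (unit_seq (r n)) (nat (int (r n) + l))) \<longlonglongrightarrow> 0"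
    using compact_op_diagonal_tendsto_0[OF C(1) strict_mono_id] by auto
  obtain r' where r': "strict_mono (r' :: nat \<Rightarrow> nat)"
    "(\<lambda>n. D (unit_seq (r (r' n))) (nat (int (r (r' n)) + l))) \<longlonglongrightarrow> 0"
    using compact_op_diagonal_tendsto_0[OF D(1) r(1)] by auto
  have "(\<lambda>n. C (unit_seq (r (r' n))) (nat (int (r (r' n)) + l))) \<longlonglongrightarrow> 0"
    using LIMSEQ_subseq_LIMSEQ[OF r(2) r'(1)] by (simp add: o_def)
  from tendsto_diff[OF r'(2) this]
  have lim: "(\<lambda>n. D (unit_seq (r (r' n))) (nat (int (r (r' n)) + l)) - C (unit_seq (r (r' n))) (nat (int (r (r' n)) + l))) \<longlonglongrightarrow> 0"
    by simp
  have "\<forall>\<^sub>F n in sequentially. D (unit_seq (r (r' n))) (nat (int (r (r' n)) + l)) -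
      C (unit_seq (r (r' n))) (nat (int (r (r' n)) + l)) = fourier_coeff f l - fourier_coeff g l"
    using eventually_ge_at_top[of "nat \<bar>l\<bar>"]
  proof eventually_elim
    case (elim n)
    have "n \<le> r (r' n)"
      using strict_mono_imp_increasing[OF r'(1), of n] strict_mono_imp_increasing[OF r(1), of "r' n"] by linarith
    then have "int (nat (int (r (r' n)) + l)) - int (r (r' n)) = l"
      using elim by auto
    then show ?case
      using eq[of "nat (int (r (r' n)) + l)" "r (r' n)"] by (simp add: algebra_simps)
  qed
  have "fourier_coeff f l - fourier_coeff g l = 0"
    by (rule LIMSEQ_unique[OF tendsto_eventually[OF \<open>eventually _ _\<close>] lim])
  then show ?thesis by simp
qed

text \<open>Vanishing of all Fourier coefficients survives multiplication by z and by its conjugate,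
  hence by polynomials in the real and imaginary parts. Products nest two multipliers, so
  \<open>h\<close> has to vary in the induction.\<close>

lemma fourier_coeff_mult_polynomial_function:
  assumes "real_polynomial_function q" "continuous_on (sphere 0 1) h" "\<And>l. fourier_coeff h l = 0"
  shows "fourier_coeff (\<lambda>z. of_real (q z) * h z) l = 0"
  using assms
proof (induction q arbitrary: h l rule: real_polynomial_function.induct)
  case (linear q)
  interpret bounded_linear q by fact
  \<comment> \<open>A real-linear functional is Re z q(1) + Im z q(\<i>); \<open>a\<close> and
    \<open>b\<close> are its coefficients in terms of z and \<open>cnj z\<close>.\<close>
  define a b where "a = (of_real (q 1) - \<i> * of_real (q \<i>)) / 2" and "b = (of_real (q 1) + \<i> * of_real (q \<i>)) / 2"
  have "of_real (q z) = a * z + b * cnj z" for z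
  proof -
    have "q z = q (Re z *\<^sub>R 1 + Im z *\<^sub>R \<i>)"
      by (intro arg_cong[of _ _ q]) (simp add: complex_eq_iff)
    also have "\<dots> = Re z * q 1 + Im z * q \<i>"
      by (simp only: add scaleR real_scaleR_def)
    finally show ?thesis
      by (simp add: a_def b_def complex_eq_iff algebra_simps diff_divide_distrib add_divide_distrib)
  qed
  then have "(\<lambda>z. of_real (q z) * h z) = (\<lambda>z. a * (z * h z) + b * (cnj z * h z))"
    by (simp add: fun_eq_iff algebra_simps)
  then show ?case
    using linear.prems
    by (simp add: fourier_coeff_add[of "\<lambda>z. a * (z * h z)" "\<lambda>z. b * (cnj z * h z)"] fourier_coeff_scale
        fourier_coeff_mult_z fourier_coeff_mult_cnj continuous_intros)
next
  case (const c)
  then show ?case by (simp add: fourier_coeff_scale)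
next
  case (add f g)
  have "continuous_on (sphere 0 1) f" "continuous_on (sphere 0 1) g"
    using add.hyps continuous_on_polymonial_function by (auto simp: real_polynomial_function_eq)
  then show ?case
    using add by (simp add: distrib_right fourier_coeff_add continuous_intros)
next
  case (mult f g)
  have "continuous_on (sphere 0 1) g"
    using mult.hyps continuous_on_polymonial_function by (auto simp: real_polynomial_function_eq)
  then have "fourier_coeff (\<lambda>z. of_real (f z) * (of_real (g z) * h z)) l = 0"
    using mult by (intro mult.IH(1)) (auto intro!: continuous_intros)
  then show ?case by (simp add: mult.assoc)
qed

text \<open>By Stone-Weierstrass some polynomial g is within e of the conjugate of \<open>f\<close>
  on the circle. The integral of g f vanishes, so that of |f|^2 is at most e times that of
  |f|.\<close>

lemma fourier_coeff_unique:
  assumes f: "continuous_on (sphere 0 1) f" and 0: "\<And>l. fourier_coeff f l = 0" and z: "cmod z = 1"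
  shows "f z = 0"
proof -
  define J where "J = integral {0..2 * pi} (\<lambda>\<theta>. cmod (f (cis \<theta>)))"
  define I where "I = integral {0..2 * pi} (\<lambda>\<theta>. (cmod (f (cis \<theta>)))\<^sup>2)"
  note contf = continuous_on_circle[OF f]
  have J: "0 \<le> J"
    unfolding J_def by (intro integral_nonneg integrable_continuous_real continuous_intros contf) auto
  have I_le: "I \<le> e * J" if "e > 0" for e
  proof -
    have "continuous_on (sphere 0 1) (\<lambda>z. cnj (f z))"
      by (intro continuous_intros f)
    from Stone_Weierstrass_polynomial_function[OF compact_sphere this \<open>e > 0\<close>]
    obtain g where g: "polynomial_function g" "\<And>z. z \<in> sphere 0 1 \<Longrightarrow> cmod (cnj (f z) - g z) < e"
      by blast
    have gc: "continuous_on S g" for S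
      using continuous_on_polymonial_function[OF g(1)] .
    have "real_polynomial_function (\<lambda>z. Re (g z))" "real_polynomial_function (\<lambda>z. Im (g z))"
      using g(1) bounded_linear_Re bounded_linear_Im by (auto simp: polynomial_function_def o_def)
    note q0 = fourier_coeff_mult_polynomial_function[OF this(1) f 0, of 0]
      fourier_coeff_mult_polynomial_function[OF this(2) f 0, of 0]
    have "g z * f z = of_real (Re (g z)) * f z + \<i> * (of_real (Im (g z)) * f z)" for z
      by (subst complex_eq[of "g z"]) (simp add: algebra_simps)
    then have "fourier_coeff (\<lambda>z. g z * f z) 0 = 0"
      using q0 by (simp add: fourier_coeff_add fourier_coeff_scale f gc continuous_intros)
    then have gf: "integral {0..2 * pi} (\<lambda>\<theta>. g (cis \<theta>) * f (cis \<theta>)) = 0"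
      by (simp add: fourier_coeff_def)
    have "complex_of_real I = integral {0..2 * pi} (\<lambda>\<theta>. complex_of_real ((cmod (f (cis \<theta>)))\<^sup>2))"
      unfolding I_def
      by (rule integral_linear[OF _ bounded_linear_of_real, symmetric, unfolded o_def])
        (intro integrable_continuous_real continuous_intros contf)
    also have "\<dots> = integral {0..2 * pi} (\<lambda>\<theta>. (cnj (f (cis \<theta>)) - g (cis \<theta>)) * f (cis \<theta>) + g (cis \<theta>) * f (cis \<theta>))"
    proof (rule integral_cong)
      show "complex_of_real ((cmod (f (cis x)))\<^sup>2) =
          (cnj (f (cis x)) - g (cis x)) * f (cis x) + g (cis x) * f (cis x)" for x
        by (subst complex_norm_square) (simp add: algebra_simps)
    qed
    also have "\<dots> = integral {0..2 * pi} (\<lambda>\<theta>. (cnj (f (cis \<theta>)) - g (cis \<theta>)) * f (cis \<theta>))"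
      by (subst integral_add)
        (auto simp: gf intro!: integrable_continuous_real continuous_intros contf continuous_on_compose2[OF gc[of UNIV]])
    finally have "\<bar>I\<bar> = cmod (integral {0..2 * pi} (\<lambda>\<theta>. (cnj (f (cis \<theta>)) - g (cis \<theta>)) * f (cis \<theta>)))"
      by (metis norm_of_real)
    also have "\<dots> \<le> integral {0..2 * pi} (\<lambda>\<theta>. e * cmod (f (cis \<theta>)))"
    proof (rule integral_norm_bound_integral)
      show "cmod ((cnj (f (cis x)) - g (cis x)) * f (cis x)) \<le> e * cmod (f (cis x))" for x
        using g(2)[of "cis x"] by (simp add: norm_mult mult_right_mono)
    qed (intro integrable_continuous_real continuous_intros contf continuous_on_compose2[OF gc[of UNIV]]; simp)+
    finally show ?thesis
      by (simp add: J_def)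
  qed
  have "I \<le> 0"
  proof (rule field_le_epsilon)
    fix e :: real assume "e > 0"
    have "I \<le> e / (J + 1) * J"
      using J \<open>e > 0\<close> by (intro I_le) (auto simp: add_nonneg_pos)
    also have "\<dots> \<le> e"
      using J \<open>e > 0\<close> by (simp add: field_simps)
    finally show "I \<le> 0 + e" by simp
  qed
  moreover have "0 \<le> I"
    unfolding I_def by (intro integral_nonneg integrable_continuous_real continuous_intros contf) auto
  ultimately have I0: "I = 0" by simp
  have "continuous_on {0..2 * pi} (\<lambda>\<theta>. (cmod (f (cis \<theta>)))\<^sup>2)"
    by (intro continuous_intros contf)
  from integral_eq_0_iff[OF this] have "\<forall>\<theta>\<in>{0..2 * pi}. (cmod (f (cis \<theta>)))\<^sup>2 = 0"
    using I0 unfolding I_def by simp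
  moreover obtain t where "z = cis t" "t \<in> {0..2 * pi}"
    using z Arg2pi_eq[of z] Arg2pi_ge_0[of z] Arg2pi_lt_2pi[of z]
    by (intro that[of "Arg2pi z"]) (auto simp: cis_conv_exp)
  ultimately show ?thesis by simp
qed

text \<open>The chosen symbol agrees on the circle with the explicit one, as their difference has
  zero Fourier coefficients. It remains that (1 + Re z) / 2 maps the circle onto [0, 1], with
  preimages given by \<open>arccos\<close>.\<close>

lemma symbol_nonvanishing_iff:
  "symbol_nonvanishing (Vtilde M k) \<longleftrightarrow> (\<forall>x\<in>{0..1}. volterra_kernel M k (1 - x) x \<noteq> 0)"
proof -
  let ?f = "poly_symbol (symbol_poly M k)" and ?g = "toeplitz_symbol (Vtilde M k)"
  have g: "is_toeplitz_symbol (Vtilde M k) ?g"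
    unfolding toeplitz_symbol_def by (rule someI[where P = "is_toeplitz_symbol (Vtilde M k)", OF is_toeplitz_symbol_Vtilde])
  have cont: "continuous_on (sphere 0 1) ?g"
    using g by (simp add: is_toeplitz_symbol_def)
  have eq: "?g z = ?f z" if "cmod z = 1" for z
  proof -
    have "fourier_coeff (\<lambda>z. ?g z + - 1 * ?f z) l = 0" for l
      using toeplitz_symbol_fourier_unique[OF g is_toeplitz_symbol_Vtilde, of l] 
        fourier_coeff_add[OF cont, of "\<lambda>z. - 1 * ?f z" l] fourier_coeff_scale[of "- 1" ?f l]
      by (simp add: continuous_intros continuous_on_poly_symbol)
    from fourier_coeff_unique[OF _ this that] show ?thesis
      by (auto intro!: continuous_intros cont continuous_on_poly_symbol)
  qed
  have "symbol_nonvanishing (Vtilde M k) \<longleftrightarrow> (\<forall>z. cmod z = 1 \<longrightarrow> ?f z \<noteq> 0)"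
    using eq by (auto simp: symbol_nonvanishing_def)
  also have "\<dots> \<longleftrightarrow> (\<forall>x\<in>{0..1}. poly (symbol_poly M k) (of_real x) \<noteq> 0)"
  proof
    assume *: "\<forall>z. cmod z = 1 \<longrightarrow> ?f z \<noteq> 0"
    show "\<forall>x\<in>{0..1}. poly (symbol_poly M k) (of_real x) \<noteq> 0"
    proof
      fix x :: real assume "x \<in> {0..1}"
      then have "cos (arccos (2 * x - 1)) = 2 * x - 1"
        by (intro cos_arccos) auto
      then show "poly (symbol_poly M k) (of_real x) \<noteq> 0"
        using *[rule_format, of "cis (arccos (2 * x - 1))"] by (simp add: poly_symbol_def)
    qed
  next
    assume *: "\<forall>x\<in>{0..1}. poly (symbol_poly M k) (of_real x) \<noteq> 0"
    show "\<forall>z. cmod z = 1 \<longrightarrow> ?f z \<noteq> 0"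
    proof (intro allI impI)
      fix z assume "cmod z = 1"
      then have "(1 + Re z) / 2 \<in> {0..1}"
        using abs_Re_le_cmod[of z] by auto
      then show "?f z \<noteq> 0"
        unfolding poly_symbol_def using * by blast
    qed
  qed
  finally show ?thesis
    by (simp add: poly_symbol_poly)
qed

section \<open>Expansions\<close>

abbreviation unit_leb :: "real measure" where
  "unit_leb \<equiv> lebesgue_on {0..1}"

lemma AE_unit_leb_neq: "AE x in unit_leb. x \<noteq> c"
proof -
  have "AE x in lebesgue. x \<noteq> c"
    by (rule AE_completion[OF AE_lborel_singleton])
  then show ?thesis
    by (subst AE_restrict_space_iff) (auto elim: eventually_mono)
qed

definition psum :: "(nat \<Rightarrow> complex) \<Rightarrow> nat \<Rightarrow> real \<Rightarrow> complex" where
  "psum a N x = (\<Sum>n<N. a n * of_real (P10 n x))"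

lemma has_expansion_psum:
  "has_expansion f a \<longleftrightarrow> f \<in> borel_measurable unit_leb \<and>
     integrable unit_leb (\<lambda>x. (1 - x) * (cmod (f x))\<^sup>2) \<and>
     (\<lambda>N. LINT x|unit_leb. (1 - x) * (cmod (f x - psum a N x))\<^sup>2) \<longlonglongrightarrow> 0"
  by (simp add: has_expansion_def psum_def)

lemma continuous_on_psum: "continuous_on S (psum a N)"
  unfolding psum_def[abs_def] by (intro continuous_intros continuous_on_P10)

lemma borel_measurable_unit_leb:
  fixes f :: "real \<Rightarrow> 'a::euclidean_space"
  shows "continuous_on {0..1} f \<Longrightarrow> f \<in> borel_measurable unit_leb"
  by (rule continuous_imp_measurable_on_sets_lebesgue) auto

lemma borel_measurable_psum [measurable]: "psum a N \<in> borel_measurable unit_leb"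
  by (rule borel_measurable_unit_leb[OF continuous_on_psum])

lemma borel_measurable_id_unit_leb [measurable]: "(\<lambda>x. x) \<in> borel_measurable unit_leb"
  by (rule borel_measurable_unit_leb) (rule continuous_on_id)

lemma psum_diff: "psum a N x - psum b N x = psum (\<lambda>i. a i - b i) N x"
  by (simp add: psum_def sum_subtractf left_diff_distrib)

lemma psum_add: "psum a N x + psum b N x = psum (\<lambda>i. a i + b i) N x"
  by (simp add: psum_def sum.distrib distrib_right)

lemma psum_eq_larger:
  assumes "\<And>m. m \<ge> N \<Longrightarrow> a m = 0" "N \<le> L"
  shows "psum a L = psum a N"
  unfolding psum_def using assms by (intro ext sum.mono_neutral_right) auto

lemma psum_trunc: "psum (trunc N a) N = psum a N"
  by (auto simp: psum_def trunc_nth)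

lemma integrable_psum_sq: "integrable unit_leb (\<lambda>x. (1 - x) * (cmod (psum a N x))\<^sup>2)"
  by (intro continuous_imp_integrable_real continuous_intros continuous_on_psum)

text \<open>Parseval's identity. The weights 1 / (2 (m + 1)) are the squared norms of the
  polynomials; being at most 1, they make the \<open>ell 0\<close> norm of the coefficients an upper
  bound.\<close>

lemma integral_psum_sq:
  "(LINT x|unit_leb. (1 - x) * (cmod (psum a N x))\<^sup>2) = (\<Sum>m<N. (cmod (a m))\<^sup>2 / (2 * (real m + 1)))"
proof -
  define c where "c = (\<lambda>n m. Re (a n * cnj (a m)))"
  have "(cmod (psum a N x))\<^sup>2 = (\<Sum>n<N. \<Sum>m<N. c n m * P10 n x * P10 m x)" for x
  proof -
    have "complex_of_real ((cmod (psum a N x))\<^sup>2) = psum a N x * cnj (psum a N x)"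
      by (rule complex_norm_square)
    also have "\<dots> = (\<Sum>n<N. \<Sum>m<N. (a n * cnj (a m)) * of_real (P10 n x * P10 m x))"
      by (simp add: psum_def sum_product mult_ac)
    finally have "(cmod (psum a N x))\<^sup>2 = Re (\<Sum>n<N. \<Sum>m<N. (a n * cnj (a m)) * of_real (P10 n x * P10 m x))"
      by (metis Re_complex_of_real)
    also have "\<dots> = (\<Sum>n<N. \<Sum>m<N. Re ((a n * cnj (a m)) * of_real (P10 n x * P10 m x)))"
      by (simp only: Re_sum)
    also have "\<dots> = (\<Sum>n<N. \<Sum>m<N. c n m * P10 n x * P10 m x)"
      by (intro sum.cong refl) (simp add: c_def algebra_simps)
    finally show ?thesis .
  qed
  then have "(LINT x|unit_leb. (1 - x) * (cmod (psum a N x))\<^sup>2) =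
      (LINT x|unit_leb. (\<Sum>n<N. \<Sum>m<N. c n m * ((1 - x) * P10 n x * P10 m x)))"
    by (simp add: sum_distrib_left mult_ac)
  also have "\<dots> = (\<Sum>n<N. \<Sum>m<N. c n m * (LINT x|unit_leb. (1 - x) * P10 n x * P10 m x))"
  proof -
    have int: "integrable unit_leb (\<lambda>x. (1 - x) * P10 n x * P10 m x)" for n m
      by (intro continuous_imp_integrable_real continuous_intros continuous_on_P10)
    show ?thesis
      by (simp add: Bochner_Integration.integral_sum Bochner_Integration.integrable_sum int)
  qed
  also have "\<dots> = (\<Sum>n<N. \<Sum>m<N. c n m * P10_ip (P10 n) (P10 m))"
  proof -
    have "(LINT x|unit_leb. (1 - x) * P10 n x * P10 m x) = P10_ip (P10 n) (P10 m)" for n m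
      unfolding P10_ip_def
      by (intro lebesgue_integral_eq_integral continuous_imp_integrable_real continuous_intros continuous_on_P10) auto
    then show ?thesis by simp
  qed
  also have "\<dots> = (\<Sum>n<N. \<Sum>m<N. if m = n then (cmod (a n))\<^sup>2 / (2 * (real n + 1)) else 0)"
  proof (intro sum.cong refl)
    fix n m
    have "c n n = (cmod (a n))\<^sup>2"
      using cmod_power2[of "a n"] by (simp add: c_def power2_eq_square)
    then show "c n m * P10_ip (P10 n) (P10 m) = (if m = n then (cmod (a n))\<^sup>2 / (2 * (real n + 1)) else 0)"
      by (auto simp: P10_ip_self P10_orthogonal)
  qed
  also have "\<dots> = (\<Sum>n<N. (cmod (a n))\<^sup>2 / (2 * (real n + 1)))"
    by simp
  finally show ?thesis .
qed

lemma integral_psum_sq_le: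
  assumes "a \<in> ell 0"
  shows "(LINT x|unit_leb. (1 - x) * (cmod (psum a N x))\<^sup>2) \<le> (ell_norm 0 a)\<^sup>2"
proof -
  have "(LINT x|unit_leb. (1 - x) * (cmod (psum a N x))\<^sup>2) \<le> (\<Sum>m<N. (cmod (a m))\<^sup>2)"
    unfolding integral_psum_sq by (intro sum_mono) (simp add: field_simps mult_left_le add_increasing)
  also have "\<dots> \<le> (\<Sum>m. (cmod (a m))\<^sup>2)"
    using assms by (intro sum_le_suminf) (auto simp: ell_0_iff)
  finally show ?thesis
    by (simp add: ell_norm_power2[OF assms])
qed

lemma nn_integral_psum_sq_le:
  assumes "a \<in> ell 0"
  shows "(\<integral>\<^sup>+x. ennreal ((1 - x) * (cmod (psum a N x))\<^sup>2) \<partial>unit_leb) \<le> ennreal ((ell_norm 0 a)\<^sup>2)"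
proof -
  have "(\<integral>\<^sup>+x. ennreal ((1 - x) * (cmod (psum a N x))\<^sup>2) \<partial>unit_leb) =
      ennreal (LINT x|unit_leb. (1 - x) * (cmod (psum a N x))\<^sup>2)"
    by (rule nn_integral_eq_integral[OF integrable_psum_sq]) (auto intro!: AE_I2)
  then show ?thesis
    using integral_psum_sq_le[OF assms] by (simp add: ennreal_leI)
qed

text \<open>Fatou's lemma, applied to \<open>w\<^sub>K - S\<^sub>N c\<close> for the partial sums \<open>S\<^sub>N c\<close> of the limit expansion.\<close>

lemma has_expansion_limit:
  assumes f [measurable]: "f \<in> borel_measurable unit_leb"
    and c: "c \<in> ell 0" and C: "\<And>K :: nat. C K \<in> ell 0"
    and w: "\<And>K. \<exists>L. (\<forall>m\<ge>L. C K m = 0) \<and> w K = psum (C K) L"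
    and lim: "AE x in unit_leb. (\<lambda>K. w K x) \<longlonglongrightarrow> f x"
    and conv: "(\<lambda>K. ell_norm 0 (\<lambda>i. C K i - c i)) \<longlonglongrightarrow> 0"
  shows "has_expansion f c"
proof -
  define t where "t = (\<lambda>N. ell_norm 0 (\<lambda>i. c i - trunc N c i))"
  have t: "t \<longlonglongrightarrow> 0" "\<And>N. 0 \<le> t N"
    unfolding t_def by (auto intro!: ell_0_diff_trunc_tendsto[OF c] ell_norm_nonneg ell_0_diff c)
  have wm [measurable]: "w K \<in> borel_measurable unit_leb" for K
    using w[of K] by auto
  have main: "(\<integral>\<^sup>+x. ennreal ((1 - x) * (cmod (f x - psum c N x))\<^sup>2) \<partial>unit_leb) \<le> ennreal ((t N)\<^sup>2)" for N
  proof -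
    have le: "(\<integral>\<^sup>+x. ennreal ((1 - x) * (cmod (w K x - psum c N x))\<^sup>2) \<partial>unit_leb) \<le>
        ennreal ((ell_norm 0 (\<lambda>i. C K i - c i) + t N)\<^sup>2)" for K
    proof -
      obtain L where L: "\<And>m. m \<ge> L \<Longrightarrow> C K m = 0" "w K = psum (C K) L"
        using w[of K] by blast
      define b where "b = (\<lambda>i. C K i - trunc N c i)"
      have "psum c N = psum (trunc N c) (max L N)"
        using psum_eq_larger[of N "trunc N c" "max L N"] by (simp add: psum_trunc trunc_nth)
      moreover have "w K = psum (C K) (max L N)"
        unfolding L(2) using psum_eq_larger[of L "C K" "max L N"] L(1) by simp
      ultimately have eq: "w K x - psum c N x = psum b (max L N) x" for x
        by (simp add: psum_diff b_def)
      have b: "b \<in> ell 0"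
        unfolding b_def by (rule ell_0_diff(1)[OF C ell_0_trunc])
      have "ell_norm 0 b \<le> ell_norm 0 (\<lambda>i. C K i - c i) + t N"
        using ell_0_add(2)[OF ell_0_diff(1)[OF C[of K] c] ell_0_diff(1)[OF c ell_0_trunc[of N c]]]
        by (simp add: b_def t_def)
      then have "(ell_norm 0 b)\<^sup>2 \<le> (ell_norm 0 (\<lambda>i. C K i - c i) + t N)\<^sup>2"
        by (rule power_mono) (rule ell_norm_nonneg[OF b])
      then show ?thesis
        unfolding eq using nn_integral_psum_sq_le[OF b, of "max L N"] order_trans ennreal_leI by blast
    qed
    have "(\<integral>\<^sup>+x. ennreal ((1 - x) * (cmod (f x - psum c N x))\<^sup>2) \<partial>unit_leb) =
        (\<integral>\<^sup>+x. liminf (\<lambda>K. ennreal ((1 - x) * (cmod (w K x - psum c N x))\<^sup>2)) \<partial>unit_leb)"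
    proof (rule nn_integral_cong_AE, use lim in eventually_elim)
      case (elim x)
      have "(\<lambda>K. ennreal ((1 - x) * (cmod (w K x - psum c N x))\<^sup>2)) \<longlonglongrightarrow>
          ennreal ((1 - x) * (cmod (f x - psum c N x))\<^sup>2)"
        by (intro tendsto_ennrealI tendsto_intros elim)
      then show ?case
        by (simp add: lim_imp_Liminf)
    qed
    also have "\<dots> \<le> liminf (\<lambda>K. \<integral>\<^sup>+x. ennreal ((1 - x) * (cmod (w K x - psum c N x))\<^sup>2) \<partial>unit_leb)"
      by (rule nn_integral_liminf) measurable
    also have "\<dots> \<le> liminf (\<lambda>K. ennreal ((ell_norm 0 (\<lambda>i. C K i - c i) + t N)\<^sup>2))"
      by (intro Liminf_mono always_eventually allI le)
    also have "\<dots> = ennreal ((0 + t N)\<^sup>2)"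
      by (intro lim_imp_Liminf tendsto_ennrealI tendsto_intros conv) simp
    finally show ?thesis by simp
  qed
  have int: "integrable unit_leb (\<lambda>x. (1 - x) * (cmod (f x - psum c N x))\<^sup>2)" and
    bd: "(LINT x|unit_leb. (1 - x) * (cmod (f x - psum c N x))\<^sup>2) \<le> (t N)\<^sup>2" for N
  proof -
    have nn: "AE x in unit_leb. 0 \<le> (1 - x) * (cmod (f x - psum c N x))\<^sup>2"
      by (rule AE_I2) auto
    show i: "integrable unit_leb (\<lambda>x. (1 - x) * (cmod (f x - psum c N x))\<^sup>2)"
      by (rule integrableI_nonneg[OF _ nn]) (measurable, use main[of N] in \<open>auto simp: less_top[symmetric] top_unique\<close>)
    show "(LINT x|unit_leb. (1 - x) * (cmod (f x - psum c N x))\<^sup>2) \<le> (t N)\<^sup>2"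
      using main[of N] nn_integral_eq_integral[OF i nn] by simp
  qed
  show ?thesis
    unfolding has_expansion_psum
  proof (intro conjI f)
    \<comment> \<open>The empty partial sum is 0, so the case \<open>N = 0\<close> is the
      integrability for \<open>f\<close> itself.\<close>
    show "integrable unit_leb (\<lambda>x. (1 - x) * (cmod (f x))\<^sup>2)"
      using int[of 0] by (simp add: psum_def)
    have "(\<lambda>N. (t N)\<^sup>2) \<longlonglongrightarrow> 0\<^sup>2"
      by (intro tendsto_intros t)
    then have t2: "(\<lambda>N. (t N)\<^sup>2) \<longlonglongrightarrow> 0" by simp
    show "(\<lambda>N. LINT x|unit_leb. (1 - x) * (cmod (f x - psum c N x))\<^sup>2) \<longlonglongrightarrow> 0"
    proof (rule Lim_null_comparison[OF always_eventually t2], rule allI)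
      fix N
      have "0 \<le> (LINT x|unit_leb. (1 - x) * (cmod (f x - psum c N x))\<^sup>2)"
        by (rule integral_nonneg_AE) (auto intro!: AE_I2)
      then show "norm (LINT x|unit_leb. (1 - x) * (cmod (f x - psum c N x))\<^sup>2) \<le> (t N)\<^sup>2"
        using bd[of N] by simp
    qed
  qed
qed

section \<open>Linearity, uniqueness and existence of expansions\<close>

lemma sq_norm_add_le: "(cmod (a + b))\<^sup>2 \<le> 2 * (cmod a)\<^sup>2 + 2 * (cmod b)\<^sup>2"
proof -
  have "(cmod (a + b))\<^sup>2 \<le> (cmod a + cmod b)\<^sup>2"
    by (intro power_mono norm_triangle_ineq) auto
  also have "\<dots> \<le> 2 * (cmod a)\<^sup>2 + 2 * (cmod b)\<^sup>2"
    using zero_le_power2[of "cmod a - cmod b"] by (simp add: power2_eq_square algebra_simps)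
  finally show ?thesis .
qed

text \<open>The crude factor 2 replaces Minkowski's inequality, which is enough for integrability
  and for limits equal to 0.\<close>

lemma integrable_weighted_sq_add:
  assumes [measurable]: "f \<in> borel_measurable unit_leb" "g \<in> borel_measurable unit_leb"
    and f: "integrable unit_leb (\<lambda>x. (1 - x) * (cmod (f x))\<^sup>2)"
    and g: "integrable unit_leb (\<lambda>x. (1 - x) * (cmod (g x))\<^sup>2)"
  shows "integrable unit_leb (\<lambda>x. (1 - x) * (cmod (f x + g x))\<^sup>2)"
    and "(LINT x|unit_leb. (1 - x) * (cmod (f x + g x))\<^sup>2) \<le>
      2 * (LINT x|unit_leb. (1 - x) * (cmod (f x))\<^sup>2) + 2 * (LINT x|unit_leb. (1 - x) * (cmod (g x))\<^sup>2)"
proof -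
  have le: "(1 - x) * (cmod (f x + g x))\<^sup>2 \<le> 2 * ((1 - x) * (cmod (f x))\<^sup>2) + 2 * ((1 - x) * (cmod (g x))\<^sup>2)"
    if "x \<in> space unit_leb" for x
    using mult_left_mono[OF sq_norm_add_le[of "f x" "g x"], of "1 - x"] that by (simp add: algebra_simps)
  have dom: "integrable unit_leb (\<lambda>x. 2 * ((1 - x) * (cmod (f x))\<^sup>2) + 2 * ((1 - x) * (cmod (g x))\<^sup>2))"
    by (intro Bochner_Integration.integrable_add integrable_mult_right f g)
  show i: "integrable unit_leb (\<lambda>x. (1 - x) * (cmod (f x + g x))\<^sup>2)"
  proof (rule Bochner_Integration.integrable_bound[OF dom])
    show "AE x in unit_leb. norm ((1 - x) * (cmod (f x + g x))\<^sup>2) \<le>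
        norm (2 * ((1 - x) * (cmod (f x))\<^sup>2) + 2 * ((1 - x) * (cmod (g x))\<^sup>2))"
      using le by (intro AE_I2) (auto simp: abs_mult)
  qed measurable
  have "(LINT x|unit_leb. (1 - x) * (cmod (f x + g x))\<^sup>2) \<le>
      (LINT x|unit_leb. 2 * ((1 - x) * (cmod (f x))\<^sup>2) + 2 * ((1 - x) * (cmod (g x))\<^sup>2))"
    by (rule integral_mono[OF i dom le])
  also have "\<dots> = 2 * (LINT x|unit_leb. (1 - x) * (cmod (f x))\<^sup>2) + 2 * (LINT x|unit_leb. (1 - x) * (cmod (g x))\<^sup>2)"
    using f g by simp
  finally show "(LINT x|unit_leb. (1 - x) * (cmod (f x + g x))\<^sup>2) \<le>
      2 * (LINT x|unit_leb. (1 - x) * (cmod (f x))\<^sup>2) + 2 * (LINT x|unit_leb. (1 - x) * (cmod (g x))\<^sup>2)" .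
qed

lemma has_expansion_residual:
  assumes "has_expansion f a"
  shows "f \<in> borel_measurable unit_leb" "(\<lambda>x. f x - psum a N x) \<in> borel_measurable unit_leb"
    "integrable unit_leb (\<lambda>x. (1 - x) * (cmod (f x - psum a N x))\<^sup>2)"
proof -
  show f [measurable]: "f \<in> borel_measurable unit_leb"
    using assms by (simp add: has_expansion_psum)
  show "(\<lambda>x. f x - psum a N x) \<in> borel_measurable unit_leb"
    by measurable
  show "integrable unit_leb (\<lambda>x. (1 - x) * (cmod (f x - psum a N x))\<^sup>2)"
    using integrable_weighted_sq_add(1)[of f "\<lambda>x. - psum a N x"] assms integrable_psum_sq[of a N]
    by (simp add: has_expansion_psum)
qed

lemma has_expansion_add:
  assumes f: "has_expansion f a" and g: "has_expansion g b"
  shows "has_expansion (\<lambda>x. f x + g x) (\<lambda>i. a i + b i)"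
proof -
  note fm = has_expansion_residual[OF f] and gm = has_expansion_residual[OF g]
  have "(\<lambda>N. LINT x|unit_leb. (1 - x) * (cmod (f x + g x - psum (\<lambda>i. a i + b i) N x))\<^sup>2) \<longlonglongrightarrow> 0"
  proof (rule Lim_null_comparison[OF always_eventually], rule allI)
    fix N
    have eq: "f x + g x - psum (\<lambda>i. a i + b i) N x = (f x - psum a N x) + (g x - psum b N x)" for x
      by (simp flip: psum_add)
    have "0 \<le> (LINT x|unit_leb. (1 - x) * (cmod (f x + g x - psum (\<lambda>i. a i + b i) N x))\<^sup>2)"
      by (rule integral_nonneg_AE) (auto intro!: AE_I2)
    then show "norm (LINT x|unit_leb. (1 - x) * (cmod (f x + g x - psum (\<lambda>i. a i + b i) N x))\<^sup>2) \<le>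
        2 * (LINT x|unit_leb. (1 - x) * (cmod (f x - psum a N x))\<^sup>2) + 2 * (LINT x|unit_leb. (1 - x) * (cmod (g x - psum b N x))\<^sup>2)"
      unfolding eq using integrable_weighted_sq_add(2)[OF fm(2)[of N] gm(2)[of N] fm(3) gm(3)] by simp
  next
    have "(\<lambda>N. 2 * (LINT x|unit_leb. (1 - x) * (cmod (f x - psum a N x))\<^sup>2) + 2 * (LINT x|unit_leb. (1 - x) * (cmod (g x - psum b N x))\<^sup>2)) \<longlonglongrightarrow> 2 * 0 + 2 * 0"
      using f g by (intro tendsto_intros) (auto simp: has_expansion_psum)
    then show "(\<lambda>N. 2 * (LINT x|unit_leb. (1 - x) * (cmod (f x - psum a N x))\<^sup>2) + 2 * (LINT x|unit_leb. (1 - x) * (cmod (g x - psum b N x))\<^sup>2)) \<longlonglongrightarrow> 0"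
      by simp
  qed
  then show ?thesis
    using fm(1) gm(1) integrable_weighted_sq_add(1)[OF fm(1) gm(1)] f g
    by (auto simp: has_expansion_psum)
qed

text \<open>By Parseval one coefficient of the difference is controlled by the weighted L2 norm of
  the difference of partial sums. As \<open>f\<close> and \<open>g\<close> agree almost everywhere,
  that difference consists of two residuals, which tend to 0.\<close>

lemma has_expansion_unique:
  assumes f: "has_expansion f a" and g: "has_expansion g b" and eq: "AE x in unit_leb. f x = g x"
  shows "a = b"
proof
  fix m
  note fm = has_expansion_residual[OF f] and gm = has_expansion_residual[OF g]
  define E where "E = (\<lambda>N. 2 * (LINT x|unit_leb. (1 - x) * (cmod (f x - psum a N x))\<^sup>2) +
      2 * (LINT x|unit_leb. (1 - x) * (cmod (g x - psum b N x))\<^sup>2))"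
  have "E \<longlonglongrightarrow> 2 * 0 + 2 * 0"
    unfolding E_def using f g by (intro tendsto_intros) (auto simp: has_expansion_psum)
  then have E: "E \<longlonglongrightarrow> 0" by simp
  have "(cmod (a m - b m))\<^sup>2 / (2 * (real m + 1)) \<le> E N" if "N > m" for N
  proof -
    have "(cmod (a m - b m))\<^sup>2 / (2 * (real m + 1)) \<le> (\<Sum>i<N. (cmod (a i - b i))\<^sup>2 / (2 * (real i + 1)))"
      by (rule member_le_sum[of m _ "\<lambda>i. (cmod (a i - b i))\<^sup>2 / (2 * (real i + 1))"]) (use that in auto)
    also have "\<dots> = (LINT x|unit_leb. (1 - x) * (cmod (psum (\<lambda>i. a i - b i) N x))\<^sup>2)"
      by (rule integral_psum_sq[symmetric])
    also have "\<dots> = (LINT x|unit_leb. (1 - x) * (cmod ((g x - psum b N x) + - (f x - psum a N x)))\<^sup>2)"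
      by (rule integral_cong_AE; (use fm(2) gm(2) in measurable)?)
        (use eq in eventually_elim, simp flip: psum_diff)
    also have "\<dots> \<le> E N"
    proof -
      have "(\<lambda>x. - (f x - psum a N x)) \<in> borel_measurable unit_leb"
        by (rule borel_measurable_uminus[OF fm(2)])
      moreover have "integrable unit_leb (\<lambda>x. (1 - x) * (cmod (- (f x - psum a N x)))\<^sup>2)"
        unfolding norm_minus_cancel by (rule fm(3))
      ultimately show ?thesis
        using integrable_weighted_sq_add(2)[of "\<lambda>x. g x - psum b N x" "\<lambda>x. - (f x - psum a N x)", OF gm(2) _ gm(3)]
        unfolding E_def norm_minus_cancel by simp
    qed
    finally show ?thesis .
  qed
  then have "(cmod (a m - b m))\<^sup>2 / (2 * (real m + 1)) \<le> 0"
    by (intro tendsto_lowerbound[OF E]) (auto simp: eventually_sequentially intro!: exI[of _ "Suc m"])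
  then show "a m = b m"
    by (simp add: divide_le_0_iff)
qed

lemma has_expansion_0:
  assumes "has_expansion f (\<lambda>i. 0)"
  shows "AE x in unit_leb. f x = 0"
proof -
  have "(LINT x|unit_leb. (1 - x) * (cmod (f x))\<^sup>2) = 0"
    using assms LIMSEQ_unique[OF tendsto_const] by (force simp: has_expansion_psum psum_def)
  moreover have "AE x in unit_leb. 0 \<le> (1 - x) * (cmod (f x))\<^sup>2"
    by (rule AE_I2) auto
  ultimately have "AE x in unit_leb. (1 - x) * (cmod (f x))\<^sup>2 = 0"
    using assms integral_nonneg_eq_0_iff_AE[of unit_leb "\<lambda>x. (1 - x) * (cmod (f x))\<^sup>2"]
    by (simp add: has_expansion_psum)
  then show ?thesis
    using AE_unit_leb_neq[of 1] by eventually_elim auto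
qed

text \<open>Partial sums of rapidly chosen lengths \<open>N k\<close> have differences that are
  summable in weighted L1, so they converge almost everywhere; \<open>has_expansion_limit\<close>
  then identifies the expansion of the limit.\<close>

lemma riesz_fischer:
  assumes v: "v \<in> ell 0"
  shows "\<exists>f. has_expansion f v"
proof -
  have "\<exists>n. ell_norm 0 (\<lambda>i. v i - trunc n v i) < (1 / 2) ^ k" for k :: nat
  proof -
    from order_tendstoD(2)[OF ell_0_diff_trunc_tendsto[OF v], of "(1 / 2) ^ k"] show ?thesis
      by (auto simp: eventually_sequentially)
  qed
  then obtain N where N: "\<And>k. ell_norm 0 (\<lambda>i. v i - trunc (N k) v i) < (1 / 2) ^ k"
    by metis
  define w where "w = (\<lambda>k. psum v (N k))"
  define d where "d = (\<lambda>k x. w (Suc k) x - w k x)"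
  have [measurable]: "w k \<in> borel_measurable unit_leb" "d k \<in> borel_measurable unit_leb" for k
    by (simp_all add: w_def d_def)
  \<comment> \<open>Cauchy-Schwarz is replaced by |d| \<le> 2^-k + 2^k |d|^2. The coefficient norm
    of \<open>d k\<close> is at most 2 times 2^-k, so the second term integrates to at most 4 times
    2^-k, and 5 = 1 + 4.\<close>
  have d_le: "(\<integral>\<^sup>+x. ennreal ((1 - x) * cmod (d k x)) \<partial>unit_leb) \<le> ennreal (5 * (1 / 2) ^ k)" for k
  proof -
    define b where "b = (\<lambda>i. trunc (N (Suc k)) v i - trunc (N k) v i)"
    define L where "L = max (N k) (N (Suc k))"
    have b: "b \<in> ell 0"
      unfolding b_def by (rule ell_0_diff) auto
    have "w (Suc k) = psum (trunc (N (Suc k)) v) L" "w k = psum (trunc (N k) v) L"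
      using psum_eq_larger[of "N k" "trunc (N k) v" L] psum_eq_larger[of "N (Suc k)" "trunc (N (Suc k)) v" L]
      by (auto simp: w_def psum_trunc trunc_nth L_def)
    then have d: "d k x = psum b L x" for x
      by (simp add: d_def psum_diff b_def)
    have "ell_norm 0 b \<le> (1 / 2) ^ k + (1 / 2) ^ Suc k"
      using ell_0_diff(2)[OF ell_0_diff(1)[OF v ell_0_trunc[of "N k" v]] ell_0_diff(1)[OF v ell_0_trunc[of "N (Suc k)" v]]]
        N[of k] N[of "Suc k"] by (simp add: b_def)
    then have nb: "ell_norm 0 b \<le> 2 * (1 / 2) ^ k"
      using zero_le_power[of "1 / 2 :: real" k] by (simp only: power_Suc) linarith
    have "(ell_norm 0 b)\<^sup>2 \<le> (2 * (1 / 2) ^ k)\<^sup>2"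
      by (rule power_mono[OF nb ell_norm_nonneg[OF b]])
    then have sq: "(LINT x|unit_leb. (1 - x) * (cmod (d k x))\<^sup>2) \<le> 4 * ((1 / 2) ^ k * (1 / 2) ^ k)"
      unfolding d using integral_psum_sq_le[OF b, of L] by (simp add: power2_eq_square)
    have int: "integrable unit_leb (\<lambda>x. (1 - x) * cmod (d k x))" "integrable unit_leb (\<lambda>x. (1 - x) * (cmod (d k x))\<^sup>2)"
      unfolding d by (intro continuous_imp_integrable_real continuous_intros continuous_on_psum)+
    have "(LINT x|unit_leb. (1 - x) * cmod (d k x)) \<le> (LINT x|unit_leb. (1 / 2) ^ k + 2 ^ k * ((1 - x) * (cmod (d k x))\<^sup>2))"
    proof (rule integral_mono[OF int(1)])
      show "integrable unit_leb (\<lambda>x. (1 / 2) ^ k + 2 ^ k * ((1 - x) * (cmod (d k x))\<^sup>2))"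
        by (intro Bochner_Integration.integrable_add integrable_mult_right int(2)
            continuous_imp_integrable_real[OF continuous_on_const])
      fix x assume "x \<in> space unit_leb"
      then have x: "0 \<le> x" "x \<le> 1" by auto
      have "cmod (d k x) \<le> (1 / 2) ^ k + 2 ^ k * (cmod (d k x))\<^sup>2"
      proof -
        define y where "y = 2 ^ k * cmod (d k x)"
        have "y \<le> 1 + y\<^sup>2"
          using zero_le_power2[of "y - 1 / 2"] by (simp add: power2_eq_square algebra_simps)
        then have "(1 / 2) ^ k * y \<le> (1 / 2) ^ k * (1 + y\<^sup>2)"
          by (rule mult_left_mono) simp
        then show ?thesis
          by (simp add: y_def power2_eq_square power_divide distrib_left mult_ac)
      qed
      then have "(1 - x) * cmod (d k x) \<le> (1 - x) * ((1 / 2) ^ k + 2 ^ k * (cmod (d k x))\<^sup>2)"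
        by (rule mult_left_mono) (use x in simp)
      also have "\<dots> \<le> (1 / 2) ^ k + 2 ^ k * ((1 - x) * (cmod (d k x))\<^sup>2)"
        using mult_right_mono[of "1 - x" 1 "(1 / 2 :: real) ^ k"] x by (simp add: algebra_simps)
      finally show "(1 - x) * cmod (d k x) \<le> (1 / 2) ^ k + 2 ^ k * ((1 - x) * (cmod (d k x))\<^sup>2)" .
    qed
    also have "\<dots> = (1 / 2) ^ k + 2 ^ k * (LINT x|unit_leb. (1 - x) * (cmod (d k x))\<^sup>2)"
    proof -
      have "integrable unit_leb (\<lambda>x. (1 / 2 :: real) ^ k)"
        by (rule continuous_imp_integrable_real) auto
      then show ?thesis
        using int(2) by (simp add: measure_restrict_space)
    qed
    also have "\<dots> \<le> (1 / 2) ^ k + 2 ^ k * (4 * ((1 / 2) ^ k * (1 / 2) ^ k))"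
      by (intro add_left_mono mult_left_mono sq) auto
    also have "\<dots> = 5 * (1 / 2) ^ k"
      by (simp add: power_divide)
    finally have "(LINT x|unit_leb. (1 - x) * cmod (d k x)) \<le> 5 * (1 / 2) ^ k" .
    moreover have "AE x in unit_leb. 0 \<le> (1 - x) * cmod (d k x)"
      by (rule AE_I2) auto
    ultimately show ?thesis
      by (simp add: nn_integral_eq_integral[OF int(1)] ennreal_leI)
  qed
  have "(\<integral>\<^sup>+x. (\<Sum>k. ennreal ((1 - x) * cmod (d k x))) \<partial>unit_leb) =
      (\<Sum>k. \<integral>\<^sup>+x. ennreal ((1 - x) * cmod (d k x)) \<partial>unit_leb)"
    by (rule nn_integral_suminf) measurable
  also have "\<dots> \<le> (\<Sum>k. ennreal (5 * (1 / 2) ^ k))"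
    by (intro suminf_le d_le) auto
  also have "\<dots> = ennreal (\<Sum>k. 5 * (1 / 2) ^ k)"
    by (intro suminf_ennreal2 summable_mult summable_geometric) auto
  also have "\<dots> < \<infinity>"
    by simp
  finally have "AE x in unit_leb. (\<Sum>k. ennreal ((1 - x) * cmod (d k x))) \<noteq> \<infinity>"
    by (intro nn_integral_PInf_AE) auto
  moreover have "AE x in unit_leb. x \<in> space unit_leb"
    by (rule AE_space)
  \<comment> \<open>The weight vanishes at \<open>x = 1\<close> and gives no information there;
    elsewhere it can be divided out.\<close>
  ultimately have conv: "AE x in unit_leb. (\<lambda>k. w k x) \<longlonglongrightarrow> lim (\<lambda>k. w k x)"
    using AE_unit_leb_neq[of 1]
  proof eventually_elim
    case (elim x)
    then have x: "0 \<le> x" "x < 1" by auto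
    have "summable (\<lambda>k. (1 - x) * cmod (d k x))"
      by (rule summable_suminf_not_top) (use elim(1) x in auto)
    from summable_mult[OF this, of "inverse (1 - x)"] have "summable (\<lambda>k. cmod (d k x))"
      using x by simp
    then have "summable (\<lambda>k. d k x)"
      by (rule summable_norm_cancel)
    then have "convergent (\<lambda>n. \<Sum>k<n. d k x)"
      by (simp only: summable_iff_convergent)
    from convergent_add[OF this convergent_const[of "w 0 x"]] have "convergent (\<lambda>n. (\<Sum>k<n. d k x) + w 0 x)" .
    moreover have "(\<Sum>k<n. d k x) + w 0 x = w n x" for n
      unfolding d_def by (simp add: sum_lessThan_telescope[of "\<lambda>k. w k x"])
    ultimately have "convergent (\<lambda>k. w k x)"
      by simp
    then show ?case
      by (simp add: convergent_LIMSEQ_iff)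
  qed
  have "has_expansion (\<lambda>x. lim (\<lambda>k. w k x)) v"
  proof (rule has_expansion_limit[OF _ v _ _ conv, where C = "\<lambda>k. trunc (N k) v"])
    show "\<exists>L. (\<forall>m\<ge>L. trunc (N k) v m = 0) \<and> w k = psum (trunc (N k) v) L" for k
      by (intro exI[of _ "N k"]) (auto simp: w_def psum_trunc trunc_nth)
    have "(\<lambda>k. (1 / 2 :: real) ^ k) \<longlonglongrightarrow> 0"
      by (rule LIMSEQ_realpow_zero) auto
    then show "(\<lambda>k. ell_norm 0 (\<lambda>i. trunc (N k) v i - v i)) \<longlonglongrightarrow> 0"
    proof (rule Lim_null_comparison[OF always_eventually, rotated], intro allI)
      fix k
      show "norm (ell_norm 0 (\<lambda>i. trunc (N k) v i - v i)) \<le> (1 / 2) ^ k"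
        using N[of k] ell_norm_nonneg[OF ell_0_diff(1)[OF ell_0_trunc v]]
        by (simp add: ell_norm_minus_commute[of v] less_imp_le)
    qed
  qed auto
  then show ?thesis
    by (rule exI[where P = "\<lambda>f. has_expansion f v"])
qed

section \<open>The Volterra operator on expansions\<close>

text \<open>On finite expansions the coefficient operators match operations on functions exactly,
  without any limit; the general case follows by approximation.\<close>

definition finite_expansion :: "(nat \<Rightarrow> complex) \<Rightarrow> (real \<Rightarrow> complex) \<Rightarrow> bool" where
  "finite_expansion a f \<longleftrightarrow> (\<exists>L. (\<forall>m\<ge>L. a m = 0) \<and> f = psum a L)"

lemma finite_expansion_larger:
  assumes "finite_expansion a f"
  obtains L where "\<And>L'. L \<le> L' \<Longrightarrow> f = psum a L'" "\<And>m. L \<le> m \<Longrightarrow> a m = 0"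
proof -
  obtain L where L: "\<And>m. m \<ge> L \<Longrightarrow> a m = 0" "f = psum a L"
    using assms by (auto simp: finite_expansion_def)
  show ?thesis
  proof (rule that[of L])
    show "f = psum a L'" if "L \<le> L'" for L'
      unfolding L(2) by (rule psum_eq_larger[symmetric]) (use L(1) that in auto)
  qed (rule L(1))
qed

lemma finite_expansion_add:
  assumes "finite_expansion a f" "finite_expansion b g"
  shows "finite_expansion (\<lambda>m. a m + b m) (\<lambda>x. f x + g x)"
proof -
  obtain L where L: "\<And>L'. L \<le> L' \<Longrightarrow> f = psum a L'" "\<And>m. L \<le> m \<Longrightarrow> a m = 0"
    using finite_expansion_larger[OF assms(1)] by metis
  obtain K where K: "\<And>L'. K \<le> L' \<Longrightarrow> g = psum b L'" "\<And>m. K \<le> m \<Longrightarrow> b m = 0"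
    using finite_expansion_larger[OF assms(2)] by metis
  have "f x + g x = psum (\<lambda>m. a m + b m) (max L K) x" for x
    unfolding psum_add[symmetric] using L(1)[of "max L K"] K(1)[of "max L K"] by simp
  then show ?thesis
    unfolding finite_expansion_def using L(2) K(2) by (intro exI[of _ "max L K"]) auto
qed

lemma finite_expansion_scale:
  assumes "finite_expansion a f"
  shows "finite_expansion (\<lambda>m. c * a m) (\<lambda>x. c * f x)"
proof -
  obtain L where "\<And>m. m \<ge> L \<Longrightarrow> a m = 0" "f = psum a L"
    using assms by (auto simp: finite_expansion_def)
  then show ?thesis
    unfolding finite_expansion_def
    by (intro exI[of _ L]) (auto simp: psum_def sum_distrib_left mult.assoc)
qed

lemma finite_expansion_sum:
  assumes "\<And>i. i \<in> I \<Longrightarrow> finite_expansion (a i) (f i)"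
  shows "finite_expansion (\<lambda>m. \<Sum>i\<in>I. a i m) (\<lambda>x. \<Sum>i\<in>I. f i x)"
  using assms
proof (induction I rule: infinite_finite_induct)
  case (insert i I)
  then show ?case
    using finite_expansion_add[of "a i" "f i" "\<lambda>m. \<Sum>i\<in>I. a i m" "\<lambda>x. \<Sum>i\<in>I. f i x"] by simp
qed (auto simp: finite_expansion_def psum_def intro!: exI[of _ 0])

lemma P10_recurrence:
  "x * P10 n x = rec_up n * P10 (Suc n) x + rec_diag n * P10 n x + rec_down n * P10 (n - 1) x"
proof (cases n)
  case 0
  then show ?thesis
    using mult_x_P10[of x n] by (simp add: P10_coeff_mult_x rec_down_def)
next
  case (Suc k)
  have "(\<Sum>m<k. P10_coeff (\<lambda>x. x * P10 n x) m * P10 m x) = 0"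
    using Suc by (intro sum.neutral) (auto simp: P10_coeff_mult_x_eq_0)
  moreover have "x * P10 n x = (\<Sum>m<Suc (Suc (Suc k)). P10_coeff (\<lambda>x. x * P10 n x) m * P10 m x)"
    using mult_x_P10[of x n] Suc by (simp add: lessThan_Suc_atMost)
  ultimately show ?thesis
    using Suc by (simp add: P10_coeff_mult_x)
qed

lemma finite_expansion_J_op:
  assumes "finite_expansion a f"
  shows "finite_expansion (J_op a) (\<lambda>x. of_real x * f x)"
proof -
  obtain L where L: "\<And>m. m \<ge> L \<Longrightarrow> a m = 0" "f = psum a L"
    using assms by (auto simp: finite_expansion_def)
  let ?P = "\<lambda>n x. complex_of_real (P10 n x)"
  have "of_real x * f x = psum (J_op a) (Suc L) x" for x
  proof -
    have "psum (J_op a) (Suc L) x =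
        (\<Sum>m<Suc L. of_real (rec_down (Suc m)) * a (Suc m) * ?P m x) +
        (\<Sum>m<Suc L. of_real (rec_diag m) * a m * ?P m x) +
        (\<Sum>m<Suc L. rshift (\<lambda>i. of_real (rec_up i) * a i) m * ?P m x)"
      by (simp only: psum_def J_op_eq lshift_def distrib_right sum.distrib)
    also have "(\<Sum>m<Suc L. of_real (rec_down (Suc m)) * a (Suc m) * ?P m x) =
        (\<Sum>n<L. of_real (rec_down n) * a n * ?P (n - 1) x)"
    proof -
      \<comment> \<open>Shifting the index adds a term for \<open>n = 0\<close>, which is 0 because
        \<open>rec_down 0 = 0\<close>.\<close>
      have "(\<Sum>m<Suc L. of_real (rec_down (Suc m)) * a (Suc m) * ?P m x) =
          (\<Sum>n<Suc (Suc L). of_real (rec_down n) * a n * ?P (n - 1) x)"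
        by (subst (2) sum.lessThan_Suc_shift) (simp add: rec_down_def)
      then show ?thesis
        using L(1) by simp
    qed
    also have "(\<Sum>m<Suc L. of_real (rec_diag m) * a m * ?P m x) = (\<Sum>n<L. of_real (rec_diag n) * a n * ?P n x)"
      using L(1) by simp
    also have "(\<Sum>m<Suc L. rshift (\<lambda>i. of_real (rec_up i) * a i) m * ?P m x) =
        (\<Sum>n<L. of_real (rec_up n) * a n * ?P (Suc n) x)"
      by (subst sum.lessThan_Suc_shift) (simp add: rshift_def)
    also have "(\<Sum>n<L. of_real (rec_down n) * a n * ?P (n - 1) x) + (\<Sum>n<L. of_real (rec_diag n) * a n * ?P n x) +
        (\<Sum>n<L. of_real (rec_up n) * a n * ?P (Suc n) x) = (\<Sum>n<L. a n * of_real (x * P10 n x))"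
      unfolding sum.distrib[symmetric] by (intro sum.cong refl) (subst P10_recurrence, simp add: algebra_simps)
    also have "\<dots> = of_real x * f x"
      by (simp add: L(2) psum_def sum_distrib_left mult_ac)
    finally show ?thesis by simp
  qed
  moreover have "J_op a m = 0" if "m \<ge> Suc L" for m
    using L(1) that by (simp add: J_op_eq lshift_def rshift_def)
  ultimately show ?thesis
    unfolding finite_expansion_def by blast
qed

lemma finite_expansion_J_op_funpow:
  assumes "finite_expansion a f"
  shows "finite_expansion ((J_op ^^ n) a) (\<lambda>x. of_real x ^ n * f x)"
proof (induction n)
  case (Suc n)
  then show ?case
    using finite_expansion_J_op[OF Suc] by (simp add: mult.assoc)
qed (use assms in simp)

text \<open>By \<open>has_integral_P10\<close> with upper limit 1 - x, integration multiplies each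
  \<open>P10 n\<close> by its eigenvalue and by 1 - x; \<open>D_op\<close> collects the
  eigenvalues.\<close>

lemma finite_expansion_D_op:
  assumes "finite_expansion a f"
  shows "\<exists>h. finite_expansion (D_op a) h \<and> (\<forall>x\<in>{0..1}. (f has_integral of_real (1 - x) * h x) {0..1 - x})"
proof -
  obtain L where L: "\<And>m. m \<ge> L \<Longrightarrow> a m = 0" "f = psum a L"
    using assms by (auto simp: finite_expansion_def)
  have "finite_expansion (D_op a) (psum (D_op a) L)"
    unfolding finite_expansion_def using L(1) by (intro exI[of _ L]) (auto simp: D_op_def)
  moreover have "(f has_integral of_real (1 - x) * psum (D_op a) L x) {0..1 - x}" if "x \<in> {0..1}" for x
  proof -
    have "((\<lambda>y. complex_of_real (P10 n y)) has_integral of_real ((- 1) ^ n / (real n + 1) * (1 - x) * P10 n (1 - (1 - x)))) {0..1 - x}" for n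
    proof -
      have "0 \<le> 1 - x"
        using that by simp
      from has_integral_linear[OF has_integral_P10[OF this] bounded_linear_of_real] show ?thesis
        by (simp only: o_def)
    qed
    then have "((\<lambda>y. \<Sum>n<L. a n * of_real (P10 n y)) has_integral
        (\<Sum>n<L. a n * of_real ((- 1) ^ n / (real n + 1) * (1 - x) * P10 n (1 - (1 - x))))) {0..1 - x}"
      by (intro has_integral_sum has_integral_mult_right) auto
    also have "(\<Sum>n<L. a n * of_real ((- 1) ^ n / (real n + 1) * (1 - x) * P10 n (1 - (1 - x)))) =
        of_real (1 - x) * psum (D_op a) L x"
      unfolding psum_def sum_distrib_left
      by (intro sum.cong refl) (simp add: D_op_def add.commute)
    finally show ?thesis
      by (simp add: L(2) psum_def[abs_def])
  qed
  ultimately show ?thesis by blast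
qed

text \<open>For a monomial of the kernel the power of y is applied before the integration and the
  power of x after it, which accounts for the order of the factors in \<open>Vtilde\<close>.\<close>

lemma finite_expansion_Vtilde:
  assumes "finite_expansion a f"
  shows "\<exists>h. finite_expansion (Vtilde M k a) h \<and>
           (\<forall>x\<in>{0..1}. ((\<lambda>y. volterra_kernel M k x y * f y) has_integral of_real (1 - x) * h x) {0..1 - x})"
proof -
  have "\<forall>j. \<exists>h. finite_expansion (D_op ((J_op ^^ j) a)) h \<and>
      (\<forall>x\<in>{0..1}. ((\<lambda>y. of_real y ^ j * f y) has_integral of_real (1 - x) * h x) {0..1 - x})"
    using finite_expansion_D_op[OF finite_expansion_J_op_funpow[OF assms]] by blast
  then obtain G where G: "\<And>j. finite_expansion (D_op ((J_op ^^ j) a)) (G j)"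
    "\<And>j x. x \<in> {0..1} \<Longrightarrow> ((\<lambda>y. of_real y ^ j * f y) has_integral of_real (1 - x) * G j x) {0..1 - x}"
    by metis
  define h where "h = (\<lambda>x. \<Sum>n\<le>M. \<Sum>j\<le>n. k n j * (of_real x ^ (n - j) * G j x))"
  have "finite_expansion (\<lambda>m. \<Sum>n\<le>M. \<Sum>j\<le>n. k n j * (J_op ^^ (n - j)) (D_op ((J_op ^^ j) a)) m) h"
    unfolding h_def by (intro finite_expansion_sum finite_expansion_scale finite_expansion_J_op_funpow G)
  then have "finite_expansion (Vtilde M k a) h"
    by (simp add: Vtilde_def)
  moreover have "((\<lambda>y. volterra_kernel M k x y * f y) has_integral of_real (1 - x) * h x) {0..1 - x}" if "x \<in> {0..1}" for x
  proof -
    have "((\<lambda>y. \<Sum>n\<le>M. \<Sum>j\<le>n. (k n j * of_real x ^ (n - j)) * (of_real y ^ j * f y)) has_integral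
        (\<Sum>n\<le>M. \<Sum>j\<le>n. (k n j * of_real x ^ (n - j)) * (of_real (1 - x) * G j x))) {0..1 - x}"
      by (intro has_integral_sum has_integral_mult_right G(2)[OF that]) auto
    also have "(\<lambda>y. \<Sum>n\<le>M. \<Sum>j\<le>n. (k n j * of_real x ^ (n - j)) * (of_real y ^ j * f y)) =
        (\<lambda>y. volterra_kernel M k x y * f y)"
      by (simp add: volterra_kernel_def sum_distrib_right mult.assoc)
    also have "(\<Sum>n\<le>M. \<Sum>j\<le>n. (k n j * of_real x ^ (n - j)) * (of_real (1 - x) * G j x)) = of_real (1 - x) * h x"
      by (simp add: h_def sum_distrib_left mult_ac)
    finally show ?thesis .
  qed
  ultimately show ?thesis by blast
qed

section \<open>Continuity of the Volterra integral in the weighted L2 norm\<close>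

lemma volterra_kernel_bound:
  assumes "x \<in> {0..1}" "y \<in> {0..1}"
  shows "cmod (volterra_kernel M k x y) \<le> (\<Sum>n\<le>M. \<Sum>j\<le>n. cmod (k n j))"
proof -
  have "cmod (k n j * of_real x ^ (n - j) * of_real y ^ j) \<le> cmod (k n j)" for n j
  proof -
    have "\<bar>x\<bar> ^ (n - j) * \<bar>y\<bar> ^ j \<le> 1 * 1"
      using assms by (intro mult_mono power_le_one) auto
    from mult_left_mono[OF this norm_ge_zero[of "k n j"]] show ?thesis
      by (simp add: norm_mult norm_power mult.assoc)
  qed
  then show ?thesis
    unfolding volterra_kernel_def by (intro sum_norm_le)
qed

lemma continuous_on_volterra_kernel: "continuous_on S (volterra_kernel M k x)"
  unfolding volterra_kernel_def[abs_def] by (intro continuous_intros)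

lemma set_integral_unit_leb:
  fixes h :: "real \<Rightarrow> complex"
  assumes "A \<in> sets lebesgue" "A \<subseteq> {0..1}"
  shows "(LINT y:A|lebesgue. h y) = (LINT y|unit_leb. indicator A y *\<^sub>R h y)"
    and "set_integrable lebesgue A h \<longleftrightarrow> integrable unit_leb (\<lambda>y. indicator A y *\<^sub>R h y)"
proof -
  have eq: "indicator {0..1} y * indicator A y = (indicator A y :: real)" for y
    using assms(2) by (auto simp: indicator_def)
  show "(LINT y:A|lebesgue. h y) = (LINT y|unit_leb. indicator A y *\<^sub>R h y)"
    by (subst integral_restrict_space) (auto simp: set_lebesgue_integral_def eq)
  show "set_integrable lebesgue A h \<longleftrightarrow> integrable unit_leb (\<lambda>y. indicator A y *\<^sub>R h y)"
    by (subst integrable_restrict_space) (auto simp: set_integrable_def eq)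
qed

text \<open>On \<open>[0, 1 - x]\<close> the weight \<open>1 - y\<close> is at least \<open>x\<close>, so \<open>\<bar>d\<bar> \<le> (1 - y) \<bar>d\<bar>\<^sup>2 / (t x) + t\<close>.\<close>

lemma volterra_integral_bound:
  fixes M :: nat and k :: "nat \<Rightarrow> nat \<Rightarrow> complex"
  assumes [measurable]: "d \<in> borel_measurable unit_leb"
    and int: "integrable unit_leb (\<lambda>y. (1 - y) * (cmod (d y))\<^sup>2)"
    and x: "0 < x" "x < 1" and t: "0 < t"
  defines "B \<equiv> (\<Sum>n\<le>M. \<Sum>j\<le>n. cmod (k n j))"
  shows "integrable unit_leb (\<lambda>y. indicator {0..1 - x} y *\<^sub>R (volterra_kernel M k x y * d y))"
    and "cmod (LINT y|unit_leb. indicator {0..1 - x} y *\<^sub>R (volterra_kernel M k x y * d y)) \<le>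
      B * ((LINT y|unit_leb. (1 - y) * (cmod (d y))\<^sup>2) / (t * x) + t)"
proof -
  let ?f = "\<lambda>y. indicator {0..1 - x} y *\<^sub>R (volterra_kernel M k x y * d y)"
  let ?g = "\<lambda>y. B * (((1 - y) * (cmod (d y))\<^sup>2) / (t * x) + t)"
  have B: "0 \<le> B"
    unfolding B_def by (intro sum_nonneg) auto
  have [measurable]: "volterra_kernel M k x \<in> borel_measurable unit_leb"
    by (rule borel_measurable_unit_leb[OF continuous_on_volterra_kernel])
  have tint: "integrable unit_leb (\<lambda>y. t)"
    by (rule continuous_imp_integrable_real) (rule continuous_on_const)
  have g: "integrable unit_leb ?g"
    by (intro integrable_mult_right Bochner_Integration.integrable_add tint integrable_divide_zero) (use int in auto)
  have le: "cmod (?f y) \<le> ?g y" if "y \<in> space unit_leb" for y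
  proof (cases "y \<in> {0..1 - x}")
    case True
    have "cmod (d y) \<le> (cmod (d y))\<^sup>2 / t + t"
    proof -
      have "0 \<le> (cmod (d y) - t / 2)\<^sup>2" by simp
      then have "cmod (d y) * t \<le> (cmod (d y))\<^sup>2 + t * t / 4"
        by (simp add: power2_eq_square algebra_simps)
      also have "\<dots> \<le> (cmod (d y))\<^sup>2 + t * t"
        by simp
      finally have "cmod (d y) * t \<le> (cmod (d y))\<^sup>2 + t * t" .
      then show ?thesis
        using t by (simp add: field_simps power2_eq_square)
    qed
    also have "(cmod (d y))\<^sup>2 / t \<le> ((1 - y) * (cmod (d y))\<^sup>2) / (t * x)"
    proof -
      have "x * (cmod (d y))\<^sup>2 \<le> (1 - y) * (cmod (d y))\<^sup>2"
        using True by (intro mult_right_mono) auto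
      then show ?thesis
        using t x by (simp add: field_simps)
    qed
    finally have "cmod (d y) \<le> ((1 - y) * (cmod (d y))\<^sup>2) / (t * x) + t" by simp
    moreover have "cmod (volterra_kernel M k x y) \<le> B"
      unfolding B_def by (rule volterra_kernel_bound) (use x that in auto)
    ultimately have "cmod (volterra_kernel M k x y) * cmod (d y) \<le> ?g y"
      using B by (intro mult_mono) auto
    then show ?thesis
      using True by (simp add: norm_mult)
  next
    case False
    have "0 \<le> ?g y"
      using B t x that by (intro mult_nonneg_nonneg add_nonneg_nonneg divide_nonneg_nonneg) auto
    then show ?thesis
      using False by simp
  qed
  show f: "integrable unit_leb ?f"
  proof (rule Bochner_Integration.integrable_bound[OF g])
    show "AE y in unit_leb. norm (?f y) \<le> norm (?g y)"
      by (rule AE_I2) (use le in fastforce)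
  qed measurable
  have "cmod (LINT y|unit_leb. ?f y) \<le> (LINT y|unit_leb. ?g y)"
    by (rule Bochner_Integration.integral_norm_bound_integral[OF f g le])
  also have "\<dots> = B * ((LINT y|unit_leb. (1 - y) * (cmod (d y))\<^sup>2) / (t * x) + t)"
    using int tint by (simp add: measure_restrict_space)
  finally show "cmod (LINT y|unit_leb. ?f y) \<le> B * ((LINT y|unit_leb. (1 - y) * (cmod (d y))\<^sup>2) / (t * x) + t)" .
qed

definition volterra_int :: "nat \<Rightarrow> (nat \<Rightarrow> nat \<Rightarrow> complex) \<Rightarrow> (real \<Rightarrow> complex) \<Rightarrow> real \<Rightarrow> complex" where
  "volterra_int M k u x = (LINT y:{0..1 - x}|lebesgue. volterra_kernel M k x y * u y)"

lemma volterra_int_eq: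
  assumes "0 < x" "x < 1"
  shows "volterra_int M k u x = (LINT y|unit_leb. indicator {0..1 - x} y *\<^sub>R (volterra_kernel M k x y * u y))"
  unfolding volterra_int_def using assms by (intro set_integral_unit_leb) auto

lemma volterra_int_add:
  assumes "has_expansion u a" "has_expansion v b" "0 < x" "x < 1"
  shows "volterra_int M k (\<lambda>y. u y + v y) x = volterra_int M k u x + volterra_int M k v x"
proof -
  note int = volterra_integral_bound(1)[OF _ _ assms(3,4), of _ 1 M k]
  have "integrable unit_leb (\<lambda>y. indicator {0..1 - x} y *\<^sub>R (volterra_kernel M k x y * u y))"
    "integrable unit_leb (\<lambda>y. indicator {0..1 - x} y *\<^sub>R (volterra_kernel M k x y * v y))"
    using int[of u] int[of v] assms by (auto simp: has_expansion_psum)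
  from Bochner_Integration.integral_add[OF this] show ?thesis
    using assms(3,4) by (simp add: volterra_int_eq algebra_simps scaleR_add_right)
qed

lemma volterra_int_psum_tendsto:
  assumes u: "has_expansion u a" and x: "0 < x" "x < 1"
  shows "(\<lambda>N. volterra_int M k (psum a N) x) \<longlonglongrightarrow> volterra_int M k u x"
proof -
  let ?I = "\<lambda>d. (LINT y|unit_leb. indicator {0..1 - x} y *\<^sub>R (volterra_kernel M k x y * d y))"
  define E where "E = (\<lambda>N. LINT y|unit_leb. (1 - y) * (cmod (u y - psum a N y))\<^sup>2)"
  \<comment> \<open>In \<open>volterra_integral_bound\<close> the two terms E / (t x) and t balance
    for t of size sqrt E; the added 1 / (N + 1) keeps \<open>t N\<close> positive when
    \<open>E N = 0\<close>.\<close>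
  define t where "t = (\<lambda>N. sqrt (E N) + inverse (real (Suc N)))"
  define B where "B = (\<Sum>n\<le>M. \<Sum>j\<le>n. cmod (k n j))"
  note res = has_expansion_residual[OF u]
  have E: "E \<longlonglongrightarrow> 0"
    using u by (simp add: has_expansion_psum E_def)
  have E0: "0 \<le> E N" for N
    unfolding E_def by (rule integral_nonneg_AE) (auto intro!: AE_I2)
  have tpos: "0 < t N" for N
    using E0[of N] by (simp add: t_def add_nonneg_pos)
  have sE: "(\<lambda>N. sqrt (E N)) \<longlonglongrightarrow> 0"
    using tendsto_real_sqrt[OF E] by simp
  have bound: "cmod (?I (\<lambda>y. u y - psum a N y)) \<le> B * (sqrt (E N) / x + t N)" for N
  proof -
    have "E N / (t N * x) \<le> sqrt (E N) / x"
    proof -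
      have "sqrt (E N) * sqrt (E N) \<le> sqrt (E N) * t N"
        using E0 by (intro mult_left_mono) (auto simp: t_def)
      then have "E N / t N \<le> sqrt (E N)"
        using tpos[of N] E0[of N] by (simp add: field_simps)
      from divide_right_mono[OF this, of x] show ?thesis
        using x by (simp add: field_simps)
    qed
    moreover have "0 \<le> B"
      unfolding B_def by (intro sum_nonneg) auto
    ultimately have "B * (E N / (t N * x) + t N) \<le> B * (sqrt (E N) / x + t N)"
      by (intro mult_left_mono) auto
    then show ?thesis
      using volterra_integral_bound(2)[where M = M and k = k, OF res(2,3)[of N] x tpos[of N]] by (simp add: E_def B_def)
  qed
  have "(\<lambda>N. B * (sqrt (E N) / x + t N)) \<longlonglongrightarrow> B * (0 / x + (0 + 0))"
    unfolding t_def using x by (intro tendsto_intros sE LIMSEQ_inverse_real_of_nat) auto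
  then have "(\<lambda>N. B * (sqrt (E N) / x + t N)) \<longlonglongrightarrow> 0" by simp
  from Lim_null_comparison[OF always_eventually[OF allI[OF bound]] this]
  have "(\<lambda>N. ?I (\<lambda>y. u y - psum a N y)) \<longlonglongrightarrow> 0" .
  moreover have "?I (\<lambda>y. u y - psum a N y) = volterra_int M k u x - volterra_int M k (psum a N) x" for N
  proof -
    note int = volterra_integral_bound(1)[OF _ _ x, of _ 1 M k]
    have "integrable unit_leb (\<lambda>y. indicator {0..1 - x} y *\<^sub>R (volterra_kernel M k x y * u y))"
      "integrable unit_leb (\<lambda>y. indicator {0..1 - x} y *\<^sub>R (volterra_kernel M k x y * psum a N y))"
      using int[of u] int[of "psum a N"] u integrable_psum_sq by (auto simp: has_expansion_psum)
    from Bochner_Integration.integral_diff[OF this] show ?thesis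
      using x by (simp add: volterra_int_eq algebra_simps scaleR_diff_right)
  qed
  ultimately have "(\<lambda>N. volterra_int M k u x - volterra_int M k (psum a N) x) \<longlonglongrightarrow> 0"
    by simp
  from tendsto_diff[OF tendsto_const[of "volterra_int M k u x"] this] show ?thesis
    by simp
qed

lemma bounded_op_Vtilde: "bounded_op (Vtilde M k)"
proof -
  have "cmod ((- 1) ^ i / of_nat (i + 1)) \<le> 1" for i
    by (simp add: norm_divide norm_power divide_le_eq_1 del: of_nat_Suc)
  then have "bounded_op D_op"
    using bounded_op_diag[of "\<lambda>i. (- 1) ^ i / of_nat (i + 1)" 1] by (simp add: D_op_def[abs_def])
  from bounded_op_comp[OF this bounded_op_volterra_op] show ?thesis
    by (simp add: Vtilde_eq[abs_def])
qed

text \<open>Exact for the truncations of \<open>a\<close> by \<open>finite_expansion_Vtilde\<close>.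
  In the limit the functions converge pointwise on (0, 1) by
  \<open>volterra_int_psum_tendsto\<close>, and the coefficients converge in \<open>ell 0\<close>
  because \<open>Vtilde\<close> is bounded.\<close>

lemma has_expansion_volterra_int:
  assumes u: "has_expansion u a" and a: "a \<in> ell 0"
  shows "has_expansion (\<lambda>x. if 0 < x \<and> x < 1 then volterra_int M k u x / of_real (1 - x) else 0) (Vtilde M k a)"
proof -
  have "\<forall>N. \<exists>h. finite_expansion (Vtilde M k (trunc N a)) h \<and>
      (\<forall>x\<in>{0..1}. ((\<lambda>y. volterra_kernel M k x y * psum a N y) has_integral of_real (1 - x) * h x) {0..1 - x})"
  proof
    fix N
    have "finite_expansion (trunc N a) (psum a N)"
      unfolding finite_expansion_def by (intro exI[of _ N]) (auto simp: psum_trunc trunc_nth)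
    from finite_expansion_Vtilde[OF this]
    show "\<exists>h. finite_expansion (Vtilde M k (trunc N a)) h \<and>
      (\<forall>x\<in>{0..1}. ((\<lambda>y. volterra_kernel M k x y * psum a N y) has_integral of_real (1 - x) * h x) {0..1 - x})" .
  qed
  then obtain h where h: "\<And>N. finite_expansion (Vtilde M k (trunc N a)) (h N)"
    "\<And>N x. x \<in> {0..1} \<Longrightarrow> ((\<lambda>y. volterra_kernel M k x y * psum a N y) has_integral of_real (1 - x) * h N x) {0..1 - x}"
    by metis
  have hm [measurable]: "h N \<in> borel_measurable unit_leb" for N
    using h(1)[of N] by (auto simp: finite_expansion_def)
  have lim: "(\<lambda>N. h N x) \<longlonglongrightarrow> volterra_int M k u x / of_real (1 - x)" if x: "0 < x" "x < 1" for x
  proof -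
    have "volterra_int M k (psum a N) x = of_real (1 - x) * h N x" for N
    proof -
      have "set_integrable lebesgue {0..1 - x} (\<lambda>y. volterra_kernel M k x y * psum a N y)"
        by (intro absolutely_integrable_continuous_real continuous_intros continuous_on_psum continuous_on_volterra_kernel)
      from set_lebesgue_integral_eq_integral(2)[OF this] show ?thesis
        unfolding volterra_int_def using integral_unique[OF h(2)[of x N]] x by simp
    qed
    then have "(\<lambda>N. of_real (1 - x) * h N x / of_real (1 - x)) \<longlonglongrightarrow> volterra_int M k u x / of_real (1 - x)"
      using volterra_int_psum_tendsto[OF u x, of M k] x by (intro tendsto_divide tendsto_const) auto
    then show ?thesis
      using x by simp
  qed
  show ?thesis
  proof (rule has_expansion_limit[where w = h and C = "\<lambda>N. Vtilde M k (trunc N a)"])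
    \<comment> \<open>Measurability in x is inherited from the polynomials \<open>h N\<close>; the
      value 0 outside (0, 1) makes the convergence hold everywhere.\<close>
    show "(\<lambda>x. if 0 < x \<and> x < 1 then volterra_int M k u x / of_real (1 - x) else 0) \<in> borel_measurable unit_leb"
    proof (rule borel_measurable_LIMSEQ_metric)
      show "(\<lambda>x. if 0 < x \<and> x < 1 then h N x else 0) \<in> borel_measurable unit_leb" for N
        by measurable
      show "(\<lambda>N. if 0 < x \<and> x < 1 then h N x else 0) \<longlonglongrightarrow>
          (if 0 < x \<and> x < 1 then volterra_int M k u x / of_real (1 - x) else 0)" for x
        using lim by auto
    qed
    show "Vtilde M k a \<in> ell 0" "Vtilde M k (trunc N a) \<in> ell 0" for N
      using bounded_op_ell_0[OF bounded_op_Vtilde] a ell_0_trunc by blast+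
    show "\<exists>L. (\<forall>m\<ge>L. Vtilde M k (trunc N a) m = 0) \<and> h N = psum (Vtilde M k (trunc N a)) L" for N
      using h(1) by (simp add: finite_expansion_def)
    show "AE x in unit_leb. (\<lambda>N. h N x) \<longlonglongrightarrow> (if 0 < x \<and> x < 1 then volterra_int M k u x / of_real (1 - x) else 0)"
      using AE_unit_leb_neq[of 0] AE_unit_leb_neq[of 1] AE_space[of unit_leb]
      by eventually_elim (use lim in auto)
    have "(\<lambda>N. ell_norm 0 (Vtilde M k (\<lambda>i. a i - trunc N a i))) \<longlonglongrightarrow> 0"
      by (intro bounded_op_norm_tendsto_0[OF bounded_op_Vtilde] ell_0_diff_trunc_tendsto a ell_0_diff ell_0_trunc)
    then show "(\<lambda>N. ell_norm 0 (\<lambda>i. Vtilde M k (trunc N a) i - Vtilde M k a i)) \<longlonglongrightarrow> 0"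
      by (simp add: lin_op_diff[OF bounded_op_lin[OF bounded_op_Vtilde]] ell_norm_minus_commute[of "Vtilde M k a"])
  qed
qed

section \<open>From the integral equation to convergence of the truncated systems\<close>

lemma volterra_solution_iff:
  "volterra_solution M k g a \<longleftrightarrow> a \<in> ell 0 \<and> (\<exists>u. has_expansion u a \<and> (AE x in unit_leb. volterra_int M k u x = g x))"
  by (simp add: volterra_solution_def volterra_int_def)

lemma volterra_solution_imp_Vtilde:
  assumes "volterra_solution M k g a" "has_expansion (\<lambda>x. g x / of_real (1 - x)) q"
  shows "q = Vtilde M k a"
proof -
  obtain u where u: "a \<in> ell 0" "has_expansion u a" "AE x in unit_leb. volterra_int M k u x = g x"
    using assms(1) by (auto simp: volterra_solution_iff)
  have "AE x in unit_leb. g x / of_real (1 - x) =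
      (if 0 < x \<and> x < 1 then volterra_int M k u x / of_real (1 - x) else 0)"
    using u(3) AE_unit_leb_neq[of 0] AE_unit_leb_neq[of 1] AE_space[of unit_leb]
    by eventually_elim auto
  from has_expansion_unique[OF assms(2) has_expansion_volterra_int[OF u(2,1)] this] show ?thesis .
qed

text \<open>A function with coefficients \<open>v\<close> has Volterra integral 0 almost everywhere.
  Adding it to the given solution shows that \<open>a + v\<close> is another solution vector, so it
  equals \<open>a\<close>.\<close>

lemma well_posed_imp_injective:
  assumes wp: "well_posed M k g" and a: "volterra_solution M k g a"
    and v: "v \<in> ell 0" "volterra_op M k v = (\<lambda>i. 0)"
  shows "v = (\<lambda>i. 0)"
proof -
  obtain u where u: "a \<in> ell 0" "has_expansion u a" "AE x in unit_leb. volterra_int M k u x = g x"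
    using a by (auto simp: volterra_solution_iff)
  obtain w where w: "has_expansion w v"
    using riesz_fischer[OF v(1)] by blast
  have "Vtilde M k v = (\<lambda>i. 0)"
    by (simp add: Vtilde_eq v(2) D_op_def)
  then have "AE x in unit_leb. (if 0 < x \<and> x < 1 then volterra_int M k w x / of_real (1 - x) else 0) = 0"
    using has_expansion_volterra_int[OF w v(1), of M k] by (intro has_expansion_0) simp
  then have "AE x in unit_leb. volterra_int M k (\<lambda>y. u y + w y) x = g x"
    using u(3) AE_unit_leb_neq[of 0] AE_unit_leb_neq[of 1] AE_space[of unit_leb]
  proof eventually_elim
    case (elim x)
    then have x: "0 < x" "x < 1" by auto
    then show ?case
      using elim volterra_int_add[OF u(2) w x, of M k] by simp
  qed
  then have "volterra_solution M k g (\<lambda>i. a i + v i)"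
    unfolding volterra_solution_iff using has_expansion_add[OF u(2) w] ell_0_add(1)[OF u(1) v(1)] by blast
  then have "(\<lambda>i. a i + v i) = a"
    using wp a unfolding well_posed_def by blast
  then show ?thesis
    by (simp add: fun_eq_iff)
qed

text \<open>\<open>D_op\<close> is diagonal with nonzero entries and can be cancelled row by row.
  The spectral method is thus the finite section method for \<open>volterra_op\<close> with
  right-hand side \<open>D_inv q\<close>.\<close>

lemma truncated_solution_iff:
  "truncated_solution M k q n v \<longleftrightarrow> trunc n v = v \<and> trunc n (volterra_op M k v) = trunc n (D_inv q)"
proof -
  have "trunc n (Vtilde M k v) = trunc n q \<longleftrightarrow> trunc n (volterra_op M k v) = trunc n (D_inv q)"
  proof
    assume "trunc n (Vtilde M k v) = trunc n q"
    then have "D_op (volterra_op M k v) i = q i" if "i < n" for i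
      using that by (metis Vtilde_eq trunc_nth)
    then have "D_inv (D_op (volterra_op M k v)) i = D_inv q i" if "i < n" for i
      using that by (simp add: D_inv_def)
    then show "trunc n (volterra_op M k v) = trunc n (D_inv q)"
      by (auto simp: trunc_nth fun_eq_iff)
  next
    assume "trunc n (volterra_op M k v) = trunc n (D_inv q)"
    then have "volterra_op M k v i = D_inv q i" if "i < n" for i
      using that by (metis trunc_nth)
    then have "D_op (volterra_op M k v) i = D_op (D_inv q) i" if "i < n" for i
      using that by (simp add: D_op_def)
    then show "trunc n (Vtilde M k v) = trunc n q"
      by (auto simp: Vtilde_eq trunc_nth fun_eq_iff)
  qed
  then show ?thesis
    by (auto simp: truncated_solution_def)
qed

lemma trunc_trunc [simp]: "trunc n (trunc n u) = trunc n u"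
  by (auto simp: trunc_nth)

text \<open>Stability and consistency: the uniform lower bound makes the sections injective, hence
  bijective, and it bounds the error by the truncation error of \<open>a\<close> and its image under
  \<open>A\<close>, both of which tend to 0.\<close>

lemma spectral_method_converges_Vtilde:
  assumes a: "a \<in> ell 0"
    and inj: "\<And>v. v \<in> ell 0 \<Longrightarrow> volterra_op M k v = (\<lambda>i. 0) \<Longrightarrow> v = (\<lambda>i. 0)"
    and nz: "\<forall>x\<in>{0..1}. volterra_kernel M k (1 - x) x \<noteq> 0"
  shows "spectral_method_converges M k (Vtilde M k a) a"
proof -
  define A where "A = volterra_op M k"
  note bdA = bounded_op_volterra_op[of M k, folded A_def]
  note linA = bounded_op_lin[OF bdA]
  have Dq: "D_inv (Vtilde M k a) = A a"
    by (simp add: Vtilde_eq A_def)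
  have "poly (symbol_poly M k) (complex_of_real x) \<noteq> 0" if "0 \<le> x" "x \<le> 1" for x
    using nz that by (simp add: poly_symbol_poly)
  from poly_op_factorization[OF this] obtain c \<rho>s where fac: "c \<noteq> 0" "\<And>\<rho>. \<rho> \<in> set \<rho>s \<Longrightarrow> cmod \<rho> < 1"
    "poly_op (symbol_poly M k) \<simeq> (\<lambda>u i. c * lprod \<rho>s (uprod \<rho>s u) i)"
    by blast
  have "A \<simeq> (\<lambda>u i. c * lprod \<rho>s (uprod \<rho>s u) i)"
    unfolding A_def by (rule eq_cc_trans[OF volterra_op_eq_cc fac(3)])
  from finite_section_stable[OF this fac(1,2) inj[folded A_def]]
  obtain \<delta> where \<delta>: "\<delta> > 0" and
    stable: "\<forall>\<^sub>F n in sequentially. \<forall>v. trunc n v = v \<longrightarrow> \<delta> * ell_norm 0 v \<le> ell_norm 0 (trunc n (A v))"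
    by blast
  have "\<forall>\<^sub>F n in sequentially. \<exists>!v. truncated_solution M k (Vtilde M k a) n v"
    using stable
  proof eventually_elim
    case (elim n)
    have inj_n: "v = (\<lambda>i. 0)" if v: "trunc n v = v" "trunc n (A v) = (\<lambda>i. 0)" for v
    proof -
      have vE: "v \<in> ell 0"
        using ell_0_trunc[of n v] v(1) by simp
      have "\<delta> * ell_norm 0 v \<le> 0"
        using elim v by fastforce
      then have "ell_norm 0 v = 0"
        using \<delta> ell_norm_nonneg[OF vE] by (simp add: mult_le_0_iff)
      then show ?thesis
        by (rule ell_norm_eq_0D[OF vE])
    qed
    from finite_section_surj[OF linA inj_n, of n "trunc n (A a)"]
    obtain v where v: "trunc n v = v" "trunc n (A v) = trunc n (A a)"
      by auto
    show ?case
    proof (rule ex1I[of _ v])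
      show "truncated_solution M k (Vtilde M k a) n v"
        using v by (simp add: truncated_solution_iff Dq A_def)
    next
      fix w assume "truncated_solution M k (Vtilde M k a) n w"
      then have w: "trunc n w = w" "trunc n (A w) = trunc n (A a)"
        by (auto simp: truncated_solution_iff Dq A_def)
      have "(\<lambda>i. w i - v i) = (\<lambda>i. 0)"
      proof (rule inj_n)
        show "trunc n (\<lambda>i. w i - v i) = (\<lambda>i. w i - v i)"
          using w(1) v(1) by (simp add: lin_op_diff[OF trunc_lin])
        show "trunc n (A (\<lambda>i. w i - v i)) = (\<lambda>i. 0)"
          using w(2) v(2) by (simp add: lin_op_diff[OF linA] lin_op_diff[OF trunc_lin])
      qed
      then show "w = v"
        by (simp add: fun_eq_iff)
    qed
  qed
  moreover have "ell2_tendsto v a" if sol: "\<forall>\<^sub>F n in sequentially. truncated_solution M k (Vtilde M k a) n (v n)" for v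
  proof -
    define r where "r = (\<lambda>n. ell_norm 0 (\<lambda>i. a i - trunc n a i))"
    have r: "r \<longlonglongrightarrow> 0"
      unfolding r_def by (rule ell_0_diff_trunc_tendsto[OF a])
    define s where "s = (\<lambda>n. ell_norm 0 (A (\<lambda>i. a i - trunc n a i)))"
    have s: "s \<longlonglongrightarrow> 0"
      unfolding s_def by (intro bounded_op_norm_tendsto_0[OF bdA] ell_0_diff a ell_0_trunc r[unfolded r_def])
    have "\<forall>\<^sub>F n in sequentially. v n \<in> ell 0"
      using sol by eventually_elim (metis ell_0_trunc truncated_solution_def)
    moreover have "(\<lambda>n. ell_norm 0 (\<lambda>i. v n i - a i)) \<longlonglongrightarrow> 0"
    proof (rule Lim_null_comparison)
      show "\<forall>\<^sub>F n in sequentially. norm (ell_norm 0 (\<lambda>i. v n i - a i)) \<le> s n / \<delta> + r n"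
        using sol stable
      proof eventually_elim
        case (elim n)
        have vn: "trunc n (v n) = v n" "trunc n (A (v n)) = trunc n (A a)"
          using elim(1) by (auto simp: truncated_solution_iff Dq A_def)
        have vE: "v n \<in> ell 0"
          using ell_0_trunc[of n "v n"] vn(1) by simp
        \<comment> \<open>The comparison is with \<open>trunc n a\<close> instead of
          \<open>a\<close>, since the stability estimate only concerns truncated vectors.\<close>
        define d where "d = (\<lambda>i. v n i - trunc n a i)"
        have dE: "d \<in> ell 0"
          unfolding d_def by (rule ell_0_diff(1)[OF vE ell_0_trunc])
        have "trunc n d = d"
          using vn(1) by (simp add: d_def lin_op_diff[OF trunc_lin])
        then have "\<delta> * ell_norm 0 d \<le> ell_norm 0 (trunc n (A d))"
          using elim(2) by blast
        \<comment> \<open>The first \<open>n\<close> entries of \<open>A (v n)\<close> and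
          \<open>A a\<close> agree, so only the image of the tail of \<open>a\<close> is
          left.\<close>
        also have "trunc n (A d) = trunc n (A (\<lambda>i. a i - trunc n a i))"
          using vn(2) by (simp add: d_def lin_op_diff[OF linA] lin_op_diff[OF trunc_lin])
        also have "ell_norm 0 \<dots> \<le> s n"
          unfolding s_def by (intro ell_norm_trunc_le bounded_op_ell_0[OF bdA] ell_0_diff a ell_0_trunc)
        finally have "ell_norm 0 d \<le> s n / \<delta>"
          using \<delta> by (simp add: field_simps)
        moreover have "ell_norm 0 (\<lambda>i. v n i - a i) \<le> ell_norm 0 d + r n"
          using ell_0_diff(2)[OF dE ell_0_diff(1)[OF a ell_0_trunc[of n a]]] by (simp add: d_def r_def)
        ultimately show ?case
          using ell_norm_nonneg[OF ell_0_diff(1)[OF vE a]] by simp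
      qed
      have "(\<lambda>n. s n / \<delta> + r n) \<longlonglongrightarrow> 0 / \<delta> + 0"
        using \<delta> by (intro tendsto_intros s r) auto
      then show "(\<lambda>n. s n / \<delta> + r n) \<longlonglongrightarrow> 0" by simp
    qed
    ultimately show ?thesis
      using a by (simp add: ell2_tendsto_def)
  qed
  ultimately show ?thesis
    by (simp add: spectral_method_converges_def)
qed

theorem theorem5p8:
  fixes M :: nat and k :: "nat \<Rightarrow> nat \<Rightarrow> complex"
  shows
    "(\<forall>(g :: real \<Rightarrow> complex) (u :: nat \<Rightarrow> complex) (q :: nat \<Rightarrow> complex).
        well_posed M k g \<longrightarrow>
        volterra_solution M k g u \<longrightarrow>
        has_expansion (\<lambda>x. g x / of_real (1 - x)) q \<longrightarrow>
        q \<in> ell 1 \<longrightarrow>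
        symbol_nonvanishing (Vtilde M k) \<longrightarrow>
        spectral_method_converges M k q u)
     \<and> (symbol_nonvanishing (Vtilde M k) \<longleftrightarrow> (\<forall>x\<in>{0..1}. volterra_kernel M k (1 - x) x \<noteq> 0))"
proof (intro conjI allI impI)
  fix g :: "real \<Rightarrow> complex" and u q :: "nat \<Rightarrow> complex"
  assume wp: "well_posed M k g" and u: "volterra_solution M k g u"
    and q: "has_expansion (\<lambda>x. g x / of_real (1 - x)) q" and nz: "symbol_nonvanishing (Vtilde M k)"
  have "u \<in> ell 0"
    using u by (simp add: volterra_solution_def)
  then have "spectral_method_converges M k (Vtilde M k u) u"
    using well_posed_imp_injective[OF wp u] nz
    by (intro spectral_method_converges_Vtilde) (auto simp: symbol_nonvanishing_iff)
  then show "spectral_method_converges M k q u"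
    using volterra_solution_imp_Vtilde[OF u q] by simp
qed (rule symbol_nonvanishing_iff)

end
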